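(* Let $n\ge 3$, $R\ge 1$ and $\ell$ be integers with $\ell>\max\{n+1,\frac n2+4\}$. Let $\mathbf{x}_0\in\mathbb{R}^n$ and let $f_1,\dots,f_R\in\mathcal{C}^{\ell}(\mathbb{R}^n)$ be real-valued functions such that for every $\mathbf{t}=(t_1,\dots,t_R)\in\mathbb{R}^R\setminus\{\mathbf 0\}$ $$\operatorname{rank} H_{t_1f_1+\cdots+t_Rf_R}(\mathbf{x}_0)\ge n-1 .$$ Then, provided $\varepsilon_0>0$ is sufficiently small and $\omega\in\mathcal{C}_c^\infty(\mathbb{R}^n)$ is a non-negative weight function supported in a sufficiently small neighbourhood of $\mathbf{x}_0$ (that is, there is $\varepsilon_*>0$, depending only on $n,R,\mathbf{x}_0,f_1,\dots,f_R$, such that the following holds whenever $0<\varepsilon_0\le\varepsilon_*$ and $\operatorname{supp}\omega\subseteq B_{\varepsilon_*}(\mathbf{x}_0)$), there exist positive constants $\mathfrak{c}_1,\mathfrak{c}_2$ and $C$, depending only on $\mathscr{M}$ and $\omega$, such that for all integers $Q\ge 2$ and all real $0\le\delta\le\frac12$ $$\left|N_\omega(Q,\delta)-(2\delta)^RN_0\right|\le C\cdot\begin{cases}\delta^{\frac{(R-1)(n-1)}{n+1}}\,Q^{\,n+\frac{2}{n+1}}\,\mathscr{E}_{n-1}(Q) & \text{if }\delta\ge Q^{-\frac{n-1}{n+2R-1}},\\[4pt] Q^{\,n-\frac{(R-1)n+1-3R}{n+2R-1}}\,\mathscr{E}_{n-1}(Q) & \text{if }\delta< Q^{-\frac{n-1}{n+2R-1}},\end{cases}$$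 where $$\mathscr{E}_{n-1}(Q)=\begin{cases}\exp(\mathfrak{c}_1\sqrt{\log Q}) & \text{if } n=3,\\ (\log Q)^{\mathfrak{c}_2} & \text{if } n\ge 4.\end{cases}$$
   Context: $|\cdot|$ is the $L^\infty$-norm on $\mathbb{R}^n$ and $B_\varepsilon(\mathbf{x}_0)=\{\mathbf{x}\in\mathbb{R}^n: |\mathbf{x}-\mathbf{x}_0|<\varepsilon\}$. $H_f(\mathbf{x})$ is the $n\times n$ Hessian matrix of $f$ at $\mathbf{x}$. For $\theta\in\mathbb{R}$, $\|\theta\|$ is the distance from $\theta$ to the nearest integer. The manifold is $$\mathscr{M}=\{(\mathbf{x},f_1(\mathbf{x}),\dots,f_R(\mathbf{x}))\in\mathbb{R}^{n+R}:\ \mathbf{x}\in\overline{B_{\varepsilon_0}(\mathbf{x}_0)}\}.$$ The counting functions (with $q$ ranging over positive integers) are $$N_\omega(Q,\delta)=\sum_{\substack{\mathbf{a}\in\mathbb{Z}^n,\ 1\le q\le Q\\ \|qf_r(\mathbf{a}/q)\|\le\delta\ (1\le r\le R)}}\omega\!\left(\frac{\mathbf{a}}{q}\right),\qquad N_0=\sum_{\mathbf{a}\in\mathbb{Z}^n,\ 1\le q\le Q}\omega\!\left(\frac{\mathbf{a}}{q}\right).$$ *)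

theory Defs
  imports "HOL-Analysis.Analysis"
begin

definition linf_ball :: "real^'n \<Rightarrow> real \<Rightarrow> (real^'n) set" where
  "linf_ball x0 \<epsilon> = {x. infnorm (x - x0) < \<epsilon>}"

definition partial_derivative :: "'n \<Rightarrow> (real^'n \<Rightarrow> real) \<Rightarrow> real^'n \<Rightarrow> real" where
  "partial_derivative i f x = frechet_derivative f (at x) (axis i 1)"

text \<open>Membership in \<open>C\<^sup>k(\<real>\<^sup>n)\<close>.\<close>

fun cont_diff :: "nat \<Rightarrow> (real^'n \<Rightarrow> real) \<Rightarrow> bool" where
  "cont_diff 0 f \<longleftrightarrow> continuous_on UNIV f"
| "cont_diff (Suc k) f \<longleftrightarrow>
     (\<forall>x. f differentiable (at x)) \<and> (\<forall>i. cont_diff k (partial_derivative i f))"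

definition function_support :: "(real^'n \<Rightarrow> real) \<Rightarrow> (real^'n) set" where
  "function_support w = closure {x. w x \<noteq> 0}"

definition smooth_compact_support :: "(real^'n \<Rightarrow> real) \<Rightarrow> bool" where
  "smooth_compact_support w \<longleftrightarrow> (\<forall>k. cont_diff k w) \<and> compact (function_support w)"

definition hessian :: "(real^'n \<Rightarrow> real) \<Rightarrow> real^'n \<Rightarrow> real^'n^'n" where
  "hessian f x = (\<chi> i j. partial_derivative i (partial_derivative j f) x)"

text \<open>The number \<open>R\<close> of functions is the cardinality of the index type \<open>'r\<close>, and
  \<open>\<real>\<^sup>n\<^sup>+\<^sup>R\<close> is represented as \<open>\<real>\<^sup>n \<times> \<real>\<^sup>R\<close>.\<close>

definition graph_manifold ::
  "('r::finite \<Rightarrow> real^'n \<Rightarrow> real) \<Rightarrow> real^'n \<Rightarrow> real \<Rightarrow> ((real^'n) \<times> (real^'r)) set" where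
  "graph_manifold f x0 \<epsilon> = {(x, \<chi> r. f r x) | x. x \<in> closure (linf_ball x0 \<epsilon>)}"

definition nearest_int_dist :: "real \<Rightarrow> real" where
  "nearest_int_dist \<theta> = infdist \<theta> \<int>"

definition rational_point :: "int^'n \<Rightarrow> nat \<Rightarrow> real^'n" where
  "rational_point a q = (\<chi> i. real_of_int (a $ i) / real q)"

text \<open>The sums below are over infinite index sets; for compactly supported \<open>w\<close> only
  finitely many terms are nonzero, so \<open>infsum\<close> is the ordinary sum of these terms.\<close>

definition weighted_count ::
  "('r::finite \<Rightarrow> real^'n \<Rightarrow> real) \<Rightarrow> (real^'n \<Rightarrow> real) \<Rightarrow> nat \<Rightarrow> real \<Rightarrow> real" where
  "weighted_count f w Q \<delta> =
     (\<Sum>\<^sub>\<infinity>(a, q) \<in> {(a, q). 1 \<le> q \<and> q \<le> Q \<and>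
                      (\<forall>r. nearest_int_dist (real q * f r (rational_point a q)) \<le> \<delta>)}.
        w (rational_point a q))"

definition total_weight :: "(real^'n \<Rightarrow> real) \<Rightarrow> nat \<Rightarrow> real" where
  "total_weight w Q =
     (\<Sum>\<^sub>\<infinity>(a, q) \<in> {(a, q). 1 \<le> q \<and> q \<le> Q}. w (rational_point a q))"

text \<open>\<open>log_factor n c1 c2 Q\<close> is \<open>\<E>\<^bsub>n-1\<^esub>(Q)\<close>: the index is shifted by one.\<close>

definition log_factor :: "nat \<Rightarrow> real \<Rightarrow> real \<Rightarrow> nat \<Rightarrow> real" where
  "log_factor n c1 c2 Q =
     (if n = 3 then exp (c1 * sqrt (ln (real Q))) else ln (real Q) powr c2)"

definition error_bound :: "real \<Rightarrow> real \<Rightarrow> nat \<Rightarrow> real \<Rightarrow> real" where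
  "error_bound n R Q \<delta> =
     (if \<delta> \<ge> real Q powr (- ((n - 1) / (n + 2 * R - 1)))
      then \<delta> powr ((R - 1) * (n - 1) / (n + 1)) * real Q powr (n + 2 / (n + 1))
      else real Q powr (n - ((R - 1) * n + 1 - 3 * R) / (n + 2 * R - 1)))"

end

theory Submission
  imports Defs
begin

text \<open>Detect \<open>\<parallel>q f\<^sub>r(a/q)\<parallel> \<le> \<delta>\<close> by trigonometric polynomials of degree \<open>J\<close>. Each nonzero frequency \<open>j\<close> leads, for
  every single \<open>q\<close>, to the sum over \<open>a\<close> of \<open>w(a/q) e(q F(a/q))\<close> with \<open>F = \<Sum>\<^sub>r j\<^sub>r f\<^sub>r\<close>. Split \<open>a\<close> into boxes of side
  \<open>L = sqrt(q/|j|)\<close>; on a box the phase is linear up to a bounded smooth remainder, so the box contributes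
  about \<open>\<Prod>\<^sub>i min(L, 1/\<parallel>\<partial>\<^sub>iF\<parallel>)\<close>. Since the Hessian has rank at least \<open>n - 1\<close>, the gradient is bi-Lipschitz on the
  slices \<open>x\<^sub>k = const\<close> for some \<open>k\<close>, so the gradients at the boxes of a slice are separated by about \<open>1/L\<close> and
  summing over boxes gives \<open>q (q|j|)\<^bsup>(n-1)/2\<^esup>\<close> up to logarithms. Optimising \<open>J\<close> yields exactly the first error term;
  the second follows from it by monotonicity in \<open>\<delta>\<close>. No averaging over \<open>q\<close> is needed.\<close>

section \<open>Mixed differences and summation by parts\<close>

text \<open>Why treating one \<open>q\<close> at a time loses so little: a slice coordinate takes
  about q/L values, and since the gradient of F moves by about |j| over the support, each slice
  splits into about |j|^(n-1) cells on which it cannot wrap around modulo 1. On a cell the separated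
  gradients meet each residue class of width 1/L boundedly often, and the geometric weights of all
  L^n classes sum to L^n up to logarithms. With L = sqrt(q/|j|) the product is q (q|j|)^((n-1)/2):
  the degenerate direction costs one full factor q and nothing more. For degree Y the nonzero
  frequencies then give Q^2 (QY)^((n-1)/2), while blurring the ends of the interval gives
  \<delta>^(R-1) Q^(n+1) / Y. Equality determines Y, and the two ranges of \<delta> meet where Y
  \<delta> = 1, that is, where an interval of length \<delta> is just resolved at degree Y. Every
  further loss is a fixed power of log Q, which both forms of the logarithmic factor absorb.\<close>

text \<open>For distinct directions: on the box [0, p] every mixed difference, at most one per
  listed direction, is bounded by \<open>B\<close> over \<open>L\<close> to the number of
  differences. A difference looks at the neighbour \<open>Suc (u i)\<close>, so it lives on the box
  shortened by one in direction \<open>i\<close>; the guard \<open>0 < p i\<close> excludes the case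
  where truncated subtraction would not shorten it.\<close>

fun bounded_differences :: "real \<Rightarrow> 'n list \<Rightarrow> real \<Rightarrow> ('n \<Rightarrow> nat) \<Rightarrow> (('n \<Rightarrow> nat) \<Rightarrow> complex) \<Rightarrow> bool" where
  "bounded_differences L [] B p A \<longleftrightarrow> (\<forall>u. u \<le> p \<longrightarrow> cmod (A u) \<le> B)"
| "bounded_differences L (i # is) B p A \<longleftrightarrow> bounded_differences L is B p A \<and>
     (0 < p i \<longrightarrow> bounded_differences L is (B / L) (p(i := p i - 1)) (\<lambda>u. A (u(i := Suc (u i))) - A u))"

lemma bounded_differences_mono:
  assumes "bounded_differences L is B p A" "B \<le> B'" "p' \<le> p" "L > 0"
  shows "bounded_differences L is B' p' A"
  using assms
proof (induction "is" arbitrary: B B' p p' A)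
  case Nil
  then show ?case by (auto intro: order_trans)
next
  case (Cons i "is")
  have "p'(i := p' i - 1) \<le> p(i := p i - 1)"
    using Cons.prems(3) by (auto simp: le_fun_def diff_le_mono)
  moreover have "B / L \<le> B' / L"
    using Cons.prems by (simp add: divide_right_mono)
  moreover have "0 < p' i \<Longrightarrow> 0 < p i"
    using Cons.prems(3) by (simp add: le_fun_def order_less_le_trans)
  ultimately show ?case
    unfolding bounded_differences.simps
    using Cons.prems(1)[unfolded bounded_differences.simps] Cons.prems(2-4) by (blast intro: Cons.IH)
qed

lemma bounded_differences_zero: "B \<ge> 0 \<Longrightarrow> L > 0 \<Longrightarrow> bounded_differences L is B p (\<lambda>u. 0)"
  by (induction "is" arbitrary: B p) auto

lemma bounded_differences_const:
  "cmod c \<le> B \<Longrightarrow> L > 0 \<Longrightarrow> bounded_differences L is B p (\<lambda>u. c)"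
proof (induction "is" arbitrary: B p)
  case (Cons i "is")
  have "B / L \<ge> 0" using Cons.prems norm_ge_zero[of c] by (meson divide_nonneg_pos order_trans)
  then show ?case using Cons by (auto intro: bounded_differences_zero)
qed auto

lemma bounded_differences_add:
  assumes "bounded_differences L is B p A" "bounded_differences L is B' p A'"
  shows "bounded_differences L is (B + B') p (\<lambda>u. A u + A' u)"
  using assms
proof (induction "is" arbitrary: B B' p A A')
  case Nil
  then show ?case by (auto intro: order_trans[OF norm_triangle_ineq] add_mono)
next
  case (Cons i "is")
  have eq: "(\<lambda>u. A (u(i := Suc (u i))) + A' (u(i := Suc (u i))) - (A u + A' u))
     = (\<lambda>u. (A (u(i := Suc (u i))) - A u) + (A' (u(i := Suc (u i))) - A' u))"
    by auto
  show ?case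
    using Cons.prems Cons.IH unfolding bounded_differences.simps eq add_divide_distrib by blast
qed

lemma bounded_differences_cmult:
  assumes "bounded_differences L is B p A"
  shows "bounded_differences L is (cmod c * B) p (\<lambda>u. c * A u)"
  using assms
proof (induction "is" arbitrary: B p A)
  case Nil
  then show ?case by (auto simp: norm_mult mult_left_mono)
next
  case (Cons i "is")
  have eq: "(\<lambda>u. c * A (u(i := Suc (u i))) - c * A u) = (\<lambda>u. c * (A (u(i := Suc (u i))) - A u))"
    by (auto simp: algebra_simps)
  have "bounded_differences L is (cmod c * B) p (\<lambda>u. c * A u)"
    using Cons.prems by (intro Cons.IH) simp
  moreover have "bounded_differences L is (cmod c * (B / L)) (p(i := p i - 1))
      (\<lambda>u. c * (A (u(i := Suc (u i))) - A u))" if "0 < p i"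
  proof -
    have "bounded_differences L is (B / L) (p(i := p i - 1)) (\<lambda>u. A (u(i := Suc (u i))) - A u)"
      using Cons.prems that by simp
    then show ?thesis by (rule Cons.IH)
  qed
  ultimately show ?case unfolding bounded_differences.simps eq by simp
qed

text \<open>In the discrete product rule one factor is evaluated at the shifted argument; this
  supplies its bound on the shortened box. The induction works because shifts and box shortenings
  commute, also when the two directions coincide.\<close>

lemma bounded_differences_shift:
  assumes "bounded_differences L is B p A" "0 < p i"
  shows "bounded_differences L is B (p(i := p i - 1)) (\<lambda>u. A (u(i := Suc (u i))))"
  using assms
proof (induction "is" arbitrary: B p A)
  case Nil
  show ?case
    unfolding bounded_differences.simps
  proof (intro allI impI)
    fix u assume "u \<le> p(i := p i - 1)"
    then have le: "u j \<le> (p(i := p i - 1)) j" for j by (simp only: le_fun_def)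
    have "(u(i := Suc (u i))) j \<le> p j" for j
      using Nil.prems(2) le[of i] le[of j] by (cases "j = i") simp_all
    then have "u(i := Suc (u i)) \<le> p" by (rule le_funI)
    then show "cmod (A (u(i := Suc (u i)))) \<le> B" using Nil.prems by simp
  qed
next
  case (Cons j "is")
  have "bounded_differences L is B p A" using Cons.prems by simp
  from Cons.IH[OF this Cons.prems(2)]
  have 1: "bounded_differences L is B (p(i := p i - 1)) (\<lambda>u. A (u(i := Suc (u i))))" .
  have 2: "bounded_differences L is (B / L) ((p(i := p i - 1))(j := (p(i := p i - 1)) j - 1))
     (\<lambda>u. A ((u(j := Suc (u j)))(i := Suc ((u(j := Suc (u j))) i))) - A (u(i := Suc (u i))))"
    if pos: "0 < (p(i := p i - 1)) j"
  proof -
    have pj: "0 < p j" using pos by (cases "j = i") auto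
    have D: "bounded_differences L is (B / L) (p(j := p j - 1)) (\<lambda>u. A (u(j := Suc (u j))) - A u)"
      using Cons.prems pj by simp
    have "0 < (p(j := p j - 1)) i" using pos Cons.prems(2) by (cases "j = i") auto
    note R = Cons.IH[OF D this]
    have comm: "(p(i := p i - 1))(j := (p(i := p i - 1)) j - 1) = (p(j := p j - 1))(i := (p(j := p j - 1)) i - 1)"
      "\<And>u. (u(j := Suc (u j)))(i := Suc ((u(j := Suc (u j))) i)) = (u(i := Suc (u i)))(j := Suc ((u(i := Suc (u i))) j))"
      by (cases "j = i"; simp add: fun_upd_twist)+
    show ?thesis unfolding comm by (rule R)
  qed
  show ?case unfolding bounded_differences.simps by (intro conjI impI 1) (rule 2)
qed

text \<open>Discrete Leibniz rule: the difference of a product is the difference of \<open>A\<close>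
  times the shifted \<open>A'\<close> plus \<open>A\<close> times the difference of
  \<open>A'\<close>. Each direction doubles the number of terms, whence
  \<open>2 ^ length is\<close>.\<close>

lemma bounded_differences_mult:
  assumes "bounded_differences L is B p A" "bounded_differences L is B' p A'" "L > 0"
  shows "bounded_differences L is (2 ^ length is * B * B') p (\<lambda>u. A u * A' u)"
  using assms
proof (induction "is" arbitrary: B B' p A A')
  case Nil
  show ?case
  proof (simp, intro allI impI)
    fix u assume "u \<le> p"
    then have "cmod (A u) \<le> B" "cmod (A' u) \<le> B'" using Nil.prems by auto
    then show "cmod (A u * A' u) \<le> B * B'"
      unfolding norm_mult by (intro mult_mono) (auto intro: order_trans[OF norm_ge_zero])
  qed
next
  case (Cons i "is")
  \<comment> \<open>The box is never empty, so a bound for norms on it is nonnegative.\<close>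
  have B: "B \<ge> 0" "B' \<ge> 0"
  proof -
    have "\<And>B A. bounded_differences L js B p A \<Longrightarrow> B \<ge> 0" for js :: "'a list"
      by (induction js) (auto intro: order_trans[OF norm_ge_zero])
    then show "B \<ge> 0" "B' \<ge> 0" using Cons.prems by blast+
  qed
  have 1: "bounded_differences L is (2 ^ length is * B * B') p (\<lambda>u. A u * A' u)"
    using Cons by simp
  moreover have "2 ^ length is * B * B' \<le> 2 ^ length (i # is) * B * B'"
    using B by (simp add: mult_right_mono)
  ultimately have 1: "bounded_differences L is (2 ^ length (i # is) * B * B') p (\<lambda>u. A u * A' u)"
    using Cons.prems(3) by (blast intro: bounded_differences_mono order_refl)
  have 2: "bounded_differences L is (2 ^ length (i # is) * B * B' / L) (p(i := p i - 1))
     (\<lambda>u. A (u(i := Suc (u i))) * A' (u(i := Suc (u i))) - A u * A' u)" if pos: "0 < p i"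
  proof -
    let ?p = "p(i := p i - 1)"
    have le: "?p \<le> p" by (simp add: le_fun_def)
    have D: "bounded_differences L is (B / L) ?p (\<lambda>u. A (u(i := Suc (u i))) - A u)"
      "bounded_differences L is (B' / L) ?p (\<lambda>u. A' (u(i := Suc (u i))) - A' u)"
      using Cons.prems pos by simp_all
    have A': "bounded_differences L is B' p A'" and A: "bounded_differences L is B p A"
      using Cons.prems by simp_all
    have "bounded_differences L is (2 ^ length is * (B / L) * B') ?p
        (\<lambda>u. (A (u(i := Suc (u i))) - A u) * A' (u(i := Suc (u i))))"
      by (rule Cons.IH[OF D(1) bounded_differences_shift[OF A' pos] Cons.prems(3)])
    moreover have "bounded_differences L is (2 ^ length is * B * (B' / L)) ?p
        (\<lambda>u. A u * (A' (u(i := Suc (u i))) - A' u))"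
      by (rule Cons.IH[OF bounded_differences_mono[OF A order_refl le Cons.prems(3)] D(2) Cons.prems(3)])
    ultimately have "bounded_differences L is (2 ^ length is * (B / L) * B' + 2 ^ length is * B * (B' / L)) ?p
        (\<lambda>u. (A (u(i := Suc (u i))) - A u) * A' (u(i := Suc (u i))) + A u * (A' (u(i := Suc (u i))) - A' u))"
      by (rule bounded_differences_add)
    then show ?thesis by (simp add: algebra_simps)
  qed
  show ?case using 1 2 by simp
qed

lemma bounded_differences_power:
  assumes "bounded_differences L is B p A" "L > 0"
  shows "bounded_differences L is ((2 ^ length is * B) ^ k) p (\<lambda>u. A u ^ k)"
proof (induction k)
  case 0
  then show ?case using assms by (auto intro: bounded_differences_const)
next
  case (Suc k)
  have "bounded_differences L is (2 ^ length is * B * (2 ^ length is * B) ^ k) p (\<lambda>u. A u * A u ^ k)"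
    using assms Suc by (intro bounded_differences_mult) auto
  then show ?case by simp
qed

lemma bounded_differences_sum:
  assumes "\<And>k. k < (N::nat) \<Longrightarrow> bounded_differences L is (B k) p (A k)" "L > 0"
  shows "bounded_differences L is (\<Sum>k<N. B k) p (\<lambda>u. \<Sum>k<N. A k u)"
  using assms(1)
proof (induction N)
  case 0
  then show ?case using assms(2) by (auto intro: bounded_differences_zero)
next
  case (Suc N)
  then show ?case by (auto intro!: bounded_differences_add)
qed

lemma bounded_differences_limit:
  assumes "\<And>N. bounded_differences L is B p (A N)" "\<And>u. (\<lambda>N. A N u) \<longlonglongrightarrow> A' u"
  shows "bounded_differences L is B p A'"
  using assms
proof (induction "is" arbitrary: B p A A')
  case Nil
  show ?case
    unfolding bounded_differences.simps
  proof (intro allI impI)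
    fix u assume "u \<le> p"
    then show "cmod (A' u) \<le> B"
      using Nil.prems(1) by (intro LIMSEQ_le_const2[OF tendsto_norm[OF Nil.prems(2)]]) auto
  qed
next
  case (Cons i "is")
  have "bounded_differences L is (B / L) (p(i := p i - 1)) (\<lambda>u. A' (u(i := Suc (u i))) - A' u)"
    if "0 < p i"
  proof (rule Cons.IH)
    show "bounded_differences L is (B / L) (p(i := p i - 1)) (\<lambda>u. A N (u(i := Suc (u i))) - A N u)" for N
      using Cons.prems(1)[of N] that by simp
    show "(\<lambda>N. A N (u(i := Suc (u i))) - A N u) \<longlonglongrightarrow> A' (u(i := Suc (u i))) - A' u" for u
      by (intro tendsto_diff Cons.prems(2))
  qed
  moreover have "bounded_differences L is B p A'"
    using Cons.prems(1) by (intro Cons.IH[OF _ Cons.prems(2)]) simp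
  ultimately show ?case by simp
qed

text \<open>The bounds form a Banach algebra norm up to the factor \<open>2 ^ length is\<close>, so the exponential
  is controlled through its power series.\<close>

lemma bounded_differences_exp:
  assumes "bounded_differences L is B p A" "L > 0" "B \<ge> 0"
  shows "bounded_differences L is (exp (2 ^ length is * B)) p (\<lambda>u. exp (A u))"
proof (rule bounded_differences_limit)
  let ?B = "2 ^ length is * B"
  show "bounded_differences L is (exp ?B) p (\<lambda>u. \<Sum>k<N. A u ^ k /\<^sub>R fact k)" for N
  proof -
    have "bounded_differences L is (\<Sum>k<N. inverse (fact k) * ?B ^ k) p (\<lambda>u. \<Sum>k<N. A u ^ k /\<^sub>R fact k)"
    proof (rule bounded_differences_sum)
      fix k
      show "bounded_differences L is (inverse (fact k) * ?B ^ k) p (\<lambda>u. A u ^ k /\<^sub>R fact k)"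
        using bounded_differences_cmult[OF bounded_differences_power[OF assms(1,2)], of "of_real (inverse (fact k))" k]
        by (simp add: scaleR_conv_of_real norm_inverse)
    qed fact
    moreover have "(\<Sum>k<N. inverse (fact k) * ?B ^ k) \<le> exp ?B"
      using assms(3) sum_le_suminf[OF summable_exp_generic[of ?B], of "{..<N}"]
      by (simp add: exp_def)
    ultimately show ?thesis using assms(2) by (blast intro: bounded_differences_mono order_refl)
  qed
  show "(\<lambda>N. \<Sum>k<N. A u ^ k /\<^sub>R fact k) \<longlonglongrightarrow> exp (A u)" for u
    using exp_converges[of "A u"] by (simp add: sums_def)
qed

section \<open>Abel summation over a box\<close>

fun iterated_sum :: "nat \<Rightarrow> ('n \<Rightarrow> complex) \<Rightarrow> 'n list \<Rightarrow> (('n \<Rightarrow> nat) \<Rightarrow> complex) \<Rightarrow> ('n \<Rightarrow> nat) \<Rightarrow> complex" where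
  "iterated_sum N z [] A u = A u"
| "iterated_sum N z (i # is) A u = (\<Sum>k<N. z i ^ k * iterated_sum N z is A (u(i := k)))"

text \<open>The variable \<open>i\<close> is not summed, so differencing in it passes through the
  sums onto the amplitude; Abel summation in direction \<open>i\<close> thus meets inner sums of the
  same shape.\<close>

lemma iterated_sum_diff:
  assumes "i \<notin> set is"
  shows "iterated_sum N z is A (v(i := Suc k)) - iterated_sum N z is A (v(i := k))
    = iterated_sum N z is (\<lambda>u. A (u(i := Suc (u i))) - A u) (v(i := k))"
  using assms
proof (induction "is" arbitrary: v)
  case (Cons j "is")
  then have "j \<noteq> i" by auto
  then have tw: "\<And>k l. v(i := k, j := l) = v(j := l, i := k)" by (simp add: fun_upd_twist)
  have "i \<notin> set is" using Cons.prems by simp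
  from Cons.IH[OF this] show ?case
    unfolding iterated_sum.simps tw sum_subtractf[symmetric] right_diff_distrib[symmetric]
    by (simp del: fun_upd_apply)
qed auto

lemma summation_by_parts:
  fixes T z :: "nat \<Rightarrow> complex"
  shows "(\<Sum>k<Suc N. z k * T k) = T N * (\<Sum>k<Suc N. z k) - (\<Sum>k<N. (T (Suc k) - T k) * (\<Sum>j<Suc k. z j))"
  by (induction N) (auto simp: algebra_simps)

text \<open>Abel summation in the head direction leaves a boundary term and \<open>N - 1\<close>
  increments of the inner sum \<open>T\<close>. By induction \<open>T\<close> is at most
  \<open>B * ?P\<close> and its increments at most \<open>B / N * ?P\<close>, so the boundary and
  the increments each cost one factor \<open>G i\<close>, hence \<open>2 * G i\<close> per
  direction. Side \<open>N\<close> is required of \<open>p\<close> only in the directions still to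
  be summed, because a differenced direction has a shorter box.\<close>

lemma iterated_sum_bound:
  assumes "distinct is" "bounded_differences (real N) is B p A" "\<And>i. i \<in> set is \<Longrightarrow> p i = N" "N > 0" "u \<le> p" "B \<ge> 0"
    and "\<And>i K. i \<in> set is \<Longrightarrow> K \<le> N \<Longrightarrow> cmod (\<Sum>k<K. z i ^ k) \<le> G i"
  shows "cmod (iterated_sum N z is A u) \<le> B * (\<Prod>i\<in>set is. 2 * G i)"
  using assms
proof (induction "is" arbitrary: A B p u)
  case Nil
  then show ?case by simp
next
  case (Cons i "is")
  let ?P = "\<Prod>i\<in>set is. 2 * G i"
  define T where "T k = iterated_sum N z is A (u(i := k))" for k
  obtain N' where N': "N = Suc N'" using Cons.prems by (cases N) auto
  have i: "i \<notin> set is" using Cons.prems by simp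
  have G0: "G j \<ge> 0" if "j \<in> set (i # is)" for j
    using Cons.prems(7)[OF that, of 0] by simp
  then have P0: "?P \<ge> 0" by (intro prod_nonneg) auto
  have T1: "cmod (T k) \<le> B * ?P" if "k \<le> N" for k
    unfolding T_def
  proof (rule Cons.IH)
    show "u(i := k) \<le> p" using Cons.prems that by (auto simp: le_fun_def)
  qed (use Cons.prems in auto)
  have T2: "cmod (T (Suc k) - T k) \<le> B / N * ?P" if "k < N" for k
    unfolding T_def iterated_sum_diff[OF i]
  proof (rule Cons.IH)
    show "bounded_differences (real N) is (B / N) (p(i := p i - 1)) (\<lambda>u. A (u(i := Suc (u i))) - A u)"
      using Cons.prems by simp
    show "u(i := k) \<le> p(i := p i - 1)" using Cons.prems that by (auto simp: le_fun_def)
  qed (use Cons.prems i in \<open>auto simp: divide_nonneg_nonneg\<close>)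
  have "iterated_sum N z (i # is) A u = (\<Sum>k<N. z i ^ k * T k)" by (simp add: T_def)
  also have "\<dots> = T N' * (\<Sum>k<N. z i ^ k) - (\<Sum>k<N'. (T (Suc k) - T k) * (\<Sum>j<Suc k. z i ^ j))"
    unfolding N' by (rule summation_by_parts)
  also have "cmod \<dots> \<le> cmod (T N' * (\<Sum>k<N. z i ^ k)) + (\<Sum>k<N'. cmod ((T (Suc k) - T k) * (\<Sum>j<Suc k. z i ^ j)))"
    by (intro order_trans[OF norm_triangle_ineq4] add_mono order_refl norm_sum)
  also have "\<dots> \<le> B * ?P * G i + (\<Sum>k<N'. B / N * ?P * G i)"
    unfolding norm_mult
  proof (intro add_mono sum_mono mult_mono)
    show "cmod (T N') \<le> B * ?P" by (rule T1) (simp add: N')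
    show "cmod (\<Sum>k<N. z i ^ k) \<le> G i" by (rule Cons.prems) auto
    fix k assume k: "k \<in> {..<N'}"
    show "cmod (T (Suc k) - T k) \<le> B / N * ?P" using k N' by (intro T2) auto
    show "cmod (\<Sum>j<Suc k. z i ^ j) \<le> G i" using k N' by (intro Cons.prems(7)) auto
  qed (use P0 Cons.prems(6) in auto)
  also have "\<dots> = B * ?P * G i * (1 + N' / N)" by (simp add: algebra_simps)
  also have "\<dots> \<le> B * ?P * G i * 2"
    using P0 Cons.prems(6) G0 N' by (intro mult_left_mono) auto
  also have "\<dots> = B * (\<Prod>i\<in>set (i # is). 2 * G i)" using i by simp
  finally show ?case .
qed

lemma iterated_sum_eq:
  assumes "distinct is"
  shows "iterated_sum N z is A u =
    (\<Sum>v\<in>{v. (\<forall>i\<in>set is. v i < N) \<and> (\<forall>i. i \<notin> set is \<longrightarrow> v i = u i)}. A v * (\<Prod>i\<in>set is. z i ^ v i))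
    \<and> finite {v. (\<forall>i\<in>set is. v i < N) \<and> (\<forall>i. i \<notin> set is \<longrightarrow> v i = u i)}"
  using assms
proof (induction "is" arbitrary: u)
  case Nil
  have "{v. \<forall>i. v i = u i} = {u}" by auto
  then show ?case by simp
next
  case (Cons i "is")
  have i: "i \<notin> set is" using Cons.prems by simp
  let ?S = "\<lambda>u is. {v. (\<forall>i\<in>set is. v i < N) \<and> (\<forall>i. i \<notin> set is \<longrightarrow> v i = u i)}"
  have U: "?S u (i # is) = (\<Union>k\<in>{..<N}. ?S (u(i := k)) is)"
  proof (intro equalityI subsetI)
    fix v assume v: "v \<in> ?S u (i # is)"
    then have "v \<in> ?S (u(i := v i)) is" "v i < N" by auto
    then show "v \<in> (\<Union>k\<in>{..<N}. ?S (u(i := k)) is)" by blast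
  next
    fix v assume "v \<in> (\<Union>k\<in>{..<N}. ?S (u(i := k)) is)"
    then obtain k where "k < N" "v \<in> ?S (u(i := k)) is" by blast
    then show "v \<in> ?S u (i # is)" using i by (auto split: if_splits)
  qed
  have fin: "finite (?S (u(i := k)) is)" for k using Cons by simp
  have "(\<Sum>v\<in>?S u (i # is). A v * (\<Prod>i\<in>set (i # is). z i ^ v i))
     = (\<Sum>k<N. \<Sum>v\<in>?S (u(i := k)) is. A v * (\<Prod>i\<in>set (i # is). z i ^ v i))"
    unfolding U using fin i by (intro sum.UNION_disjoint) fastforce+
  also have "\<dots> = (\<Sum>k<N. z i ^ k * (\<Sum>v\<in>?S (u(i := k)) is. A v * (\<Prod>i\<in>set is. z i ^ v i)))"
    unfolding sum_distrib_left using i by (intro sum.cong refl) (simp add: mult_ac)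
  also have "\<dots> = iterated_sum N z (i # is) A u"
    using Cons by simp
  finally show ?case using U fin by simp
qed

lemma box_sum_bound:
  fixes A :: "('n::finite \<Rightarrow> nat) \<Rightarrow> complex"
  assumes "distinct is" "set is = UNIV" "bounded_differences (real N) is B (\<lambda>_. N) A" "N > 0" "B \<ge> 0"
    and "\<And>i K. K \<le> N \<Longrightarrow> cmod (\<Sum>k<K. z i ^ k) \<le> G i"
  shows "cmod (\<Sum>v\<in>{v. \<forall>i. v i < N}. A v * (\<Prod>i\<in>UNIV. z i ^ v i)) \<le> B * (\<Prod>i\<in>UNIV. 2 * G i)"
  using iterated_sum_bound[OF assms(1,3), of "\<lambda>_. 0" z G] iterated_sum_eq[OF assms(1), of N z A "\<lambda>_. 0"] assms
  by (simp add: le_fun_def)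

section \<open>Partial derivatives and mixed differences\<close>

text \<open>The head is differentiated first, so \<open>[i, j]\<close> corresponds to the (j, i)
  entry of \<open>hessian\<close>.\<close>

fun iterated_partial :: "'n list \<Rightarrow> (real^'n \<Rightarrow> real) \<Rightarrow> real^'n \<Rightarrow> real" where
  "iterated_partial [] g = g"
| "iterated_partial (i # is) g = iterated_partial is (partial_derivative i g)"

lemma iterated_partial_append:
  "iterated_partial (is @ js) g = iterated_partial js (iterated_partial is g)"
  by (induction "is" arbitrary: g) auto

lemma cont_diff_continuous: "cont_diff k g \<Longrightarrow> continuous_on UNIV g"
  by (cases k) (auto intro!: continuous_at_imp_continuous_on differentiable_imp_continuous_within)

lemma cont_diff_Suc: "cont_diff (Suc k) g \<Longrightarrow> cont_diff k g"
proof (induction k arbitrary: g)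
  case 0
  then show ?case using cont_diff_continuous[of "Suc 0" g] by simp
next
  case (Suc k)
  then show ?case by auto
qed

lemma cont_diff_mono: "cont_diff k g \<Longrightarrow> j \<le> k \<Longrightarrow> cont_diff j g"
  by (induction k) (use cont_diff_Suc le_Suc_eq in blast)+

lemma cont_diff_iterated_partial:
  "cont_diff k g \<Longrightarrow> length is \<le> k \<Longrightarrow> cont_diff (k - length is) (iterated_partial is g)"
proof (induction "is" arbitrary: g k)
  case (Cons i "is")
  then show ?case by (cases k) auto
qed simp

lemma partial_derivative_eq:
  assumes "(g has_derivative g') (at x)"
  shows "partial_derivative i g x = g' (axis i 1)"
  unfolding partial_derivative_def using frechet_derivative_at[OF assms] by simp

lemma frechet_derivative_partial_sum:
  assumes "g differentiable (at x)"
  shows "frechet_derivative g (at x) v = (\<Sum>i\<in>UNIV. v $ i * partial_derivative i g x)"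
proof -
  interpret linear "frechet_derivative g (at x)"
    using assms by (rule linear_frechet_derivative)
  have "v = (\<Sum>i\<in>UNIV. v $ i *\<^sub>R axis i 1)"
    using basis_expansion[of v] by (simp add: scalar_mult_eq_scaleR)
  then have "frechet_derivative g (at x) v = frechet_derivative g (at x) (\<Sum>i\<in>UNIV. v $ i *\<^sub>R axis i 1)"
    by simp
  also have "\<dots> = (\<Sum>i\<in>UNIV. v $ i * partial_derivative i g x)"
    by (simp add: sum scale partial_derivative_def)
  finally show ?thesis .
qed

lemma cont_diff_has_derivative:
  assumes "cont_diff (Suc k) g"
  shows "(g has_derivative (\<lambda>v. \<Sum>i\<in>UNIV. v $ i * partial_derivative i g x)) (at x)"
proof -
  have "(g has_derivative frechet_derivative g (at x)) (at x)"
    using assms by (simp add: frechet_derivative_works[symmetric])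
  moreover have "frechet_derivative g (at x) = (\<lambda>v. \<Sum>i\<in>UNIV. v $ i * partial_derivative i g x)"
    using assms by (intro ext frechet_derivative_partial_sum) auto
  ultimately show ?thesis by simp
qed

lemma cont_diff_const: "cont_diff k (\<lambda>x. c)"
  and partial_derivative_const: "partial_derivative i (\<lambda>x. c) = (\<lambda>x. 0)"
proof -
  show *: "partial_derivative i (\<lambda>x. c) = (\<lambda>x. 0)" for i and c
    by (rule ext) (simp add: partial_derivative_eq[OF has_derivative_const])
  show "cont_diff k (\<lambda>x. c)" for k
    by (induction k arbitrary: c) (auto simp: *)
qed

lemma partial_derivative_add:
  assumes "f differentiable (at x)" "g differentiable (at x)"
  shows "partial_derivative i (\<lambda>x. f x + g x) x = partial_derivative i f x + partial_derivative i g x"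
  using partial_derivative_eq[OF has_derivative_add[OF assms(1)[unfolded frechet_derivative_works] assms(2)[unfolded frechet_derivative_works]]]
  by (simp add: partial_derivative_def)

lemma partial_derivative_cmult:
  assumes "f differentiable (at x)"
  shows "partial_derivative i (\<lambda>x. c * f x) x = c * partial_derivative i f x"
  using partial_derivative_eq[OF has_derivative_mult_right[OF assms[unfolded frechet_derivative_works]]]
  by (simp add: partial_derivative_def)

lemma cont_diff_add: "cont_diff k f \<Longrightarrow> cont_diff k g \<Longrightarrow> cont_diff k (\<lambda>x. f x + g x)"
proof (induction k arbitrary: f g)
  case (Suc k)
  have "partial_derivative i (\<lambda>x. f x + g x) = (\<lambda>x. partial_derivative i f x + partial_derivative i g x)" for i
    using Suc.prems by (auto simp: partial_derivative_add)
  then show ?case using Suc by auto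
qed (auto intro: continuous_on_add)

lemma cont_diff_cmult: "cont_diff k f \<Longrightarrow> cont_diff k (\<lambda>x. c * f x)"
proof (induction k arbitrary: f)
  case (Suc k)
  have "partial_derivative i (\<lambda>x. c * f x) = (\<lambda>x. c * partial_derivative i f x)" for i
    using Suc.prems by (auto simp: partial_derivative_cmult)
  then show ?case using Suc by auto
qed (auto intro: continuous_on_mult_left)

lemma cont_diff_sum:
  "finite I \<Longrightarrow> (\<And>r. r \<in> I \<Longrightarrow> cont_diff k (f r)) \<Longrightarrow> cont_diff k (\<lambda>x. \<Sum>r\<in>I. f r x)"
  by (induction I rule: finite_induct) (auto intro: cont_diff_const cont_diff_add)

lemma iterated_partial_add:
  "cont_diff (length is) f \<Longrightarrow> cont_diff (length is) g \<Longrightarrow>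
    iterated_partial is (\<lambda>x. f x + g x) = (\<lambda>x. iterated_partial is f x + iterated_partial is g x)"
proof (induction "is" arbitrary: f g)
  case (Cons i "is")
  have "partial_derivative i (\<lambda>x. f x + g x) = (\<lambda>x. partial_derivative i f x + partial_derivative i g x)"
    using Cons.prems by (auto simp: partial_derivative_add)
  then show ?case using Cons by simp
qed simp

lemma iterated_partial_cmult:
  "cont_diff (length is) f \<Longrightarrow> iterated_partial is (\<lambda>x. c * f x) = (\<lambda>x. c * iterated_partial is f x)"
proof (induction "is" arbitrary: f)
  case (Cons i "is")
  have "partial_derivative i (\<lambda>x. c * f x) = (\<lambda>x. c * partial_derivative i f x)"
    using Cons.prems by (auto simp: partial_derivative_cmult)
  then show ?case using Cons by simp
qed simp

lemma iterated_partial_const: "is \<noteq> [] \<Longrightarrow> iterated_partial is (\<lambda>x. c) = (\<lambda>x. 0)"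
proof (induction "is" arbitrary: c)
  case (Cons i "is")
  then show ?case by (cases "is = []") (auto simp: partial_derivative_const)
qed simp

lemma iterated_partial_sum:
  assumes "finite I" "\<And>r. r \<in> I \<Longrightarrow> cont_diff (length is) (f r)"
  shows "iterated_partial is (\<lambda>x. \<Sum>r\<in>I. f r x) = (\<lambda>x. \<Sum>r\<in>I. iterated_partial is (f r) x)"
  using assms
proof (induction I rule: finite_induct)
  case empty
  show ?case by (cases "is = []") (auto simp: iterated_partial_const)
next
  case (insert r I)
  then show ?case by (simp add: iterated_partial_add cont_diff_sum)
qed

section \<open>Difference operators and sampling on a grid\<close>

lemma cont_diff_mvt:
  assumes "cont_diff (Suc 0) g"
  obtains s where "0 < s" "s < (1::real)"
    "g y - g x = (\<Sum>i\<in>UNIV. (y $ i - x $ i) * partial_derivative i g (x + s *\<^sub>R (y - x)))"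
proof -
  let ?h = "\<lambda>s::real. g (x + s *\<^sub>R (y - x))"
  have d: "(?h has_derivative (\<lambda>t. \<Sum>i\<in>UNIV. (t *\<^sub>R (y - x)) $ i * partial_derivative i g (x + s *\<^sub>R (y - x)))) (at s)" for s
    by (rule has_derivative_compose[OF _ cont_diff_has_derivative[OF assms], where f="\<lambda>s. x + s *\<^sub>R (y - x)"])
       (auto intro!: derivative_eq_intros)
  have "\<exists>s\<in>{0<..<1}. ?h 1 - ?h 0 = (\<lambda>t. \<Sum>i\<in>UNIV. (t *\<^sub>R (y - x)) $ i * partial_derivative i g (x + s *\<^sub>R (y - x))) (1 - 0)"
  proof (rule mvt_simple)
    show "(?h has_derivative (\<lambda>t. \<Sum>i\<in>UNIV. (t *\<^sub>R (y - x)) $ i * partial_derivative i g (x + s *\<^sub>R (y - x)))) (at s within {0..1})" for s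
      by (rule has_derivative_at_withinI[OF d])
  qed simp
  then show ?thesis using that by (auto simp: mult_ac)
qed

text \<open>Difference operators commute with partial derivatives, so a difference of
  \<open>g\<close> inherits derivative bounds from \<open>g\<close>. This is what allows the
  induction over directions in \<open>bounded_differences_smooth\<close>.\<close>

definition translate_diff :: "'n \<Rightarrow> real \<Rightarrow> (real^'n \<Rightarrow> real) \<Rightarrow> real^'n \<Rightarrow> real" where
  "translate_diff i h g x = g (x + h *\<^sub>R axis i 1) - g x"

lemma partial_derivative_translate:
  assumes "cont_diff (Suc 0) g"
  shows "partial_derivative i (\<lambda>x. g (x + a)) x = partial_derivative i g (x + a)"
    and "(\<lambda>x. g (x + a)) differentiable (at x)"
proof -
  have d: "((\<lambda>x. g (x + a)) has_derivative (\<lambda>v. \<Sum>i\<in>UNIV. v $ i * partial_derivative i g (x + a))) (at x)"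
    by (rule has_derivative_compose[OF _ cont_diff_has_derivative[OF assms], where f="\<lambda>x. x + a"])
       (auto intro!: derivative_eq_intros)
  have d': "(g has_derivative (\<lambda>v. \<Sum>i\<in>UNIV. v $ i * partial_derivative i g (x + a))) (at (x + a))"
    by (rule cont_diff_has_derivative[OF assms])
  show "partial_derivative i (\<lambda>x. g (x + a)) x = partial_derivative i g (x + a)"
    by (rule trans[OF partial_derivative_eq[OF d] partial_derivative_eq[OF d', symmetric]])
  show "(\<lambda>x. g (x + a)) differentiable (at x)" using d by (auto simp: differentiable_def)
qed

lemma cont_diff_Suc_0: "cont_diff (Suc k) g \<Longrightarrow> cont_diff (Suc 0) g"
  using cont_diff_mono[of "Suc k" g "Suc 0"] by simp

lemma cont_diff_translate: "cont_diff k g \<Longrightarrow> cont_diff k (\<lambda>x. g (x + a))"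
proof (induction k arbitrary: g)
  case 0
  then show ?case by (auto intro!: continuous_intros continuous_on_compose2[of UNIV g])
next
  case (Suc k)
  have "partial_derivative i (\<lambda>x. g (x + a)) = (\<lambda>x. partial_derivative i g (x + a))" for i
    using partial_derivative_translate[OF cont_diff_Suc_0[OF Suc.prems]] by auto
  then show ?case
    using Suc partial_derivative_translate(2)[OF cont_diff_Suc_0[OF Suc.prems]]
    unfolding cont_diff.simps by auto
qed

lemma iterated_partial_translate:
  "cont_diff (length is) g \<Longrightarrow> iterated_partial is (\<lambda>x. g (x + a)) = (\<lambda>x. iterated_partial is g (x + a))"
proof (induction "is" arbitrary: g)
  case (Cons i "is")
  have "partial_derivative i (\<lambda>x. g (x + a)) = (\<lambda>x. partial_derivative i g (x + a))" for i
    using partial_derivative_translate[of g] Cons.prems cont_diff_Suc_0[of "length is" g] by auto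
  then show ?case using Cons by simp
qed simp

lemma cont_diff_translate_diff: "cont_diff k g \<Longrightarrow> cont_diff k (translate_diff i h g)"
  unfolding translate_diff_def[abs_def] diff_conv_add_uminus
  using cont_diff_cmult[of k g "-1"] by (intro cont_diff_add cont_diff_translate) auto

lemma iterated_partial_translate_diff:
  assumes "cont_diff (length is) g"
  shows "iterated_partial is (translate_diff i h g) = translate_diff i h (iterated_partial is g)"
proof -
  have "translate_diff i h g = (\<lambda>x. g (x + h *\<^sub>R axis i 1) + (-1) * g x)"
    by (auto simp: translate_diff_def)
  then have "iterated_partial is (translate_diff i h g)
     = (\<lambda>x. iterated_partial is g (x + h *\<^sub>R axis i 1) + (-1) * iterated_partial is g x)"
    using assms iterated_partial_add[OF cont_diff_translate[OF assms] cont_diff_cmult[OF assms]]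
      iterated_partial_translate[OF assms] iterated_partial_cmult[OF assms] by metis
  then show ?thesis by (auto simp: translate_diff_def)
qed

lemma translate_diff_bound:
  assumes "cont_diff (Suc 0) g" "0 \<le> h"
    and "\<And>s. 0 \<le> s \<Longrightarrow> s \<le> h \<Longrightarrow> \<bar>partial_derivative i g (x + s *\<^sub>R axis i 1)\<bar> \<le> M"
  shows "\<bar>translate_diff i h g x\<bar> \<le> h * M"
proof -
  obtain s where s: "0 < s" "s < 1" and eq: "g (x + h *\<^sub>R axis i 1) - g x =
    (\<Sum>j\<in>UNIV. ((x + h *\<^sub>R axis i 1) $ j - x $ j) * partial_derivative j g (x + s *\<^sub>R ((x + h *\<^sub>R axis i 1) - x)))"
    by (rule cont_diff_mvt[OF assms(1), where x = x and y = "x + h *\<^sub>R axis i 1"])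
  have "translate_diff i h g x = h * partial_derivative i g (x + (s * h) *\<^sub>R axis i 1)"
    unfolding translate_diff_def eq by (simp add: axis_def if_distrib if_distribR sum.delta cong: if_cong)
  moreover have "\<bar>partial_derivative i g (x + (s * h) *\<^sub>R axis i 1)\<bar> \<le> M"
    using s assms(2) by (intro assms(3)) (auto intro: mult_left_le_one_le)
  ultimately show ?thesis using assms(2) by (simp add: abs_mult mult_left_mono)
qed

definition grid_point :: "real^'n \<Rightarrow> real \<Rightarrow> ('n \<Rightarrow> nat) \<Rightarrow> real^'n" where
  "grid_point c h u = c + h *\<^sub>R (\<chi> i. real (u i))"

lemma grid_point_Suc: "grid_point c h (u(i := Suc (u i))) = grid_point c h u + h *\<^sub>R axis i 1"
  by (auto simp: grid_point_def vec_eq_iff axis_def algebra_simps)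

text \<open>By the mean value theorem a difference of step \<open>h\<close> costs one more
  derivative and a factor \<open>h\<close>; with derivatives growing like powers of
  \<open>1 / (h * L)\<close> this is a gain of exactly \<open>1 / L\<close>. The induction replaces
  \<open>g\<close> by \<open>translate_diff i h g\<close>, whose values involve points up to
  \<open>h\<close> further away, so the admissible radius drops by \<open>h\<close> for each
  direction.\<close>

lemma bounded_differences_smooth:
  fixes g :: "real^'n \<Rightarrow> real" and "is" :: "'n list"
  assumes "cont_diff (length is) g" "h > 0" "L > 0"
    and "\<And>js y. length js \<le> length is \<Longrightarrow> (\<And>i. \<bar>y $ i - x0 $ i\<bar> \<le> \<rho>) \<Longrightarrow>
      \<bar>iterated_partial js g y\<bar> \<le> B * (1 / (h * L)) ^ length js"
    and "\<And>u i. u \<le> p \<Longrightarrow> \<bar>grid_point c h u $ i - x0 $ i\<bar> \<le> \<rho> - h * length is"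
  shows "bounded_differences L is B p (\<lambda>u. of_real (g (grid_point c h u)))"
  using assms
proof (induction "is" arbitrary: g B p \<rho>)
  case Nil
  show ?case unfolding bounded_differences.simps
  proof (intro allI impI)
    fix u assume "u \<le> p"
    then show "cmod (of_real (g (grid_point c h u))) \<le> B"
      using Nil.prems(4)[of "[]" "grid_point c h u"] Nil.prems(5)[of u] by simp
  qed
next
  case (Cons i "is")
  have cd: "cont_diff (length is) g" using Cons.prems(1) cont_diff_Suc by simp
  have 1: "bounded_differences L is B p (\<lambda>u. of_real (g (grid_point c h u)))"
  proof (rule Cons.IH[OF cd Cons.prems(2,3), of \<rho>])
    fix js :: "'n list" and y :: "real^'n" assume "length js \<le> length is" "\<And>i. \<bar>y $ i - x0 $ i\<bar> \<le> \<rho>"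
    then show "\<bar>iterated_partial js g y\<bar> \<le> B * (1 / (h * L)) ^ length js"
      by (intro Cons.prems(4)) auto
  next
    fix u j assume "u \<le> p"
    then show "\<bar>grid_point c h u $ j - x0 $ j\<bar> \<le> \<rho> - h * length is"
      using Cons.prems(5)[of u j] Cons.prems(2) by (simp add: algebra_simps)
  qed
  have 2: "bounded_differences L is (B / L) (p(i := p i - 1)) (\<lambda>u. of_real (translate_diff i h g (grid_point c h u)))"
  proof (rule Cons.IH[OF cont_diff_translate_diff[OF cd] Cons.prems(2,3), of "\<rho> - h"])
    fix js :: "'n list" and y :: "real^'n" assume js: "length js \<le> length is" and y: "\<And>i. \<bar>y $ i - x0 $ i\<bar> \<le> \<rho> - h"
    have cdj: "cont_diff (length js) g" using cd js cont_diff_mono by blast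
    have "cont_diff (Suc (length is) - length js) (iterated_partial js g)"
      using cont_diff_iterated_partial[OF Cons.prems(1), of js] js by simp
    then have cd1: "cont_diff (Suc 0) (iterated_partial js g)"
      using cont_diff_mono js by (metis Suc_diff_le cont_diff_Suc_0)
    have "\<bar>translate_diff i h (iterated_partial js g) y\<bar> \<le> h * (B * (1 / (h * L)) ^ Suc (length js))"
    proof (rule translate_diff_bound[OF cd1])
      fix s assume s: "0 \<le> s" "s \<le> h"
      have "\<bar>iterated_partial (js @ [i]) g (y + s *\<^sub>R axis i 1)\<bar> \<le> B * (1 / (h * L)) ^ length (js @ [i])"
      proof (rule Cons.prems(4))
        fix j
        show "\<bar>(y + s *\<^sub>R axis i 1) $ j - x0 $ j\<bar> \<le> \<rho>"
          using y[of j] s by (auto simp: axis_def)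
      qed (use js in simp)
      then show "\<bar>partial_derivative i (iterated_partial js g) (y + s *\<^sub>R axis i 1)\<bar> \<le> B * (1 / (h * L)) ^ Suc (length js)"
        by (simp add: iterated_partial_append)
    qed (use Cons.prems in simp)
    also have "\<dots> = B / L * (1 / (h * L)) ^ length js"
      using Cons.prems(2,3) by simp
    finally show "\<bar>iterated_partial js (translate_diff i h g) y\<bar> \<le> B / L * (1 / (h * L)) ^ length js"
      by (simp add: iterated_partial_translate_diff[OF cdj])
  next
    fix u j assume u: "u \<le> p(i := p i - 1)"
    have "p(i := p i - 1) \<le> p" by (simp add: le_fun_def)
    with u have "u \<le> p" by (rule order_trans)
    then show "\<bar>grid_point c h u $ j - x0 $ j\<bar> \<le> \<rho> - h - h * length is"
      using Cons.prems(5)[of u j] by (simp add: algebra_simps)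
  qed
  have "(\<lambda>u. of_real (translate_diff i h g (grid_point c h u))) =
    (\<lambda>u. of_real (g (grid_point c h (u(i := Suc (u i))))) - (of_real (g (grid_point c h u)) :: complex))"
    by (auto simp: translate_diff_def grid_point_Suc)
  with 1 2 show ?case by simp
qed

section \<open>Exponential sums\<close>

lemma sin_pi_ge:
  assumes "0 \<le> y" "y \<le> 1 / 2"
  shows "2 * y \<le> sin (pi * y)"
proof -
  have c: "concave_on {0..pi} sin"
    by (rule f''_le0_imp_concave[where f' = cos and f'' = "\<lambda>x. - sin x"])
       (auto intro!: derivative_eq_intros sin_ge_zero)
  have "(1 - 2 * y) * sin 0 + (2 * y) * sin (pi / 2) \<le> sin ((1 - 2 * y) *\<^sub>R 0 + (2 * y) *\<^sub>R (pi / 2))"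
    using c assms by (intro concave_onD) auto
  then show ?thesis by (simp add: mult.commute)
qed

lemma norm_cis_minus_one: "cmod (cis (2 * pi * x) - 1) = 2 * \<bar>sin (pi * x)\<bar>"
proof -
  have "(cmod (cis (2 * pi * x) - 1))\<^sup>2 = (cos (2 * pi * x) - 1)\<^sup>2 + (sin (2 * pi * x))\<^sup>2"
    by (simp add: cmod_power2)
  also have "\<dots> = 2 - 2 * cos (2 * pi * x)"
    using sin_cos_squared_add[of "2 * pi * x"] by (simp add: power2_eq_square algebra_simps)
  also have "\<dots> = (2 * \<bar>sin (pi * x)\<bar>)\<^sup>2"
    using cos_double_sin[of "pi * x"] by (simp add: mult.assoc power_mult_distrib)
  finally have "(cmod (cis (2 * pi * x) - 1))\<^sup>2 = (2 * \<bar>sin (pi * x)\<bar>)\<^sup>2" .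
  then show ?thesis by (rule power2_eq_imp_eq) auto
qed

lemma norm_cis_minus_one_ge:
  assumes "0 \<le> d" "d \<le> frac x" "d \<le> 1 - frac x"
  shows "4 * d \<le> cmod (cis (2 * pi * x) - 1)"
proof -
  have "cis (2 * pi * x) = cis (2 * pi * frac x) * cis (2 * pi * of_int \<lfloor>x\<rfloor>)"
    unfolding cis_mult by (simp add: frac_def algebra_simps)
  then have eq: "cis (2 * pi * x) = cis (2 * pi * frac x)"
    by (simp add: cis_multiple_2pi)
  have "2 * d \<le> sin (pi * frac x)"
  proof (cases "frac x \<le> 1 / 2")
    case True
    then show ?thesis using sin_pi_ge[of "frac x"] assms by simp
  next
    case False
    have "sin (pi * frac x) = sin (pi * (1 - frac x))"
      by (simp add: right_diff_distrib)
    then show ?thesis using sin_pi_ge[of "1 - frac x"] assms False frac_lt_1[of x] by simp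
  qed
  then show ?thesis unfolding eq norm_cis_minus_one by simp
qed

section \<open>Geometric sums in terms of residue classes\<close>

text \<open>A discrete version of the minimum of N and the reciprocal distance of x to the nearest
  integer, for x with fractional part in [v/N, (v+1)/N). That distance is at least
  \<open>min v (N - 1 - v) / N\<close>; the extreme classes \<open>0\<close> and
  \<open>N - 1\<close> both touch an integer and receive the trivial value \<open>N\<close>.\<close>

definition geometric_weight :: "nat \<Rightarrow> nat \<Rightarrow> real" where
  "geometric_weight N v = real N / real (max 1 (min v (N - 1 - v)))"

lemma geometric_sum_bound:
  assumes "K \<le> N" "N > 0"
  shows "cmod (\<Sum>k<K. cis (2 * pi * x) ^ k) \<le> geometric_weight N (nat \<lfloor>frac x * N\<rfloor>)"
proof -
  define v where "v = nat \<lfloor>frac x * N\<rfloor>"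
  define d where "d = min v (N - 1 - v)"
  have tr: "cmod (\<Sum>k<K. cis (2 * pi * x) ^ k) \<le> N"
    using sum_norm_le[of "{..<K}" "\<lambda>k. cis (2 * pi * x) ^ k" "\<lambda>_. 1"] assms
    by (simp add: norm_power)
  show ?thesis
  proof (cases "d = 0")
    case True
    then show ?thesis using tr by (simp add: geometric_weight_def v_def d_def)
  next
    case False
    have v: "real v \<le> frac x * N" "frac x * N < v + 1"
      unfolding v_def using floor_correct[of "frac x * N"] by (simp_all add: of_nat_nat) linarith
    have "real d / N \<le> frac x"
      using v(1) assms by (simp add: d_def field_simps)
    moreover have "real d / N \<le> 1 - frac x"
    proof -
      have "real d \<le> real N - 1 - v" using False by (auto simp: d_def)
      then have "real d \<le> N - frac x * N" using v by linarith
      then show ?thesis using assms by (simp add: field_simps)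
    qed
    ultimately have "4 * (real d / N) \<le> cmod (cis (2 * pi * x) - 1)"
      by (intro norm_cis_minus_one_ge) auto
    moreover have dN: "0 < real d / N" using False assms by simp
    ultimately have z: "0 < cmod (cis (2 * pi * x) - 1)" "4 * (real d / N) \<le> cmod (cis (2 * pi * x) - 1)" by linarith+
    then have "cis (2 * pi * x) \<noteq> 1" by auto
    then have "cmod (\<Sum>k<K. cis (2 * pi * x) ^ k) = cmod (cis (2 * pi * x) ^ K - 1) / cmod (cis (2 * pi * x) - 1)"
      by (simp add: geometric_sum norm_divide)
    also have "\<dots> \<le> 2 / (4 * (real d / N))"
    proof (rule frac_le)
      show "cmod (cis (2 * pi * x) ^ K - 1) \<le> 2"
        using norm_triangle_ineq4[of "cis (2 * pi * x) ^ K" 1] by (simp add: norm_power)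
    qed (use z dN in auto)
    also have "\<dots> \<le> N / d" using False by (simp add: field_simps)
    also have "\<dots> = geometric_weight N v"
      using False unfolding geometric_weight_def d_def[symmetric] by (simp add: max_def)
    finally show ?thesis by (simp add: v_def)
  qed
qed

lemma sum_inverse_bound:
  assumes "N > 0"
  shows "(\<Sum>v<N. 1 / real (max 1 v)) \<le> 2 + ln N"
proof -
  \<comment> \<open>The terms \<open>v = 0\<close> and \<open>v = 1\<close> both equal 1 and make up
    the constant 2; each later term is at most the increment of the logarithm ending at the same
    integer.\<close>
  have *: "(\<Sum>v<Suc (Suc N). 1 / real (max 1 v)) \<le> 2 + ln (Suc N)" for N
  proof (induction N)
    case (Suc N)
    have "1 / real (Suc (Suc N)) \<le> ln (Suc (Suc N)) - ln (Suc N)"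
    proof -
      have "real (Suc N) / real (Suc (Suc N)) - 1 = - (1 / real (Suc (Suc N)))"
        by (simp add: field_simps)
      then show ?thesis
        using ln_le_minus_one[of "real (Suc N) / real (Suc (Suc N))"]
          ln_div[of "real (Suc N)" "real (Suc (Suc N))"] by simp
    qed
    then show ?case using Suc by simp
  qed simp
  consider "N = 1" | M where "N = Suc (Suc M)" using assms by (metis One_nat_def gr0_implies_Suc old.nat.exhaust)
  then show ?thesis
  proof cases
    case 2
    then show ?thesis using *[of M] by (intro order_trans[OF *[of M, folded 2]]) auto
  qed auto
qed

lemma geometric_weight_nonneg: "0 \<le> geometric_weight N v"
  by (simp add: geometric_weight_def)

text \<open>The reciprocal of a minimum is at most the sum of the reciprocals, and the reflection of
  \<open>v\<close> to \<open>N - 1 - v\<close> identifies the two harmonic sums.\<close>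

lemma sum_geometric_weight:
  assumes "N > 0"
  shows "(\<Sum>v<N. geometric_weight N v) \<le> 2 * N * (2 + ln N)"
proof -
  have "(\<Sum>v<N. geometric_weight N v) \<le> (\<Sum>v<N. N * (1 / real (max 1 v) + 1 / real (max 1 (N - 1 - v))))"
  proof (rule sum_mono)
    fix v
    have "1 / real (max 1 (min a b)) \<le> 1 / real (max 1 a) + 1 / real (max 1 b)" for a b
      by (cases "a \<le> b") (auto simp: min_def)
    then show "geometric_weight N v \<le> N * (1 / real (max 1 v) + 1 / real (max 1 (N - 1 - v)))"
      unfolding geometric_weight_def
      by (metis mult_left_mono of_nat_0_le_iff times_divide_eq_right mult.right_neutral)
  qed
  also have "\<dots> = N * (2 * (\<Sum>v<N. 1 / real (max 1 v)))"
    using sum.nat_diff_reindex[of "\<lambda>v. 1 / real (max 1 v)" N]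
    by (simp add: sum_distrib_left[symmetric] sum.distrib)
  also have "\<dots> \<le> N * (2 * (2 + ln N))"
    using sum_inverse_bound[OF assms] by (intro mult_left_mono) auto
  finally show ?thesis by (simp add: algebra_simps)
qed

lemma sum_fiber_bound:
  fixes h :: "'b \<Rightarrow> real"
  assumes "finite B" "finite Y" "f ` B \<subseteq> Y" "\<And>y. y \<in> Y \<Longrightarrow> h y \<ge> 0"
    and "\<And>y. y \<in> Y \<Longrightarrow> card {b \<in> B. f b = y} \<le> M"
  shows "(\<Sum>b\<in>B. h (f b)) \<le> M * (\<Sum>y\<in>Y. h y)"
proof -
  have "(\<Sum>b\<in>B. h (f b)) = (\<Sum>y\<in>Y. \<Sum>b\<in>{b \<in> B. f b = y}. h (f b))"
    using assms by (intro sum.group[symmetric]) auto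
  also have "\<dots> = (\<Sum>y\<in>Y. card {b \<in> B. f b = y} * h y)" by simp
  also have "\<dots> \<le> (\<Sum>y\<in>Y. M * h y)"
    using assms by (intro sum_mono mult_right_mono) auto
  finally show ?thesis by (simp add: sum_distrib_left)
qed

lemma segment_coordinate_bound:
  fixes x y c :: "real^'n"
  assumes "0 < s" "s < 1" "\<bar>x $ m - c $ m\<bar> \<le> r" "\<bar>y $ m - c $ m\<bar> \<le> r"
  shows "\<bar>(x + s *\<^sub>R (y - x)) $ m - c $ m\<bar> \<le> r"
proof -
  have "(x + s *\<^sub>R (y - x)) $ m - c $ m = (1 - s) * (x $ m - c $ m) + s * (y $ m - c $ m)"
    by (simp add: algebra_simps)
  also have "\<bar>\<dots>\<bar> \<le> (1 - s) * \<bar>x $ m - c $ m\<bar> + s * \<bar>y $ m - c $ m\<bar>"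
    using assms abs_triangle_ineq[of "(1 - s) * (x $ m - c $ m)" "s * (y $ m - c $ m)"] by (simp add: abs_mult)
  also have "\<dots> \<le> (1 - s) * r + s * r"
    using assms by (intro add_mono mult_left_mono) auto
  finally show ?thesis by (simp add: algebra_simps)
qed

lemma partial_derivative_lipschitz:
  fixes F :: "real^'n \<Rightarrow> real" and K d :: real
  assumes "cont_diff (Suc (Suc 0)) F"
    and K: "\<And>i j y. (\<And>m. \<bar>y $ m - c $ m\<bar> \<le> r) \<Longrightarrow> \<bar>iterated_partial [i, j] F y\<bar> \<le> K"
    and x: "\<And>m. \<bar>x $ m - c $ m\<bar> \<le> r" and y: "\<And>m. \<bar>y $ m - c $ m\<bar> \<le> r"
    and d: "\<And>m. \<bar>y $ m - x $ m\<bar> \<le> d"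
  shows "\<bar>partial_derivative i F y - partial_derivative i F x\<bar> \<le> CARD('n) * K * d"
proof -
  obtain s where s: "0 < s" "s < 1" and eq: "partial_derivative i F y - partial_derivative i F x
     = (\<Sum>j\<in>UNIV. (y $ j - x $ j) * partial_derivative j (partial_derivative i F) (x + s *\<^sub>R (y - x)))"
    using cont_diff_mvt[of "partial_derivative i F" y x] assms(1) by auto
  have seg: "\<bar>(x + s *\<^sub>R (y - x)) $ m - c $ m\<bar> \<le> r" for m
    using s x y by (rule segment_coordinate_bound)
  have "\<bar>partial_derivative i F y - partial_derivative i F x\<bar> \<le> (\<Sum>j\<in>(UNIV::'n set). d * K)"
    unfolding eq
  proof (intro order_trans[OF sum_abs] sum_mono)
    fix j
    show "\<bar>(y $ j - x $ j) * partial_derivative j (partial_derivative i F) (x + s *\<^sub>R (y - x))\<bar> \<le> d * K"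
      unfolding abs_mult using d[of j] K[OF seg, of i j] by (intro mult_mono) auto
  qed
  then show ?thesis by (simp add: mult_ac)
qed

lemma affine_partial_derivative:
  fixes b :: "'n::finite \<Rightarrow> real"
  shows "partial_derivative i (\<lambda>y::real^'n. a + (\<Sum>j\<in>UNIV. b j * y $ j)) = (\<lambda>y. b i)"
    and "(\<lambda>y::real^'n. a + (\<Sum>j\<in>UNIV. b j * y $ j)) differentiable (at x)"
proof -
  have d: "((\<lambda>y::real^'n. a + (\<Sum>j\<in>UNIV. b j * y $ j)) has_derivative (\<lambda>v. \<Sum>j\<in>UNIV. b j * v $ j)) (at x)" for x
    by (auto intro!: derivative_eq_intros bounded_linear_imp_has_derivative bounded_linear_vec_nth)
  show "partial_derivative i (\<lambda>y::real^'n. a + (\<Sum>j\<in>UNIV. b j * y $ j)) = (\<lambda>y. b i)"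
    by (rule ext, subst partial_derivative_eq[OF d]) (simp add: axis_def if_distrib sum.delta cong: if_cong)
  show "(\<lambda>y::real^'n. a + (\<Sum>j\<in>UNIV. b j * y $ j)) differentiable (at x)"
    using d by (auto simp: differentiable_def)
qed

lemma cont_diff_affine:
  fixes b :: "'n::finite \<Rightarrow> real"
  shows "cont_diff k (\<lambda>y::real^'n. a + (\<Sum>j\<in>UNIV. b j * y $ j))"
proof (cases k)
  case 0
  then show ?thesis by (auto intro!: continuous_intros)
next
  case (Suc k)
  then show ?thesis
    by (simp add: affine_partial_derivative cont_diff_const)
qed

section \<open>Sums over a single box\<close>

text \<open>The outer \<open>2 ^ n\<close> is the product rule for weight times phase, and the
  exponential comes from \<open>bounded_differences_exp\<close>. In the phase bound,
  \<open>n\<^sup>2\<close> stems from two mean value steps with \<open>n\<close> coordinates each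
  and \<open>(n + 1)\<^sup>2\<close> from the squared radius of the enlarged box.\<close>

definition amplitude_const :: "nat \<Rightarrow> real \<Rightarrow> real \<Rightarrow> real" where
  "amplitude_const n W K = 2 ^ n * W * exp (2 ^ n * (2 * pi * (real n)\<^sup>2 * (real n + 1)\<^sup>2 * K))"

text \<open>On a box of side \<open>L \<le> sqrt (q / lam)\<close> the phase is linear up to a bounded remainder with bounded
  mixed differences, so the sum over the box is essentially a product of geometric series.\<close>

lemma box_exponential_sum_bound:
  fixes w F :: "real^'n \<Rightarrow> real" and K lam W :: real and q L :: nat
  assumes n2: "CARD('n) \<ge> 2"
    and cd: "cont_diff CARD('n) w" "cont_diff CARD('n) F"
    and wb: "\<And>js y. length js \<le> CARD('n) \<Longrightarrow> \<bar>iterated_partial js w y\<bar> \<le> W"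
    and Fb: "\<And>js y. js \<noteq> [] \<Longrightarrow> length js \<le> CARD('n) \<Longrightarrow> (\<And>i. \<bar>y $ i - x0 $ i\<bar> \<le> 3) \<Longrightarrow>
      \<bar>iterated_partial js F y\<bar> \<le> K * lam"
    and K: "K \<ge> 0" and lam: "lam > 0" and q: "q > 0" and L: "L > 0"
    and Lq: "lam * (real L)\<^sup>2 \<le> q" "(real CARD('n) + 1) * L \<le> q"
    and c: "\<And>i. \<bar>c $ i - x0 $ i\<bar> \<le> 2"
  shows "cmod (\<Sum>u\<in>{u. \<forall>i. u i < L}. of_real (w (grid_point c (1 / q) u)) * cis (2 * pi * (q * F (grid_point c (1 / q) u))))
    \<le> amplitude_const CARD('n) W K *
       (\<Prod>i\<in>UNIV. 2 * geometric_weight L (nat \<lfloor>frac (partial_derivative i F c) * L\<rfloor>))"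
proof -
  define n where "n = real CARD('n)"
  obtain "is" :: "'n list" where "is": "distinct is" "set is = UNIV"
    using finite_distinct_list[of "UNIV :: 'n set"] by auto
  then have len: "length is = CARD('n)" by (metis distinct_card)
  \<comment> \<open>The box has side L/q, but up to n differences of step 1/q reach beyond it; since
    L is at least 1, L + n is at most (n + 1) L.\<close>
  define r where "r = (n + 1) * L / q"
  define B where "B = 2 * pi * n\<^sup>2 * (n + 1)\<^sup>2 * K"
  \<comment> \<open>\<open>A\<close> is minus the first Taylor polynomial of \<open>F\<close> at
    \<open>c\<close>, so \<open>\<rho>\<close> is the phase with its linear part removed.\<close>
  define a where "a = - F c + (\<Sum>j\<in>UNIV. partial_derivative j F c * c $ j)"
  define A where "A = (\<lambda>y::real^'n. a + (\<Sum>j\<in>UNIV. - partial_derivative j F c * y $ j))"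
  define \<rho> where "\<rho> = (\<lambda>y. 2 * pi * q * (F y + A y))"
  have n1: "n \<ge> 2" using n2 by (simp add: n_def)
  have W: "W \<ge> 0" using wb[of "[]" c] by simp
  have B0: "B \<ge> 0" using K by (simp add: B_def)
  have r1: "r \<le> 1" using Lq(2) q by (simp add: r_def n_def)
  have r0: "r \<ge> 0" by (simp add: r_def n_def)
  have cF: "cont_diff (Suc (Suc 0)) F" using cd(2) cont_diff_mono[of "CARD('n)" F 2] n2 by (simp add: numeral_2_eq_2)
  have reg: "\<bar>y $ i - x0 $ i\<bar> \<le> 3" if "\<And>i. \<bar>y $ i - c $ i\<bar> \<le> r" for y i
    using that[of i] c[of i] r1 by linarith
  have qL: "1 / (1 / real q * real L) = q / L" by simp
  have qL1: "real q / L \<ge> 1"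
  proof -
    have "1 * real L \<le> (n + 1) * L" using n1 by (intro mult_right_mono) auto
    then have "real L \<le> q" using Lq(2) by (simp add: n_def)
    then show ?thesis using L by simp
  qed
  have grad: "\<bar>partial_derivative i F y - partial_derivative i F c\<bar> \<le> n * (K * lam) * r"
    if y: "\<And>i. \<bar>y $ i - c $ i\<bar> \<le> r" for y i
    unfolding n_def
  proof (rule partial_derivative_lipschitz[OF cF, where c = c and r = r])
    show "\<bar>iterated_partial [i, j] F y\<bar> \<le> K * lam" if "\<And>m. \<bar>y $ m - c $ m\<bar> \<le> r" for i j y
      using that n2 by (intro Fb reg) auto
  qed (use y r0 in auto)
  have cdA: "cont_diff k A" for k unfolding A_def by (rule cont_diff_affine)
  have cdFA: "cont_diff CARD('n) (\<lambda>y. F y + A y)" by (intro cont_diff_add cd cdA)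
  have cdr: "cont_diff CARD('n) \<rho>" unfolding \<rho>_def by (intro cont_diff_cmult cdFA)
  have val: "F y + A y = F y - F c - (\<Sum>j\<in>UNIV. (y $ j - c $ j) * partial_derivative j F c)" for y
    by (simp add: A_def a_def sum_negf sum_subtractf algebra_simps)
  \<comment> \<open>The choice of box size enters here: the remainder is of size
    \<open>lam * (real L)\<^sup>2 / q\<close>, which is at most 1.\<close>
  have scale: "q * (K * lam) * (r * (n * (n * r))) * (2 * pi) \<le> B"
  proof -
    have "q * (K * lam) * (r * (n * (n * r))) * (2 * pi) = B * (lam * (real L)\<^sup>2 / q)"
      using q by (simp add: r_def B_def field_simps power2_eq_square)
    also have "\<dots> \<le> B * 1" using Lq(1) q B0 by (intro mult_left_mono) auto
    finally show ?thesis by simp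
  qed
  \<comment> \<open>Each derivative may cost a factor q/L. Order 0 is the second-order Taylor
    remainder; at order 1 the gradient moves by about lam L/q, and q times this is at most q/L; from
    order 2 on the linear part is gone and q lam is at most (q/L)^2, hence at most every higher
    power, as q/L is at least 1.\<close>
  have rb: "\<bar>iterated_partial js \<rho> y\<bar> \<le> B * (1 / (1 / real q * real L)) ^ length js"
    if js: "length js \<le> length is" and y: "\<And>i. \<bar>y $ i - c $ i\<bar> \<le> r" for js y
  proof -
    have cj: "cont_diff (length js) (\<lambda>y. F y + A y)" "cont_diff (length js) F"
      using js len cont_diff_mono cdFA cd(2) by metis+
    have eq: "iterated_partial js \<rho> y = 2 * pi * q * (iterated_partial js F y + iterated_partial js A y)"
      unfolding \<rho>_def iterated_partial_cmult[OF cj(1)] iterated_partial_add[OF cj(2) cdA] ..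
    consider "js = []" | i where "js = [i]" | i j ks where "js = i # j # ks" by (metis list.exhaust)
    then show ?thesis
    proof cases
      case 1
      obtain s where s: "0 < s" "s < 1"
        "F y - F c = (\<Sum>i\<in>UNIV. (y $ i - c $ i) * partial_derivative i F (c + s *\<^sub>R (y - c)))"
        using cont_diff_mvt[of F y c] cF cont_diff_Suc by blast
      have "F y + A y = (\<Sum>i\<in>UNIV. (y $ i - c $ i) * (partial_derivative i F (c + s *\<^sub>R (y - c)) - partial_derivative i F c))"
        unfolding val s(3) by (simp add: sum_subtractf right_diff_distrib)
      also have "\<bar>\<dots>\<bar> \<le> (\<Sum>i\<in>(UNIV::'n set). r * (n * (K * lam) * r))"
      proof (intro order_trans[OF sum_abs] sum_mono)
        fix i
        have "\<bar>(c + s *\<^sub>R (y - c)) $ m - c $ m\<bar> \<le> r" for m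
          using s(1,2) y[of m] mult_left_le_one_le[of "\<bar>y $ m - c $ m\<bar>" s] by (simp add: abs_mult)
        then show "\<bar>(y $ i - c $ i) * (partial_derivative i F (c + s *\<^sub>R (y - c)) - partial_derivative i F c)\<bar> \<le> r * (n * (K * lam) * r)"
          unfolding abs_mult using y r0 by (intro mult_mono grad) auto
      qed
      finally have "\<bar>F y + A y\<bar> \<le> n * (r * (n * (K * lam) * r))" by (simp add: n_def)
      then have "2 * pi * q * \<bar>F y + A y\<bar> \<le> 2 * pi * q * (n * (r * (n * (K * lam) * r)))"
        by (intro mult_left_mono) auto
      also have "\<dots> \<le> B" using scale by (simp add: mult_ac)
      finally show ?thesis using 1 by (simp add: \<rho>_def abs_mult)
    next
      case 2
      have "iterated_partial js \<rho> y = 2 * pi * q * (partial_derivative i F y - partial_derivative i F c)"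
        unfolding eq unfolding 2 iterated_partial.simps A_def affine_partial_derivative by simp
      then have "\<bar>iterated_partial js \<rho> y\<bar> \<le> 2 * pi * q * (n * (K * lam) * r)"
        using grad[OF y, of i] by (simp add: abs_mult mult_left_mono)
      also have "\<dots> = 2 * pi * n * (n + 1) * K * (lam * (real L)\<^sup>2 / q) * (q / L)"
        using q L by (simp add: r_def field_simps power2_eq_square)
      also have "\<dots> \<le> 2 * pi * n * (n + 1) * K * 1 * (q / L)"
        using Lq(1) q K n1 by (intro mult_left_mono mult_right_mono) auto
      also have "\<dots> \<le> B * (q / L)"
      proof (intro mult_right_mono)
        have "n * (n + 1) * 1 \<le> n * (n + 1) * (n * (n + 1))"
        proof (rule mult_left_mono)
          show "1 \<le> n * (n + 1)" using n1 mult_mono[of 1 n 1 "n + 1"] by simp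
        qed (use n1 in auto)
        then have "(2 * pi * K) * (n * (n + 1)) \<le> (2 * pi * K) * (n\<^sup>2 * (n + 1)\<^sup>2)"
          using K by (intro mult_left_mono) (auto simp: power2_eq_square mult_ac)
        then show "2 * pi * n * (n + 1) * K * 1 \<le> B" by (simp add: B_def mult_ac)
      qed auto
      finally show ?thesis using 2 by simp
    next
      case 3
      have "iterated_partial js A y = iterated_partial (j # ks) (\<lambda>y. - partial_derivative i F c) y"
        unfolding 3 iterated_partial.simps(2)[of i] A_def affine_partial_derivative ..
      also have "\<dots> = 0" by (subst iterated_partial_const) auto
      finally have "\<bar>iterated_partial js \<rho> y\<bar> = 2 * pi * q * \<bar>iterated_partial js F y\<bar>"
        unfolding eq by (simp add: abs_mult)
      also have "\<dots> \<le> 2 * pi * q * (K * lam)"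
        using js len 3 by (intro mult_left_mono Fb reg y) auto
      also have "\<dots> = 2 * pi * K * (lam * (real L)\<^sup>2 / q) * (q / L)\<^sup>2"
        using q L by (simp add: field_simps power2_eq_square)
      also have "\<dots> \<le> 2 * pi * K * 1 * (q / L) ^ length js"
        using Lq(1) q K qL1 3 by (intro mult_mono mult_left_mono power_increasing) auto
      also have "\<dots> \<le> B * (q / L) ^ length js"
      proof (intro mult_right_mono)
        have "1 * 1 \<le> n\<^sup>2 * (n + 1)\<^sup>2" using n1 by (intro mult_mono one_le_power) auto
        then have "(2 * pi * K) * 1 \<le> (2 * pi * K) * (n\<^sup>2 * (n + 1)\<^sup>2)" using K by (intro mult_left_mono) auto
        then show "2 * pi * K * 1 \<le> B" by (simp add: B_def mult_ac)
      qed auto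
      finally show ?thesis by simp
    qed
  qed
  have pts: "\<bar>grid_point c (1 / real q) u $ i - c $ i\<bar> \<le> r - 1 / real q * real (length is)" if "u \<le> (\<lambda>_. L)" for u i
  proof -
    have "real (u i) \<le> L" using that by (simp add: le_fun_def)
    moreover have "n * 1 \<le> n * real L" using L n1 by (intro mult_left_mono) auto
    ultimately have "u i + n \<le> (n + 1) * L" by (simp add: algebra_simps)
    then have "(u i + n) / q \<le> r" unfolding r_def by (simp add: divide_right_mono)
    then show ?thesis by (simp add: grid_point_def len n_def[symmetric] add_divide_distrib)
  qed
  have bd1: "bounded_differences L is B (\<lambda>_. L) (\<lambda>u. of_real (\<rho> (grid_point c (1 / q) u)))"
  proof (rule bounded_differences_smooth)
    show "cont_diff (length is) \<rho>" using cdr len by simp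
  qed (use rb pts q L in auto)
  have bd2: "bounded_differences L is W (\<lambda>_. L) (\<lambda>u. of_real (w (grid_point c (1 / q) u)))"
  proof (rule bounded_differences_smooth)
    show "cont_diff (length is) w" using cd(1) len by simp
    fix js :: "'n list" and y :: "real^'n" assume "length js \<le> length is"
    then have "\<bar>iterated_partial js w y\<bar> \<le> W" using wb len by simp
    also have "W * 1 \<le> W * (1 / (1 / real q * real L)) ^ length js"
      unfolding qL using qL1 W by (intro mult_left_mono one_le_power) auto
    finally show "\<bar>iterated_partial js w y\<bar> \<le> W * (1 / (1 / real q * real L)) ^ length js" by simp
  qed (use pts q L in auto)
  have bd3: "bounded_differences L is (exp (2 ^ length is * B)) (\<lambda>_. L) (\<lambda>u. exp (\<i> * of_real (\<rho> (grid_point c (1 / q) u))))"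
    using bounded_differences_exp[OF bounded_differences_cmult[OF bd1, of \<i>]] L B0 by simp
  have bd: "bounded_differences L is (amplitude_const CARD('n) W K) (\<lambda>_. L)
     (\<lambda>u. of_real (w (grid_point c (1 / q) u)) * exp (\<i> * of_real (\<rho> (grid_point c (1 / q) u))))"
    using bounded_differences_mult[OF bd2 bd3] L by (simp add: amplitude_const_def B_def n_def len)
  \<comment> \<open>The factor \<open>q\<close> in the phase cancels the grid step
    \<open>1 / q\<close>, so the linear part contributes pure powers of the numbers
    \<open>z i\<close>.\<close>
  define z where "z i = cis (2 * pi * partial_derivative i F c)" for i
  have split: "of_real (w (grid_point c (1 / q) u)) * cis (2 * pi * (q * F (grid_point c (1 / q) u))) =
     cis (2 * pi * (q * F c)) * (of_real (w (grid_point c (1 / q) u)) * exp (\<i> * of_real (\<rho> (grid_point c (1 / q) u)))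
       * (\<Prod>i\<in>UNIV. z i ^ u i))" for u
  proof -
    have "(\<Prod>i\<in>I. cis (g i)) = cis (\<Sum>i\<in>I. g i)" if "finite I" for I :: "'n set" and g
      using that by (induction I rule: finite_induct) (auto simp: cis_mult)
    from this[of UNIV "\<lambda>i. u i * (2 * pi * partial_derivative i F c)"]
    have "(\<Prod>i\<in>UNIV. z i ^ u i) = cis (\<Sum>i\<in>UNIV. u i * (2 * pi * partial_derivative i F c))"
      by (simp only: z_def Complex.DeMoivre finite)
    also have "(\<Sum>i\<in>UNIV. u i * (2 * pi * partial_derivative i F c))
       = 2 * pi * q * (\<Sum>j\<in>UNIV. (grid_point c (1 / q) u $ j - c $ j) * partial_derivative j F c)"
      using q by (simp add: grid_point_def sum_distrib_left mult_ac)
    finally have P: "(\<Prod>i\<in>UNIV. z i ^ u i) = cis (2 * pi * q * (\<Sum>j\<in>UNIV. (grid_point c (1 / q) u $ j - c $ j) * partial_derivative j F c))" .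
    have "2 * pi * (q * F (grid_point c (1 / q) u)) = 2 * pi * (q * F c) + \<rho> (grid_point c (1 / q) u) +
        2 * pi * q * (\<Sum>j\<in>UNIV. (grid_point c (1 / q) u $ j - c $ j) * partial_derivative j F c)"
      unfolding \<rho>_def val by (simp add: algebra_simps)
    then show ?thesis unfolding P cis_conv_exp[symmetric] by (simp add: cis_mult[symmetric] mult_ac)
  qed
  have "amplitude_const CARD('n) W K \<ge> 0" using W by (simp add: amplitude_const_def)
  from box_sum_bound[OF "is" bd L this, of z "\<lambda>i. geometric_weight L (nat \<lfloor>frac (partial_derivative i F c) * L\<rfloor>)"]
  show ?thesis
    unfolding split sum_distrib_left[symmetric] norm_mult norm_cis mult_1_left
    using geometric_sum_bound L unfolding z_def by blast
qed

section \<open>Spacing of the gradients\<close>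

lemma card_vector_box:
  fixes S :: "'n::finite \<Rightarrow> 'a set"
  assumes "\<And>i. finite (S i)"
  shows "finite {b::'a^'n. \<forall>i. b $ i \<in> S i}" "card {b::'a^'n. \<forall>i. b $ i \<in> S i} \<le> (\<Prod>i\<in>UNIV. card (S i))"
proof -
  have inj: "inj_on (\<lambda>b. ($) b) {b::'a^'n. \<forall>i. b $ i \<in> S i}"
    by (auto simp: inj_on_def vec_eq_iff)
  have sub: "(\<lambda>b. ($) b) ` {b::'a^'n. \<forall>i. b $ i \<in> S i} \<subseteq> PiE UNIV S" by auto
  have fin: "finite (PiE UNIV S)" using assms by (intro finite_PiE) auto
  show "finite {b::'a^'n. \<forall>i. b $ i \<in> S i}"
    using inj sub fin by (rule inj_on_finite)
  show "card {b::'a^'n. \<forall>i. b $ i \<in> S i} \<le> (\<Prod>i\<in>UNIV. card (S i))"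
    using card_inj_on_le[OF inj sub fin] by (simp add: card_PiE)
qed

text \<open>In order: the number of boxes sharing one cell and one residue vector, the number of
  \<open>k\<close>-th coordinates (up to q/L), the number of cells in the other directions (up to
  \<open>lam ^ (n - 1)\<close>), and the constant from summing the geometric weights.\<close>

definition count_const :: "nat \<Rightarrow> real \<Rightarrow> real \<Rightarrow> real \<Rightarrow> real" where
  "count_const n K s X = (8 / s + 1) ^ n * (3 * X) * (10 * real n * K * X) ^ (n - 1) * 4 ^ n"

text \<open>In sup norms, the gradient expands distances by at least \<open>c\<close> between points
  of equal \<open>k\<close>-th coordinate. The dominating component \<open>i\<close> may depend on
  the two points.\<close>

definition slice_separated :: "(real^'n \<Rightarrow> real) \<Rightarrow> 'n \<Rightarrow> real \<Rightarrow> real^'n \<Rightarrow> real \<Rightarrow> bool" where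
  "slice_separated F k c x0 \<rho> \<longleftrightarrow>
    (\<forall>x y. (\<forall>m. \<bar>x $ m - x0 $ m\<bar> \<le> \<rho>) \<longrightarrow> (\<forall>m. \<bar>y $ m - x0 $ m\<bar> \<le> \<rho>) \<longrightarrow> x $ k = y $ k \<longrightarrow>
      (\<exists>i. \<forall>m. c * \<bar>x $ m - y $ m\<bar> \<le> \<bar>partial_derivative i F x - partial_derivative i F y\<bar>))"

text \<open>Boxes with the same \<open>k\<close>-th coordinate inside a cell of side \<open>1 / lam\<close> have gradients separated
  by about \<open>1 / L\<close> modulo 1, so the geometric weights may be summed over all residues.\<close>

lemma sum_geometric_weight_gradients:
  fixes F :: "real^'n \<Rightarrow> real" and K lam s X e :: real and q L :: nat and B :: "(int^'n) set"
  assumes cF: "cont_diff (Suc (Suc 0)) F"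
    and Fb: "\<And>i j y. (\<And>m. \<bar>y $ m - x0 $ m\<bar> \<le> 3) \<Longrightarrow> \<bar>iterated_partial [i, j] F y\<bar> \<le> K * lam"
    and K: "K \<ge> 1" and lam: "lam \<ge> 1" and q: "q > 0" and L: "L \<ge> 2"
    and Lq: "lam * (real L)\<^sup>2 \<le> q" "q \<le> 4 * lam * (real L)\<^sup>2"
    and sep: "slice_separated F k (s * lam) x0 (2 * e)"
    and e: "e \<le> 1" and s: "s > 0" and X: "X \<ge> 1" and finB: "finite B"
    and Bx: "\<And>b m. b \<in> B \<Longrightarrow> \<bar>P b $ m - x0 $ m\<bar> \<le> 2 * e" "\<And>b m. b \<in> B \<Longrightarrow> \<bar>P b $ m\<bar> \<le> X"
    and P: "P = (\<lambda>b. \<chi> i. real L * of_int (b $ i) / q)"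
  shows "(\<Sum>b\<in>B. \<Prod>i\<in>UNIV. 2 * geometric_weight L (nat \<lfloor>frac (partial_derivative i F (P b)) * L\<rfloor>))
    \<le> count_const CARD('n) K s X * q * (lam * L) ^ (CARD('n) - 1) * (2 + ln L) ^ CARD('n)"
proof -
  define n where "n = CARD('n)"
  have n0: "n > 0" by (simp add: n_def)
  \<comment> \<open>On a cell of side \<open>1 / \<Lambda>\<close> each gradient component varies by
    at most n K lam / \<Lambda> = 1/2, too little to wrap around modulo 1.\<close>
  define \<Lambda> where "\<Lambda> = 2 * n * K * lam"
  have KL: "K * lam \<ge> 1" using K lam mult_mono[of 1 K 1 lam] by simp
  have \<Lambda>1: "\<Lambda> \<ge> 1"
    using KL n0 mult_mono[of 1 "2 * real n" 1 "K * lam"] by (simp add: \<Lambda>_def mult_ac)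
  define v where "v b = (\<lambda>i::'n. nat \<lfloor>frac (partial_derivative i F (P b)) * L\<rfloor>)" for b
  \<comment> \<open>The slice coordinate is kept exactly, because separation holds only within a
    slice; the other coordinates are recorded only up to their cell.\<close>
  define \<kappa> where "\<kappa> b = (\<lambda>i::'n. if i = k then b $ k else \<lfloor>\<Lambda> * P b $ i\<rfloor>)" for b
  define N1 where "N1 = \<lfloor>X * (q / L)\<rfloor>"
  define N2 where "N2 = \<lceil>\<Lambda> * X\<rceil>"
  define S where "S = (\<lambda>i::'n. if i = k then {- N1..N1} else {- N2..N2})"
  define D where "D = \<lfloor>4 / s\<rfloor>"
  have LR: "real L \<ge> 2" using L by simp
  have qL1: "q / L \<ge> 1"
  proof -
    have "1 * real L \<le> lam * (real L)\<^sup>2"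
      using lam LR by (intro mult_mono) (auto simp: power2_eq_square)
    then show ?thesis using Lq(1) LR by simp
  qed
  have v_lt: "v b i < L" for b i
  proof -
    have "frac (partial_derivative i F (P b)) * L < L"
      using frac_lt_1[of "partial_derivative i F (P b)"] LR by simp
    then show ?thesis unfolding v_def by (simp add: nat_less_iff floor_less_iff frac_ge_0)
  qed
  have Pb: "P b $ i = L / q * b $ i" for b i by (simp add: P)
  have \<kappa>S: "\<kappa> b i \<in> S i" if b: "b \<in> B" for b i
  proof (cases "i = k")
    case True
    have "\<bar>real_of_int (b $ k)\<bar> = \<bar>P b $ k\<bar> * (q / L)"
      unfolding Pb using q LR by (simp add: abs_mult)
    also have "\<dots> \<le> X * (q / L)" using Bx(2)[OF b] by (intro mult_right_mono) auto
    finally have "\<bar>b $ k\<bar> \<le> N1" unfolding N1_def by (simp add: le_floor_iff)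
    then show ?thesis using True by (auto simp: \<kappa>_def S_def)
  next
    case False
    have "\<bar>\<Lambda> * P b $ i\<bar> \<le> \<Lambda> * X"
      using Bx(2)[OF b, of i] \<Lambda>1 by (simp add: abs_mult mult_left_mono)
    then have "- N2 \<le> \<lfloor>\<Lambda> * P b $ i\<rfloor>" "\<lfloor>\<Lambda> * P b $ i\<rfloor> \<le> N2"
      unfolding N2_def by linarith+
    then show ?thesis using False by (auto simp: \<kappa>_def S_def)
  qed
  \<comment> \<open>Equal cells and equal residue classes force the gradients to within 1/L.
    Separation then places the corners within 1/(s lam L), which is q/(s lam L^2), at most 4/s, in
    units of the box side.\<close>
  have fib: "\<bar>b $ m - b' $ m\<bar> \<le> D"
    if b: "b \<in> B" "b' \<in> B" and eq: "\<kappa> b = \<kappa> b'" "v b = v b'" for b b' m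
  proof -
    have bk: "b $ k = b' $ k" using fun_cong[OF eq(1), of k] by (simp add: \<kappa>_def)
    have d: "\<bar>P b $ m - P b' $ m\<bar> < 1 / \<Lambda>" for m
    proof (cases "m = k")
      case True
      then show ?thesis using bk \<Lambda>1 by (simp add: Pb)
    next
      case False
      then have "\<lfloor>\<Lambda> * P b $ m\<rfloor> = \<lfloor>\<Lambda> * P b' $ m\<rfloor>" using fun_cong[OF eq(1), of m] by (simp add: \<kappa>_def)
      then have "\<bar>\<Lambda> * P b $ m - \<Lambda> * P b' $ m\<bar> < 1" by linarith
      then have "\<Lambda> * \<bar>P b $ m - P b' $ m\<bar> < 1"
        using \<Lambda>1 by (simp add: right_diff_distrib[symmetric] abs_mult)
      then show ?thesis using \<Lambda>1 by (simp add: field_simps)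
    qed
    have g: "\<bar>partial_derivative i F (P b) - partial_derivative i F (P b')\<bar> \<le> 1 / 2" for i
    proof -
      have "\<bar>partial_derivative i F (P b) - partial_derivative i F (P b')\<bar> \<le> CARD('n) * (K * lam) * (1 / \<Lambda>)"
      proof (rule partial_derivative_lipschitz[OF cF, where c = x0 and r = 3])
        show "\<bar>P b' $ m - x0 $ m\<bar> \<le> 3" "\<bar>P b $ m - x0 $ m\<bar> \<le> 3" for m
          using Bx(1)[OF b(1), of m] Bx(1)[OF b(2), of m] e by linarith+
      qed (use less_imp_le[OF d] Fb in auto)
      also have "\<dots> = 1 / 2" using n0 K lam by (simp add: \<Lambda>_def n_def)
      finally show ?thesis .
    qed
    \<comment> \<open>The gradients differ by at most 1/2 and their fractional parts by less than
      1/2, so the integer parts differ by less than 1 and coincide.\<close>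
    have g': "\<bar>partial_derivative i F (P b) - partial_derivative i F (P b')\<bar> \<le> 1 / L" for i
    proof -
      let ?x = "partial_derivative i F (P b)" and ?y = "partial_derivative i F (P b')"
      have "v b i = v b' i" using eq(2) by simp
      then have "\<lfloor>frac ?x * L\<rfloor> = \<lfloor>frac ?y * L\<rfloor>"
        by (simp add: v_def eq_nat_nat_iff frac_ge_0)
      then have "\<bar>frac ?x * L - frac ?y * L\<bar> < 1" by linarith
      then have "\<bar>frac ?x - frac ?y\<bar> * L < 1"
        using LR by (simp add: left_diff_distrib[symmetric] abs_mult)
      then have fr: "\<bar>frac ?x - frac ?y\<bar> < 1 / L" using LR by (simp add: field_simps)
      moreover have "1 / real L \<le> 1 / 2" using LR by (simp add: field_simps)
      ultimately have "\<bar>frac ?x - frac ?y\<bar> < 1 / 2" by linarith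
      moreover have eqxy: "?x - ?y = of_int (\<lfloor>?x\<rfloor> - \<lfloor>?y\<rfloor>) + (frac ?x - frac ?y)" by (simp add: frac_def)
      ultimately have "\<bar>real_of_int (\<lfloor>?x\<rfloor> - \<lfloor>?y\<rfloor>)\<bar> < 1" using g[of i] by linarith
      then have "\<lfloor>?x\<rfloor> - \<lfloor>?y\<rfloor> = 0" by linarith
      then show ?thesis using eqxy fr by simp
    qed
    obtain i where i: "\<And>m. s * lam * \<bar>P b $ m - P b' $ m\<bar> \<le> \<bar>partial_derivative i F (P b) - partial_derivative i F (P b')\<bar>"
      using sep[unfolded slice_separated_def, rule_format, of "P b" "P b'"] Bx(1) b bk Pb by auto
    have "s * lam * (L / q * \<bar>real_of_int (b $ m) - b' $ m\<bar>) \<le> 1 / L"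
    proof -
      have "P b $ m - P b' $ m = L / q * (real_of_int (b $ m) - b' $ m)" by (simp add: Pb right_diff_distrib)
      then have "\<bar>P b $ m - P b' $ m\<bar> = L / q * \<bar>real_of_int (b $ m) - b' $ m\<bar>" by (simp add: abs_mult)
      then show ?thesis using i[of m] g'[of i] by simp
    qed
    then have "s * \<bar>real_of_int (b $ m) - b' $ m\<bar> * (lam * (real L)\<^sup>2) \<le> q"
      using q LR by (simp add: field_simps power2_eq_square)
    also have "\<dots> \<le> 4 * (lam * (real L)\<^sup>2)" using Lq(2) by simp
    finally have "s * \<bar>real_of_int (b $ m) - b' $ m\<bar> \<le> 4"
      using lam LR by (simp add: mult_le_cancel_right)
    then have "\<bar>real_of_int (b $ m) - b' $ m\<bar> \<le> 4 / s" using s by (simp add: field_simps)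
    then show ?thesis unfolding D_def by (simp add: le_floor_iff)
  qed
  have D0: "D \<ge> 0" using s by (simp add: D_def)
  \<comment> \<open>The weight depends only on the second component, so the sum over all pairs is
    the number of cells times the \<open>n\<close>-th power of a one-dimensional sum.\<close>
  let ?Y = "PiE UNIV S \<times> PiE UNIV (\<lambda>_::'n. {..<L})"
  let ?h = "\<lambda>y. \<Prod>i\<in>UNIV. 2 * geometric_weight L (snd y i)"
  have finS: "finite (S i)" for i by (simp add: S_def)
  have "(\<Sum>b\<in>B. ?h (\<kappa> b, v b)) \<le> nat (2 * D + 1) ^ n * (\<Sum>y\<in>?Y. ?h y)"
  proof (rule sum_fiber_bound[OF finB])
    show "finite ?Y" using finS by (intro finite_cartesian_product finite_PiE) auto
    show "(\<lambda>b. (\<kappa> b, v b)) ` B \<subseteq> ?Y" using \<kappa>S v_lt by auto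
    show "?h y \<ge> 0" for y by (intro prod_nonneg) (auto simp: geometric_weight_nonneg)
    fix y
    show "card {b \<in> B. (\<kappa> b, v b) = y} \<le> nat (2 * D + 1) ^ n"
    proof (cases "{b \<in> B. (\<kappa> b, v b) = y} = {}")
      case False
      then obtain b0 where b0: "b0 \<in> B" "(\<kappa> b0, v b0) = y" by auto
      have "{b \<in> B. (\<kappa> b, v b) = y} \<subseteq> {b. \<forall>i. b $ i \<in> {b0 $ i - D..b0 $ i + D}}"
      proof safe
        fix b i assume "b \<in> B" "y = (\<kappa> b, v b)"
        then have "\<bar>b $ i - b0 $ i\<bar> \<le> D" using b0 by (intro fib) auto
        then show "b $ i \<in> {b0 $ i - D..b0 $ i + D}" by auto
      qed
      then have "card {b \<in> B. (\<kappa> b, v b) = y} \<le> card {b::int^'n. \<forall>i. b $ i \<in> {b0 $ i - D..b0 $ i + D}}"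
        by (intro card_mono card_vector_box) auto
      also have "\<dots> \<le> (\<Prod>i\<in>(UNIV::'n set). card {b0 $ i - D..b0 $ i + D})"
        by (intro card_vector_box) auto
      also have "\<dots> = nat (2 * D + 1) ^ n"
        by (simp add: n_def algebra_simps)
      finally show ?thesis .
    qed (simp only: card.empty)
  qed
  also have "(\<Sum>y\<in>?Y. ?h y) = card (PiE UNIV S) * (\<Sum>v\<in>PiE UNIV (\<lambda>_::'n. {..<L}). \<Prod>i\<in>UNIV. 2 * geometric_weight L (v i))"
    using sum.cartesian_product[of "\<lambda>_ v. \<Prod>i\<in>UNIV. 2 * geometric_weight L (v i)" "PiE UNIV (\<lambda>_::'n. {..<L})" "PiE UNIV S"]
    by (simp add: case_prod_beta)
  also have "(\<Sum>v\<in>PiE UNIV (\<lambda>_::'n. {..<L}). \<Prod>i\<in>UNIV. 2 * geometric_weight L (v i)) = (\<Sum>v<L. 2 * geometric_weight L v) ^ n"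
    by (subst prod_sum_PiE[symmetric]) (auto simp: n_def)
  also have "nat (2 * D + 1) ^ n * (card (PiE UNIV S) * (\<Sum>v<L. 2 * geometric_weight L v) ^ n)
    \<le> (8 / s + 1) ^ n * ((3 * X * (q / L)) * (5 * \<Lambda> * X) ^ (n - 1) * (4 * real L * (2 + ln L)) ^ n)"
    unfolding of_nat_mult of_nat_power
  proof (intro mult_mono power_mono)
    have "real_of_int D \<le> 4 / s" by (simp add: D_def)
    then show "real (nat (2 * D + 1)) \<le> 8 / s + 1" using D0 by simp
    show "(\<Sum>v<L. 2 * geometric_weight L v) \<le> 4 * real L * (2 + ln L)"
      using sum_geometric_weight[of L] L by (simp add: sum_distrib_left[symmetric])
    show "0 \<le> real (nat (2 * D + 1))" by simp
    have XqL: "X * (q / L) \<ge> 1" using X qL1 mult_mono[of 1 X 1 "q / L"] by simp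
    have c1: "real (card {- N1..N1}) \<le> 3 * X * (q / L)"
    proof -
      have "N1 \<ge> 0" unfolding N1_def using XqL by simp
      then have "real (card {- N1..N1}) = 2 * of_int N1 + 1" by simp
      also have "\<dots> \<le> 2 * (X * (q / L)) + 1" unfolding N1_def by linarith
      finally show ?thesis using XqL by linarith
    qed
    have \<Lambda>X: "\<Lambda> * X \<ge> 1" using X \<Lambda>1 mult_mono[of 1 \<Lambda> 1 X] by simp
    have c2: "real (card {- N2..N2}) \<le> 5 * \<Lambda> * X"
    proof -
      have N2_le: "real_of_int N2 \<le> \<Lambda> * X + 1" unfolding N2_def by (rule of_int_ceiling_le_add_one)
      have "N2 \<ge> 0" unfolding N2_def using \<Lambda>X by simp
      then have "real (card {- N2..N2}) = 2 * of_int N2 + 1" by simp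
      also have "\<dots> \<le> 2 * (\<Lambda> * X + 1) + 1"
        by (intro add_mono mult_left_mono N2_le) auto
      also have "\<dots> = 2 * (\<Lambda> * X) + 3 * 1" by simp
      also have "\<dots> \<le> 2 * (\<Lambda> * X) + 3 * (\<Lambda> * X)"
        by (rule add_left_mono, rule mult_left_mono[OF \<Lambda>X]) simp
      finally show ?thesis by (simp add: mult_ac)
    qed
    have "card (PiE UNIV S) = card (S k) * (\<Prod>i\<in>UNIV - {k}. card (S i))"
      by (simp add: card_PiE prod.remove[of UNIV k])
    also have "(\<Prod>i\<in>UNIV - {k}. card (S i)) = card {- N2..N2} ^ (n - 1)"
      by (simp add: S_def n_def)
    also have "card (S k) = card {- N1..N1}" by (simp add: S_def)
    finally have "real (card (PiE UNIV S)) = real (card {- N1..N1}) * real (card {- N2..N2}) ^ (n - 1)"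
      by (simp only: of_nat_mult of_nat_power)
    also have "\<dots> \<le> (3 * X * (q / L)) * (5 * \<Lambda> * X) ^ (n - 1)"
      using X by (intro mult_mono power_mono c1 c2) auto
    finally show "real (card (PiE UNIV S)) \<le> (3 * X * (q / L)) * (5 * \<Lambda> * X) ^ (n - 1)" .
  qed (use s X \<Lambda>1 LR in \<open>auto intro!: sum_nonneg mult_nonneg_nonneg zero_le_power simp: geometric_weight_nonneg\<close>)
  also have "\<dots> = count_const n K s X * q * (lam * L) ^ (n - 1) * (2 + ln L) ^ n"
  proof -
    obtain m where m: "n = Suc m" using n0 by (cases n) auto
    have gen: "a * ((x * (y / z)) * (c * u) ^ m * (4 * z * l) ^ Suc m) = a * x * c ^ m * 4 ^ Suc m * y * (u * z) ^ m * l ^ Suc m"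
      if "z \<noteq> 0" for a x y z c u l :: real
      using that by (simp add: power_mult_distrib)
    have c: "5 * \<Lambda> * X = (10 * real n * K * X) * lam" by (simp add: \<Lambda>_def)
    have "real L \<noteq> 0" using LR by simp
    from gen[OF this, of "(8 / s + 1) ^ n" "3 * X" "real q" "10 * real n * K * X" lam "2 + ln L"]
    show ?thesis unfolding count_const_def c by (simp only: m diff_Suc_1)
  qed
  finally show ?thesis by (simp add: n_def v_def)
qed

section \<open>The exponential sum for one denominator\<close>

abbreviation weighted_points :: "(real^'n \<Rightarrow> real) \<Rightarrow> nat \<Rightarrow> (int^'n) set" where
  "weighted_points w q \<equiv> {a. w (rational_point a q) \<noteq> 0}"

definition exponential_sum :: "(real^'n \<Rightarrow> real) \<Rightarrow> (real^'n \<Rightarrow> real) \<Rightarrow> nat \<Rightarrow> complex" where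
  "exponential_sum w F q = (\<Sum>a\<in>weighted_points w q.
     of_real (w (rational_point a q)) * cis (2 * pi * (q * F (rational_point a q))))"

lemma support_points:
  fixes w :: "real^'n \<Rightarrow> real"
  assumes "q > 0" "X \<ge> 0" "\<And>y m. w y \<noteq> 0 \<Longrightarrow> \<bar>y $ m\<bar> \<le> X"
  shows "finite (weighted_points w q)"
    and "real (card (weighted_points w q)) \<le> ((2 * X + 1) * q) ^ CARD('n)"
proof -
  define N where "N = \<lfloor>X * q\<rfloor>"
  have N0: "N \<ge> 0" using assms by (simp add: N_def)
  have sub: "weighted_points w q \<subseteq> {a. \<forall>i. a $ i \<in> {- N..N}}"
  proof safe
    fix a :: "int^'n" and i assume "w (rational_point a q) \<noteq> 0"
    from assms(3)[OF this, of i] have "\<bar>real_of_int (a $ i)\<bar> \<le> X * q"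
      using assms(1) by (simp add: rational_point_def field_simps)
    then have "\<bar>a $ i\<bar> \<le> N" unfolding N_def by (simp add: le_floor_iff)
    then show "a $ i \<in> {- N..N}" by auto
  qed
  have fin: "finite {a::int^'n. \<forall>i. a $ i \<in> {- N..N}}"
    by (rule card_vector_box) auto
  then show "finite (weighted_points w q)" using sub finite_subset by blast
  have "card (weighted_points w q) \<le> card {a::int^'n. \<forall>i. a $ i \<in> {- N..N}}"
    using sub fin by (rule card_mono[rotated])
  also have "\<dots> \<le> (\<Prod>i\<in>(UNIV::'n set). card {- N..N})" by (rule card_vector_box) auto
  finally have "real (card (weighted_points w q)) \<le> real (card {- N..N}) ^ CARD('n)"
    by (simp flip: of_nat_power)
  also have "\<dots> \<le> ((2 * X + 1) * q) ^ CARD('n)"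
  proof (rule power_mono)
    have "real (card {- N..N}) = 2 * of_int N + 1" using N0 by simp
    also have "\<dots> \<le> 2 * (X * q) + q" using assms(1) of_int_floor_le[of "X * q"] unfolding N_def by linarith
    finally show "real (card {- N..N}) \<le> (2 * X + 1) * q" by (simp add: algebra_simps)
  qed simp
  finally show "real (card (weighted_points w q)) \<le> ((2 * X + 1) * q) ^ CARD('n)" .
qed

text \<open>Division with remainder tiles the lattice by boxes. As \<open>G\<close> vanishes off
  \<open>A\<close>, every box that meets \<open>A\<close> can be summed in full, which keeps the
  ranges in the box estimate rectangular.\<close>

lemma sum_over_boxes:
  fixes G :: "int^'n \<Rightarrow> complex" and L :: nat
  assumes "finite A" "L > 0" "\<And>a. a \<notin> A \<Longrightarrow> G a = 0"
  shows "(\<Sum>a\<in>A. G a) = (\<Sum>b\<in>(\<lambda>a. \<chi> i. a $ i div L) ` A.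
    \<Sum>u\<in>{u. \<forall>i. u i < L}. G (\<chi> i. int L * b $ i + int (u i)))"
proof -
  define d where "d a = (\<chi> i. a $ i div int L)" for a :: "int^'n"
  define U where "U = {u :: 'n \<Rightarrow> nat. \<forall>i. u i < L}"
  have "U = PiE UNIV (\<lambda>_. {..<L})" by (auto simp: U_def)
  then have finU: "finite U" by (simp add: finite_PiE)
  have "(\<Sum>a\<in>A. G a) = (\<Sum>b\<in>d ` A. \<Sum>a\<in>{a \<in> A. d a = b}. G a)"
    using assms(1) by (intro sum.group[symmetric]) auto
  also have "\<dots> = (\<Sum>b\<in>d ` A. \<Sum>u\<in>U. G (\<chi> i. int L * b $ i + int (u i)))"
  proof (rule sum.cong[OF refl])
    fix b
    define \<phi> where "\<phi> u = (\<chi> i. int L * b $ i + int (u i))" for u :: "'n \<Rightarrow> nat"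
    have inj: "inj_on \<phi> U" by (auto simp: inj_on_def \<phi>_def vec_eq_iff)
    have im: "\<phi> ` U = {a. d a = b}"
    proof (intro equalityI subsetI)
      fix a assume "a \<in> \<phi> ` U"
      then show "a \<in> {a. d a = b}"
        using assms(2) by (auto simp: \<phi>_def d_def U_def vec_eq_iff)
    next
      fix a assume a: "a \<in> {a. d a = b}"
      have "a $ i = int L * b $ i + a $ i mod int L" for i
        using a mult_div_mod_eq[of "int L" "a $ i"] by (auto simp: d_def)
      then have "a = \<phi> (\<lambda>i. nat (a $ i mod int L))"
        using assms(2) by (simp add: \<phi>_def vec_eq_iff)
      moreover have "(\<lambda>i. nat (a $ i mod int L)) \<in> U"
        using assms(2) by (simp add: U_def nat_less_iff)
      ultimately show "a \<in> \<phi> ` U" by blast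
    qed
    have "(\<Sum>a\<in>{a \<in> A. d a = b}. G a) = (\<Sum>a\<in>\<phi> ` U. G a)"
      using assms(3) im by (intro sum.mono_neutral_left finite_imageI[OF finU]) auto
    also have "\<dots> = (\<Sum>u\<in>U. G (\<phi> u))" using inj by (simp add: sum.reindex)
    finally show "(\<Sum>a\<in>{a \<in> A. d a = b}. G a) = (\<Sum>u\<in>U. G (\<chi> i. int L * b $ i + int (u i)))"
      by (simp add: \<phi>_def)
  qed
  finally show ?thesis by (simp add: d_def U_def)
qed

text \<open>The first summand covers the range where the trivial bound is used, the second the
  decomposition into boxes. There \<open>X + 1\<close> replaces \<open>X\<close> because the corner
  of a box meeting the support may lie slightly outside it.\<close>

definition exponential_sum_const :: "nat \<Rightarrow> real \<Rightarrow> real \<Rightarrow> real \<Rightarrow> real \<Rightarrow> real" where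
  "exponential_sum_const n W K s X = W * (2 * X + 1) ^ n * (2 + (real n + 1) / s) ^ (n - 1)
     + amplitude_const n W K * count_const n K s (X + 1)"

lemma exponential_sum_trivial_bound:
  fixes w F :: "real^'n \<Rightarrow> real" and W X :: real
  assumes "q > 0" "X \<ge> 0" "\<And>y m. w y \<noteq> 0 \<Longrightarrow> \<bar>y $ m\<bar> \<le> X" "\<And>y. \<bar>w y\<bar> \<le> W"
  shows "cmod (exponential_sum w F q) \<le> W * ((2 * X + 1) * q) ^ CARD('n)"
proof -
  have W: "W \<ge> 0" using assms(4)[of 0] by linarith
  have "cmod (exponential_sum w F q) \<le> (\<Sum>a\<in>weighted_points w q. W)"
    unfolding exponential_sum_def using assms(4) by (intro sum_norm_le) (simp add: norm_mult)
  also have "\<dots> = real (card (weighted_points w q)) * W" by simp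
  also have "\<dots> \<le> ((2 * X + 1) * q) ^ CARD('n) * W"
    using support_points(2)[of q X w] assms W by (intro mult_right_mono) auto
  finally show ?thesis by (simp add: mult.commute)
qed

text \<open>With L the integer part of sqrt(q/lam), the box argument needs L to be at least 2 and
  the boxes to be short compared with \<open>s\<close>. If either fails, sqrt q is at most a
  constant times sqrt lam, and then the trivial bound of order q^n is already of order q sqrt(q
  lam)^(n-1).\<close>

lemma exponential_sum_bound:
  fixes w F :: "real^'n \<Rightarrow> real" and K lam s X e W :: real and q :: nat
  assumes n2: "CARD('n) \<ge> 2"
    and cd: "cont_diff CARD('n) w" "cont_diff CARD('n) F"
    and wb: "\<And>js y. length js \<le> CARD('n) \<Longrightarrow> \<bar>iterated_partial js w y\<bar> \<le> W"
    and Fb: "\<And>js y. js \<noteq> [] \<Longrightarrow> length js \<le> CARD('n) \<Longrightarrow> (\<And>i. \<bar>y $ i - x0 $ i\<bar> \<le> 3) \<Longrightarrow>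
      \<bar>iterated_partial js F y\<bar> \<le> K * lam"
    and K: "K \<ge> 1" and lam: "lam \<ge> 1" and q: "q > 0" and s: "0 < s" "s \<le> e" and e: "e \<le> 1" and X: "X \<ge> 0"
    and supp: "\<And>y m. w y \<noteq> 0 \<Longrightarrow> \<bar>y $ m - x0 $ m\<bar> \<le> e" "\<And>y m. w y \<noteq> 0 \<Longrightarrow> \<bar>y $ m\<bar> \<le> X"
    and sep: "slice_separated F k (s * lam) x0 (2 * e)"
  shows "cmod (exponential_sum w F q) \<le>
    exponential_sum_const CARD('n) W K s X * q * sqrt (q * lam) ^ (CARD('n) - 1) * (2 + ln q) ^ CARD('n)"
proof -
  define n where "n = CARD('n)"
  define Y where "Y = sqrt (q * lam) ^ (n - 1)"
  have W: "W \<ge> 0" using wb[of "[]" x0] by simp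
  have Y0: "Y \<ge> 0" using lam by (simp add: Y_def)
  have lnq: "ln (real q) \<ge> 0" using q by simp
  have log1: "(2 + ln (real q)) ^ n \<ge> 1" using lnq by (intro one_le_power) simp
  have nonneg: "amplitude_const n W K * count_const n K s (X + 1) \<ge> 0" "W * (2 * X + 1) ^ n * (2 + (real n + 1) / s) ^ (n - 1) \<ge> 0"
    using W K s X by (simp_all add: amplitude_const_def count_const_def)
  have trivial: "cmod (exponential_sum w F q) \<le> exponential_sum_const n W K s X * q * Y * (2 + ln q) ^ n"
    if c: "sqrt q \<le> (2 + (real n + 1) / s) * sqrt lam"
  proof -
    have "sqrt q * sqrt q \<le> sqrt q * ((2 + (real n + 1) / s) * sqrt lam)"
      using c by (intro mult_left_mono) auto
    then have qq: "real q \<le> (2 + (real n + 1) / s) * sqrt (q * lam)" by (simp add: real_sqrt_mult mult_ac)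
    have "cmod (exponential_sum w F q) \<le> W * ((2 * X + 1) * q) ^ n"
      unfolding n_def using q X supp(2) wb[of "[]"] by (intro exponential_sum_trivial_bound) auto
    also have "((2 * X + 1) * q) ^ n = (2 * X + 1) ^ n * q * real q ^ (n - 1)"
      using n2 by (cases n) (auto simp: n_def power_mult_distrib)
    also have "W * ((2 * X + 1) ^ n * q * real q ^ (n - 1)) \<le> W * ((2 * X + 1) ^ n * q * ((2 + (real n + 1) / s) * sqrt (q * lam)) ^ (n - 1))"
      using W X qq by (intro mult_left_mono power_mono) auto
    also have "\<dots> = W * (2 * X + 1) ^ n * (2 + (real n + 1) / s) ^ (n - 1) * (q * Y)"
      by (simp add: Y_def power_mult_distrib mult_ac)
    also have "\<dots> \<le> exponential_sum_const n W K s X * (q * Y)"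
      unfolding exponential_sum_const_def using nonneg(1) Y0 by (intro mult_right_mono) simp_all
    also have "\<dots> * 1 \<le> exponential_sum_const n W K s X * (q * Y) * (2 + ln q) ^ n"
      unfolding exponential_sum_const_def using nonneg Y0 log1 by (intro mult_left_mono) auto
    finally show ?thesis by (simp add: mult_ac)
  qed
  define L where "L = nat \<lfloor>sqrt (q / lam)\<rfloor>"
  have "cmod (exponential_sum w F q) \<le> exponential_sum_const n W K s X * q * Y * (2 + ln q) ^ n"
  proof (cases "L \<ge> 2 \<and> (real n + 1) * L \<le> q * s")
    case False
    have sqL: "sqrt (q / lam) < L + 1" unfolding L_def by linarith
    have Lsq: "real L \<le> sqrt (q / lam)" unfolding L_def using lam by simp
    have ql: "sqrt q = sqrt (q / lam) * sqrt lam" using lam by (simp add: real_sqrt_divide)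
    have ls: "sqrt lam \<ge> 1" using lam by simp
    show ?thesis
    proof (cases "L \<ge> 2")
      case True
      with False have "q * s < (real n + 1) * L" by simp
      also have "\<dots> \<le> (real n + 1) * sqrt q"
      proof (rule mult_left_mono)
        have "sqrt (q / lam) \<le> sqrt q" using lam by (simp add: divide_le_eq mult_le_cancel_left1)
        then show "real L \<le> sqrt q" by (rule order_trans[OF Lsq])
      qed simp
      finally have "(sqrt q * sqrt q) * s < (real n + 1) * sqrt q" by simp
      then have "sqrt q * (sqrt q * s) < sqrt q * (real n + 1)" by (simp only: mult_ac)
      then have "sqrt q * s < real n + 1" by (rule mult_left_less_imp_less) simp
      then have "sqrt q \<le> (real n + 1) / s" using s by (simp add: pos_le_divide_eq)
      also have "\<dots> * 1 \<le> (2 + (real n + 1) / s) * sqrt lam"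
        using ls s by (intro mult_mono) auto
      finally show ?thesis by (intro trivial) simp
    next
      case False
      then have "sqrt (q / lam) \<le> 2 + (real n + 1) / s"
        using sqL s by (simp add: add_increasing2)
      then show ?thesis
        by (intro trivial, subst ql) (use lam in \<open>auto intro: mult_right_mono\<close>)
    qed
  next
    case True
    then have L2: "L \<ge> 2" and Ls: "(real n + 1) * L \<le> q * s" by auto
    have Ls': "real L \<le> q * s"
    proof -
      have "1 * real L \<le> (real n + 1) * L" by (intro mult_right_mono) auto
      then show ?thesis using Ls by simp
    qed
    have fl: "real L \<le> sqrt (q / lam)" "sqrt (q / lam) \<le> 2 * L"
      using L2 unfolding L_def by linarith+
    have "(real L)\<^sup>2 \<le> (sqrt (q / lam))\<^sup>2" "(sqrt (q / lam))\<^sup>2 \<le> (2 * real L)\<^sup>2"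
      using fl lam by (intro power_mono; simp)+
    then have Lq: "lam * (real L)\<^sup>2 \<le> q" "q \<le> 4 * lam * (real L)\<^sup>2"
      using lam by (simp_all add: field_simps power_mult_distrib)
    have s1: "q * s \<le> q" using s e by (simp add: mult_left_le)
    define A where "A = weighted_points w q"
    define B where "B = (\<lambda>a. \<chi> i. a $ i div int L) ` A"
    define P where "P = (\<lambda>b::int^'n. \<chi> i. real L * of_int (b $ i) / q)"
    define G where "G a = of_real (w (rational_point a q)) * cis (2 * pi * (q * F (rational_point a q)))" for a
    have finA: "finite A" unfolding A_def using q X supp(2) by (intro support_points) auto
    \<comment> \<open>A corner within \<open>s\<close>, hence within \<open>e\<close>, of the
      support stays within \<open>2 * e\<close> of \<open>x0\<close>; this is why separation is
      required on the doubled cube.\<close>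
    have near: "\<exists>y. w y \<noteq> 0 \<and> (\<forall>m. \<bar>P b $ m - y $ m\<bar> \<le> s)" if b: "b \<in> B" for b
    proof -
      obtain a where a: "a \<in> A" "b = (\<chi> i. a $ i div int L)" using b unfolding B_def by blast
      have "\<bar>P b $ m - rational_point a q $ m\<bar> \<le> s" for m
      proof -
        have "a $ m = int L * (a $ m div int L) + a $ m mod int L" by simp
        from arg_cong[OF this, of real_of_int]
        have "real_of_int (a $ m) = real L * real_of_int (a $ m div int L) + real_of_int (a $ m mod int L)"
          by (simp only: of_int_add of_int_mult of_int_of_nat_eq)
        then have "P b $ m - rational_point a q $ m = - real_of_int (a $ m mod int L) / q"
          by (simp add: P_def rational_point_def a(2) diff_divide_distrib[symmetric])
        moreover have "a $ m mod int L < int L" "0 \<le> a $ m mod int L" using L2 by simp_all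
        then have "real_of_int (a $ m mod int L) \<le> L" "0 \<le> real_of_int (a $ m mod int L)" by linarith+
        ultimately have "\<bar>P b $ m - rational_point a q $ m\<bar> \<le> L / q"
          by (simp add: divide_right_mono)
        also have "\<dots> \<le> s" using Ls' q by (simp add: field_simps)
        finally show ?thesis .
      qed
      then show ?thesis using a by (auto simp: A_def)
    qed
    have Bx: "\<bar>P b $ m - x0 $ m\<bar> \<le> 2 * e" "\<bar>P b $ m\<bar> \<le> X + 1" if b: "b \<in> B" for b m
    proof -
      obtain y where y: "w y \<noteq> 0" "\<And>m. \<bar>P b $ m - y $ m\<bar> \<le> s" using near[OF b] by blast
      show "\<bar>P b $ m - x0 $ m\<bar> \<le> 2 * e" "\<bar>P b $ m\<bar> \<le> X + 1"
        using supp[OF y(1), of m] y(2)[of m] s e by linarith+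
    qed
    have gp: "rational_point (\<chi> i. int L * b $ i + int (u i)) q = grid_point (P b) (1 / q) u" for b u
      using q by (simp add: rational_point_def grid_point_def P_def vec_eq_iff add_divide_distrib)
    let ?g = "\<lambda>b. \<Prod>i\<in>UNIV. 2 * geometric_weight L (nat \<lfloor>frac (partial_derivative i F (P b)) * L\<rfloor>)"
    have "exponential_sum w F q = (\<Sum>a\<in>A. G a)" by (simp add: exponential_sum_def A_def G_def)
    also have "\<dots> = (\<Sum>b\<in>B. \<Sum>u\<in>{u. \<forall>i. u i < L}. G (\<chi> i. int L * b $ i + int (u i)))"
      unfolding B_def using finA L2 by (intro sum_over_boxes) (auto simp: A_def G_def)
    also have "cmod \<dots> \<le> (\<Sum>b\<in>B. amplitude_const n W K * ?g b)"
    proof (rule sum_norm_le)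
      fix b assume b: "b \<in> B"
      show "cmod (\<Sum>u\<in>{u. \<forall>i. u i < L}. G (\<chi> i. int L * b $ i + int (u i))) \<le> amplitude_const n W K * ?g b"
        unfolding G_def gp n_def
      proof (rule box_exponential_sum_bound[OF n2 cd wb Fb])
        show "\<bar>P b $ i - x0 $ i\<bar> \<le> 2" for i using Bx(1)[OF b, of i] e by linarith
        show "(real CARD('n) + 1) * real L \<le> real q" using Ls s1 by (simp add: n_def)
      qed (use K lam q L2 Lq in auto)
    qed
    also have "\<dots> = amplitude_const n W K * (\<Sum>b\<in>B. ?g b)" by (simp add: sum_distrib_left)
    also have "\<dots> \<le> amplitude_const n W K * (count_const n K s (X + 1) * q * (lam * L) ^ (n - 1) * (2 + ln L) ^ n)"
    proof (rule mult_left_mono)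
      have cF: "cont_diff (Suc (Suc 0)) F" using cd(2) cont_diff_mono[of "CARD('n)" F 2] n2 by (simp add: numeral_2_eq_2)
      show "(\<Sum>b\<in>B. ?g b) \<le> count_const n K s (X + 1) * q * (lam * L) ^ (n - 1) * (2 + ln L) ^ n"
        unfolding n_def
      proof (rule sum_geometric_weight_gradients[OF cF _ K lam q L2 Lq sep e s(1)])
        show "\<bar>iterated_partial [i, j] F y\<bar> \<le> K * lam" if "\<And>m. \<bar>y $ m - x0 $ m\<bar> \<le> 3" for i j y
          using n2 that by (intro Fb) auto
        show "finite B" using finA by (simp add: B_def)
      qed (use X Bx P_def in auto)
    qed (use W in \<open>simp add: amplitude_const_def\<close>)
    also have "\<dots> \<le> amplitude_const n W K * (count_const n K s (X + 1) * q * Y * (2 + ln q) ^ n)"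
    proof (intro mult_left_mono mult_mono)
      have "lam * L = sqrt ((lam * L)\<^sup>2)" using lam by simp
      also have "(lam * L)\<^sup>2 \<le> q * lam" using Lq(1) lam by (simp add: power2_eq_square mult_ac mult_left_mono)
      finally have "lam * L \<le> sqrt (q * lam)" by simp
      then show "(lam * L) ^ (n - 1) \<le> Y" unfolding Y_def using lam by (intro power_mono) auto
      have "real L \<le> q" using Ls' s1 by simp
      then show "(2 + ln (real L)) ^ n \<le> (2 + ln (real q)) ^ n" using L2 by (intro power_mono) auto
    qed (use W K s X Y0 lnq L2 lam in \<open>auto simp: amplitude_const_def count_const_def\<close>)
    also have "\<dots> = amplitude_const n W K * count_const n K s (X + 1) * (q * Y * (2 + ln q) ^ n)" by (simp add: mult_ac)
    also have "\<dots> \<le> exponential_sum_const n W K s X * (q * Y * (2 + ln q) ^ n)"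
      unfolding exponential_sum_const_def using nonneg Y0 log1 by (intro mult_right_mono) auto
    finally show ?thesis by (simp add: mult_ac)
  qed
  then show ?thesis by (simp add: n_def Y_def)
qed

section \<open>Trigonometric approximation of the counting condition\<close>

definition trig_poly :: "int \<Rightarrow> (real \<Rightarrow> complex) \<Rightarrow> bool" where
  "trig_poly J g \<longleftrightarrow> (\<exists>c. \<forall>t. g t = (\<Sum>j\<in>{- J..J}. c j * cis (2 * pi * of_int j * t)))"

lemma trig_poly_monomial: "\<bar>u\<bar> \<le> J \<Longrightarrow> trig_poly J (\<lambda>t. a * cis (2 * pi * of_int u * t))"
  unfolding trig_poly_def
  by (rule exI[of _ "\<lambda>j. if j = u then a else 0"]) (auto simp: if_distrib if_distribR sum.delta cong: if_cong)

lemma trig_poly_add: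
  assumes "trig_poly J f" "trig_poly J g"
  shows "trig_poly J (\<lambda>t. f t + g t)"
proof -
  obtain c d where "\<And>t. f t = (\<Sum>j\<in>{- J..J}. c j * cis (2 * pi * of_int j * t))"
    "\<And>t. g t = (\<Sum>j\<in>{- J..J}. d j * cis (2 * pi * of_int j * t))"
    using assms unfolding trig_poly_def by blast
  then show ?thesis
    unfolding trig_poly_def by (intro exI[of _ "\<lambda>j. c j + d j"]) (auto simp: distrib_right sum.distrib)
qed

lemma trig_poly_sum:
  assumes "finite I" "\<And>i. i \<in> I \<Longrightarrow> trig_poly J (f i)"
  shows "trig_poly J (\<lambda>t. \<Sum>i\<in>I. f i t)"
  using assms
proof (induction I rule: finite_induct)
  case empty
  show ?case unfolding trig_poly_def by (rule exI[of _ "\<lambda>_. 0"]) simp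
qed (auto intro: trig_poly_add)

lemma trig_poly_mult:
  assumes "trig_poly J f" "trig_poly J' g"
  shows "trig_poly (J + J') (\<lambda>t. f t * g t)"
proof -
  obtain c d where c: "\<And>t. f t = (\<Sum>j\<in>{- J..J}. c j * cis (2 * pi * of_int j * t))"
    and d: "\<And>t. g t = (\<Sum>j\<in>{- J'..J'}. d j * cis (2 * pi * of_int j * t))"
    using assms unfolding trig_poly_def by blast
  have eq: "(\<lambda>t. f t * g t) = (\<lambda>t. \<Sum>i\<in>{- J..J}. \<Sum>j\<in>{- J'..J'}. (c i * d j) * cis (2 * pi * of_int (i + j) * t))"
    unfolding c d sum_product by (intro ext sum.cong refl) (simp add: cis_mult[symmetric] algebra_simps)
  show ?thesis unfolding eq by (intro trig_poly_sum trig_poly_monomial) auto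
qed

lemma trig_poly_power:
  assumes "trig_poly J f"
  shows "trig_poly (int k * J) (\<lambda>t. f t ^ k)"
proof (induction k)
  case 0
  show ?case using trig_poly_monomial[of 0 0 1] by simp
next
  case (Suc k)
  show ?case using trig_poly_mult[OF assms Suc] by (simp add: algebra_simps)
qed

lemma has_integral_cis:
  assumes "m \<noteq> 0" "a \<le> b"
  shows "((\<lambda>t. cis (2 * pi * of_int m * t)) has_integral
    (cis (2 * pi * of_int m * b) - cis (2 * pi * of_int m * a)) / (\<i> * (2 * pi * of_int m))) {a..b}"
proof -
  have "((\<lambda>t. cis (2 * pi * of_int m * t) / (\<i> * (2 * pi * of_int m))) has_vector_derivative cis (2 * pi * of_int m * x)) (at x within {a..b})" for x
  proof -
    have "((\<lambda>z. exp (\<i> * (2 * pi * of_int m) * z) / (\<i> * (2 * pi * of_int m))) has_field_derivative exp (\<i> * (2 * pi * of_int m) * of_real x)) (at (of_real x))"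
      using assms(1) by (auto intro!: derivative_eq_intros)
    from has_vector_derivative_real_field[OF this]
    show ?thesis by (simp add: cis_conv_exp mult_ac)
  qed
  from fundamental_theorem_of_calculus[OF assms(2) this]
  show ?thesis by (simp add: diff_divide_distrib)
qed

lemma nearest_int_dist_le: "nearest_int_dist x \<le> \<bar>x - of_int m\<bar>"
  unfolding nearest_int_dist_def 
  using infdist_le[of "of_int m" "\<int>" x] by (simp add: dist_real_def)

lemma nearest_int_dist_attained: obtains m where "nearest_int_dist x = \<bar>x - of_int m\<bar>"
proof -
  have "(\<int> :: real set) \<noteq> {}" by auto
  then obtain y where y: "y \<in> \<int>" "infdist x \<int> = dist x y"
    using infdist_attains_inf[OF closed_Ints, of x] by blast
  from y(1) obtain m where "y = of_int m" by (rule Ints_cases)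
  with y(2) show ?thesis by (intro that[of m]) (simp add: nearest_int_dist_def dist_real_def)
qed

section \<open>Powers of the Fejer kernel\<close>

text \<open>The squared modulus of the geometric sum is the Fejer kernel up to normalisation; the
  total mass is divided out only in \<open>smoothed_indicator\<close>.\<close>

definition fejer_power :: "nat \<Rightarrow> nat \<Rightarrow> real \<Rightarrow> real" where
  "fejer_power M k t = cmod (\<Sum>u<M. cis (2 * pi * t) ^ u) ^ (2 * k)"

lemma continuous_fejer_power: "continuous_on S (fejer_power M k)"
  unfolding fejer_power_def by (intro continuous_intros)

lemma fejer_power_integrable: "fejer_power M k integrable_on {a..b}"
  by (intro integrable_continuous_interval continuous_fejer_power)

lemma fejer_power_nonneg: "fejer_power M k t \<ge> 0"
  by (simp add: fejer_power_def)

lemma fejer_power_trig_poly: "trig_poly (2 * int k * int M) (\<lambda>t. of_real (fejer_power M k t))"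
proof -
  define D where "D t = (\<Sum>u<M. cis (2 * pi * t) ^ u)" for t
  have 1: "D t = (\<Sum>u<M. 1 * cis (2 * pi * of_int (int u) * t))" for t
    unfolding D_def Complex.DeMoivre by (simp add: mult_ac)
  have 2: "cnj (D t) = (\<Sum>u<M. 1 * cis (2 * pi * of_int (- int u) * t))" for t
    unfolding 1 cnj_sum complex_cnj_mult cis_cnj by simp
  have D: "trig_poly (int M) (\<lambda>t. D t)"
    unfolding 1 by (intro trig_poly_sum trig_poly_monomial) auto
  have D': "trig_poly (int M) (\<lambda>t. cnj (D t))"
    unfolding 2 by (intro trig_poly_sum trig_poly_monomial) auto
  from trig_poly_power[OF trig_poly_mult[OF D D'], of k]
  have "trig_poly (2 * int k * int M) (\<lambda>t. (D t * cnj (D t)) ^ k)" by (simp add: algebra_simps)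
  moreover have "(D t * cnj (D t)) ^ k = of_real (fejer_power M k t)" for t
    unfolding complex_norm_square[symmetric] fejer_power_def D_def[symmetric]
    by (simp add: power_mult)
  ultimately show ?thesis by simp
qed

lemma fejer_power_le:
  assumes "\<eta> > 0" "nearest_int_dist t \<ge> \<eta>"
  shows "fejer_power M k t \<le> (1 / (2 * \<eta>)) ^ (2 * k)"
proof -
  have "\<eta> \<le> frac t" using nearest_int_dist_le[of t "\<lfloor>t\<rfloor>"] assms(2) by (simp add: frac_def)
  moreover have "\<eta> \<le> 1 - frac t"
    using nearest_int_dist_le[of t "\<lfloor>t\<rfloor> + 1"] assms(2) frac_lt_1[of t] by (simp add: frac_def)
  ultimately have z: "4 * \<eta> \<le> cmod (cis (2 * pi * t) - 1)"
    using assms(1) by (intro norm_cis_minus_one_ge) auto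
  then have "cis (2 * pi * t) \<noteq> 1" using assms(1) by auto
  then have "cmod (\<Sum>u<M. cis (2 * pi * t) ^ u) = cmod (cis (2 * pi * t) ^ M - 1) / cmod (cis (2 * pi * t) - 1)"
    by (simp add: geometric_sum norm_divide)
  also have "\<dots> \<le> 2 / (4 * \<eta>)"
  proof (rule frac_le)
    show "cmod (cis (2 * pi * t) ^ M - 1) \<le> 2"
      using norm_triangle_ineq4[of "cis (2 * pi * t) ^ M" 1] by (simp add: norm_power)
  qed (use z assms in auto)
  finally show ?thesis unfolding fejer_power_def by (intro power_mono) auto
qed

text \<open>For such \<open>t\<close> all phases \<open>2 * pi * u * t\<close> stay within pi/3, so
  every term has real part at least 1/2.\<close>

lemma fejer_power_ge:
  assumes "M > 0" "\<bar>t\<bar> \<le> 1 / (6 * M)"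
  shows "fejer_power M k t \<ge> (M / 2) ^ (2 * k)"
proof -
  have "(\<Sum>u<M. 1 / 2) \<le> (\<Sum>u<M. Re (cis (2 * pi * t) ^ u))"
  proof (rule sum_mono)
    fix u assume u: "u \<in> {..<M}"
    have "\<bar>real u * t\<bar> \<le> M * (1 / (6 * M))"
      unfolding abs_mult using assms u by (intro mult_mono) auto
    then have ut: "\<bar>real u * t\<bar> \<le> 1 / 6" using assms by simp
    have "2 * pi * \<bar>real u * t\<bar> \<le> 2 * pi * (1 / 6)" using ut by (intro mult_left_mono) auto
    then have "cos (pi / 3) \<le> cos (2 * pi * \<bar>real u * t\<bar>)"
      by (intro cos_monotone_0_pi_le) auto
    also have "cos (2 * pi * \<bar>real u * t\<bar>) = cos \<bar>2 * pi * (real u * t)\<bar>"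
      by (simp add: abs_mult)
    also have "\<dots> = cos (real u * (2 * pi * t))"
      unfolding cos_abs_real by (simp add: mult_ac)
    finally show "1 / 2 \<le> Re (cis (2 * pi * t) ^ u)"
      unfolding Complex.DeMoivre by (simp add: cos_60)
  qed
  then have "M / 2 \<le> Re (\<Sum>u<M. cis (2 * pi * t) ^ u)" by simp
  also have "\<dots> \<le> cmod (\<Sum>u<M. cis (2 * pi * t) ^ u)" by (rule complex_Re_le_cmod)
  finally show ?thesis unfolding fejer_power_def by (intro power_mono) auto
qed

text \<open>Convolving the indicator of \<open>\<parallel>\<theta>\<parallel> \<le> \<delta>\<close> with a high power of the Fejer kernel gives a trigonometric
  polynomial whose error away from \<open>\<parallel>\<theta>\<parallel> = \<delta>\<close> is exponentially small in \<open>k\<close>.\<close>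

lemma smoothed_indicator:
  fixes M k :: nat and \<delta> :: real
  assumes M: "M \<ge> 6" and \<delta>: "\<delta> \<ge> 0"
  shows "\<exists>b h :: real \<Rightarrow> real.
    (\<forall>\<theta>. of_real (h \<theta>) = (\<Sum>j\<in>{- (2 * int k * int M)..2 * int k * int M}. b j * cis (2 * pi * of_int j * \<theta>))) \<and>
    b 0 = of_real (2 * \<delta>) \<and> (\<forall>j. j \<noteq> 0 \<longrightarrow> cmod (b j) \<le> 1 / \<bar>of_int j\<bar>) \<and>
    (\<forall>\<theta>. h \<theta> \<ge> 0) \<and> (2 * \<delta> \<le> 1 \<longrightarrow> (\<forall>\<theta>. h \<theta> \<le> 1)) \<and>
    (2 * \<delta> \<le> 1 \<longrightarrow> (\<forall>\<theta>. nearest_int_dist \<theta> \<ge> \<delta> + 3 / M \<longrightarrow> h \<theta> \<le> 3 * real M / 9 ^ k)) \<and>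
    (\<forall>\<theta>. nearest_int_dist \<theta> \<le> \<delta> - 3 / M \<longrightarrow> h \<theta> \<ge> 1 - 3 * real M / 9 ^ k)"
proof -
  define J where "J = 2 * int k * int M"
  define K where "K = fejer_power M k"
  \<comment> \<open>Off this neighbourhood the kernel is at most (M/6)^(2k), against (M/2)^(2k) near
    the peak; the ratio is the decay factor 9^(-k). The condition that \<open>M\<close> be at least
    6 keeps \<open>\<eta>\<close> within half a period.\<close>
  define \<eta> where "\<eta> = 3 / real M"
  have \<eta>: "0 < \<eta>" "\<eta> \<le> 1 / 2" using M by (auto simp: \<eta>_def field_simps)
  define T where "T = (1 / (2 * \<eta>)) ^ (2 * k)"
  obtain c where c: "\<And>t. of_real (K t) = (\<Sum>j\<in>{- J..J}. c j * cis (2 * pi * of_int j * t))"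
    using fejer_power_trig_poly[of k M] unfolding trig_poly_def K_def J_def by blast
  have J0: "0 \<in> {- J..J}" by (simp add: J_def)
  have K0: "K t \<ge> 0" for t by (simp add: K_def fejer_power_nonneg)
  have Kint: "K integrable_on {x..y}" for x y by (simp add: K_def fejer_power_integrable)
  define I where "I j x y = (if j = 0 then of_real (y - x) else
    (cis (2 * pi * of_int j * y) - cis (2 * pi * of_int j * x)) / (\<i> * (2 * pi * of_int j)))" for j :: int and x y :: real
  have I: "((\<lambda>t. cis (2 * pi * of_int j * t)) has_integral I j x y) {x..y}" if "x \<le> y" for j x y
  proof (cases "j = 0")
    case True
    then show ?thesis using has_integral_const_real[of "1 :: complex" x y] that
      by (simp add: I_def scaleR_conv_of_real)
  next
    case False
    then show ?thesis using has_integral_cis[OF False that] by (simp add: I_def)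
  qed
  have period: "I j x (x + 1) = (if j = 0 then 1 else 0)" for j x
  proof -
    have "cis (2 * pi * of_int j * (x + 1)) = cis (2 * pi * of_int j * x) * cis (2 * pi * of_int j)"
      unfolding cis_mult by (simp add: algebra_simps)
    then show ?thesis by (simp add: I_def cis_multiple_2pi)
  qed
  have intK: "((\<lambda>t. complex_of_real (K t)) has_integral (\<Sum>j\<in>{- J..J}. c j * I j x y)) {x..y}" if "x \<le> y" for x y
    unfolding c using I[OF that] by (intro has_integral_sum has_integral_mult_right) auto
  have intK': "complex_of_real (integral {x..y} K) = (\<Sum>j\<in>{- J..J}. c j * I j x y)" if "x \<le> y" for x y
    using has_integral_unique[OF intK[OF that] has_integral_of_real[OF integrable_integral[OF Kint]]] by simp
  define m where "m = integral {-1/2..1/2} K"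
  \<comment> \<open>Nonzero frequencies integrate to 0 over any period, so each period carries the
    same mass, the zeroth coefficient.\<close>
  have unit: "integral {x..x + 1} K = m" for x
  proof -
    have "complex_of_real (integral {x..x + 1} K) = c 0" for x
      unfolding intK'[of x "x + 1", simplified] period using J0 by (simp add: if_distrib sum.delta cong: if_cong)
    from this[of x] this[of "-1/2"] have "complex_of_real (integral {x..x + 1} K) = complex_of_real m"
      unfolding m_def by simp
    then show ?thesis by (simp only: of_real_eq_iff)
  qed
  have half: "I j (-1/2) (1/2) = (if j = 0 then 1 else 0)" for j
    using period[of j "-1/2"] by (simp split del: if_split)
  have c0: "c 0 = of_real m"
    using intK'[of "-1/2" "1/2"] J0 unfolding m_def half
    by (simp add: if_distrib sum.delta cong: if_cong)
  \<comment> \<open>No Fourier coefficient of a nonnegative function exceeds the zeroth one.\<close>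
  have cj: "cmod (c j) \<le> m" if j: "j \<in> {- J..J}" for j
  proof -
    have "((\<lambda>t. complex_of_real (K t) * cis (2 * pi * of_int (- j) * t)) has_integral
        (\<Sum>i\<in>{- J..J}. c i * I (i - j) (-1/2) (1/2))) {-1/2..1/2}"
    proof -
      have eq: "(\<lambda>t. complex_of_real (K t) * cis (2 * pi * of_int (- j) * t)) =
        (\<lambda>t. \<Sum>i\<in>{- J..J}. c i * cis (2 * pi * of_int (i - j) * t))"
        unfolding c sum_distrib_right by (intro ext sum.cong refl) (simp add: cis_mult algebra_simps)
      show ?thesis unfolding eq by (intro has_integral_sum has_integral_mult_right I) auto
    qed
    also have "(\<Sum>i\<in>{- J..J}. c i * I (i - j) (-1/2) (1/2)) = c j"
      unfolding half using j by (simp add: if_distrib sum.delta cong: if_cong)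
    finally have "c j = integral {-1/2..1/2} (\<lambda>t. complex_of_real (K t) * cis (2 * pi * of_int (- j) * t))"
      and "(\<lambda>t. complex_of_real (K t) * cis (2 * pi * of_int (- j) * t)) integrable_on {-1/2..1/2}"
      by (auto simp: has_integral_iff)
    then show ?thesis
      unfolding m_def using K0 by (auto intro!: integral_norm_bound_integral Kint simp: norm_mult)
  qed
  \<comment> \<open>The mass is bounded below by the peak alone, an interval of length 1/(3M) around
    0.\<close>
  have mge: "(1 / (3 * M)) * (M / 2) ^ (2 * k) \<le> m"
  proof -
    let ?a = "1 / (6 * real M)"
    have a: "?a \<le> 1 / 2" "0 < ?a" using M by (auto simp: field_simps)
    have "((\<lambda>t. (M / 2) ^ (2 * k)) has_integral (?a - (- ?a)) *\<^sub>R ((M / 2) ^ (2 * k))) {- ?a..?a}"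
      using has_integral_const_real[of "(M / 2) ^ (2 * k)" "- ?a" ?a] a by simp
    moreover have "(K has_integral integral {- ?a..?a} K) {- ?a..?a}" by (intro integrable_integral Kint)
    ultimately have "(?a - (- ?a)) *\<^sub>R ((M / 2) ^ (2 * k)) \<le> integral {- ?a..?a} K"
      by (rule has_integral_le) (use M fejer_power_ge[of M] in \<open>auto simp: K_def abs_le_iff\<close>)
    also have "\<dots> \<le> m" unfolding m_def using a K0 by (intro integral_subset_le Kint) auto
    finally show ?thesis by (simp add: field_simps)
  qed
  moreover have "(1 / (3 * M)) * (M / 2) ^ (2 * k) > 0" using M by simp
  ultimately have m0: "m > 0" by linarith
  have tail: "T / m \<le> 3 * real M / 9 ^ k"
  proof -
    have "T = ((1 / (3 * M)) * (M / 2) ^ (2 * k)) * (3 * real M / 9 ^ k)"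
    proof -
      have "(1 / (2 * \<eta>)) ^ (2 * k) = (M / 2 / 3) ^ (2 * k)" by (simp add: \<eta>_def)
      also have "\<dots> = (M / 2) ^ (2 * k) / 3 ^ (2 * k)" by (rule power_divide)
      also have "(3::real) ^ (2 * k) = 9 ^ k" by (simp add: power_mult)
      finally show ?thesis using M by (simp add: T_def)
    qed
    also have "\<dots> \<le> m * (3 * real M / 9 ^ k)" by (intro mult_right_mono mge) auto
    finally show ?thesis using m0 by (simp add: field_simps)
  qed
  have KT: "K t \<le> T" if "nearest_int_dist t \<ge> \<eta>" for t
    using fejer_power_le[OF \<eta>(1) that] by (simp add: K_def T_def)
  have T0: "T \<ge> 0" using \<eta> by (simp add: T_def)
  have intT: "integral {x..y} K \<le> (y - x) * T" if "x \<le> y" "\<And>t. t \<in> {x..y} \<Longrightarrow> nearest_int_dist t \<ge> \<eta>" for x y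
  proof -
    have "integral {x..y} K \<le> integral {x..y} (\<lambda>_. T)"
      using that KT by (intro integral_le Kint) auto
    then show ?thesis using that by simp
  qed
  \<comment> \<open>\<open>b\<close> and \<open>h\<close> are the Fourier coefficients and the
    values of the convolution of \<open>K / m\<close> with the indicator of
    [-\<delta>, \<delta>].\<close>
  define b where "b j = c j / m * I j (- \<delta>) \<delta>" for j
  define h where "h \<theta> = integral {\<theta> - \<delta>..\<theta> + \<delta>} K / m" for \<theta>
  show ?thesis
  \<comment> \<open>The coefficients \<open>c\<close> are unspecified outside the range of the sum;
    cutting off there makes the bound valid for every nonzero \<open>j\<close>.\<close>
  proof (rule exI[of _ "\<lambda>j. if j \<in> {- J..J} then b j else 0"], rule exI[of _ h], intro conjI allI impI)
    fix \<theta> :: real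
    have sh: "I j (\<theta> - \<delta>) (\<theta> + \<delta>) = cis (2 * pi * of_int j * \<theta>) * I j (- \<delta>) \<delta>" for j
    proof -
      have "cis (2 * pi * of_int j * (\<theta> + \<delta>)) = cis (2 * pi * of_int j * \<theta>) * cis (2 * pi * of_int j * \<delta>)"
        "cis (2 * pi * of_int j * (\<theta> - \<delta>)) = cis (2 * pi * of_int j * \<theta>) * cis (2 * pi * of_int j * (- \<delta>))"
        unfolding cis_mult by (simp_all add: algebra_simps)
      then show ?thesis by (simp add: I_def right_diff_distrib)
    qed
    have "complex_of_real (h \<theta>) = (\<Sum>j\<in>{- J..J}. c j * I j (\<theta> - \<delta>) (\<theta> + \<delta>)) / m"
      unfolding h_def of_real_divide using intK'[of "\<theta> - \<delta>" "\<theta> + \<delta>"] \<delta> by simp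
    also have "\<dots> = (\<Sum>j\<in>{- J..J}. b j * cis (2 * pi * of_int j * \<theta>))"
      unfolding sh sum_divide_distrib b_def by (intro sum.cong refl) simp
    finally show "complex_of_real (h \<theta>) = (\<Sum>j\<in>{- (2 * int k * int M)..2 * int k * int M}. (if j \<in> {- J..J} then b j else 0) * cis (2 * pi * of_int j * \<theta>))"
      by (simp add: J_def)
    show "h \<theta> \<ge> 0" unfolding h_def using m0 K0 by (intro divide_nonneg_pos integral_nonneg Kint) auto
    show "h \<theta> \<le> 1" if "2 * \<delta> \<le> 1"
    proof -
      have "integral {\<theta> - \<delta>..\<theta> + \<delta>} K \<le> integral {\<theta> - 1/2..(\<theta> - 1/2) + 1} K"
        using that K0 by (intro integral_subset_le Kint) auto
      then show ?thesis unfolding unit h_def using m0 by simp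
    qed
    show "h \<theta> \<le> 3 * real M / 9 ^ k" if d: "2 * \<delta> \<le> 1" "nearest_int_dist \<theta> \<ge> \<delta> + 3 / M"
    proof -
      have "integral {\<theta> - \<delta>..\<theta> + \<delta>} K \<le> (\<theta> + \<delta> - (\<theta> - \<delta>)) * T"
      proof (rule intT)
        fix t assume t: "t \<in> {\<theta> - \<delta>..\<theta> + \<delta>}"
        obtain n where n: "nearest_int_dist t = \<bar>t - of_int n\<bar>" by (rule nearest_int_dist_attained)
        have "\<bar>t - \<theta>\<bar> \<le> \<delta>" using t by auto
        then show "nearest_int_dist t \<ge> \<eta>"
          using d(2) nearest_int_dist_le[of \<theta> n] unfolding n \<eta>_def by linarith
      qed (use \<delta> in simp)
      also have "\<dots> \<le> 1 * T" using d T0 by (intro mult_right_mono) auto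
      finally have "h \<theta> \<le> T / m" unfolding h_def using m0 by (simp add: divide_right_mono)
      then show ?thesis using tail by simp
    qed
    show "h \<theta> \<ge> 1 - 3 * real M / 9 ^ k" if d: "nearest_int_dist \<theta> \<le> \<delta> - 3 / M"
    proof -
      obtain n where n: "nearest_int_dist \<theta> = \<bar>\<theta> - of_int n\<bar>" by (rule nearest_int_dist_attained)
      let ?n = "real_of_int n"
      have nd: "nearest_int_dist t = \<bar>t - ?n\<bar>" if t: "\<bar>t - ?n\<bar> \<le> 1 / 2" for t
      proof -
        obtain l where l: "nearest_int_dist t = \<bar>t - of_int l\<bar>" by (rule nearest_int_dist_attained)
        have "\<bar>t - ?n\<bar> \<le> \<bar>t - of_int l\<bar>"
        proof (cases "l = n")
          case False
          then have "\<bar>real_of_int l - ?n\<bar> \<ge> 1" by linarith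
          with t show ?thesis by linarith
        qed simp
        then show ?thesis using l nearest_int_dist_le[of t n] by linarith
      qed
      have "m = integral {?n - 1/2..(?n - 1/2) + 1} K" unfolding unit ..
      \<comment> \<open>One full period around the nearest integer: the middle piece lies inside the
        window of \<open>h\<close>, and the two outer pieces carry mass at most \<open>T\<close>
        together.\<close>
      also have "\<dots> = integral {?n - 1/2..?n - \<eta>} K + integral {?n - \<eta>..?n + \<eta>} K + integral {?n + \<eta>..?n + 1/2} K"
      proof -
        have "integral {?n - 1/2..?n - \<eta>} K + integral {?n - \<eta>..?n + 1/2} K = integral {?n - 1/2..?n + 1/2} K"
          "integral {?n - \<eta>..?n + \<eta>} K + integral {?n + \<eta>..?n + 1/2} K = integral {?n - \<eta>..?n + 1/2} K"
          using \<eta> by (intro Henstock_Kurzweil_Integration.integral_combine Kint; simp)+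
        moreover have upper: "(?n - 1/2) + 1 = ?n + 1/2" by simp
        ultimately show ?thesis unfolding upper by linarith
      qed
      also have "integral {?n - 1/2..?n - \<eta>} K \<le> (?n - \<eta> - (?n - 1/2)) * T"
      proof (rule intT)
        fix t assume "t \<in> {?n - 1/2..?n - \<eta>}"
        then show "nearest_int_dist t \<ge> \<eta>" using \<eta> by (subst nd) auto
      qed (use \<eta> in simp)
      also have "integral {?n + \<eta>..?n + 1/2} K \<le> (?n + 1/2 - (?n + \<eta>)) * T"
      proof (rule intT)
        fix t assume "t \<in> {?n + \<eta>..?n + 1/2}"
        then show "nearest_int_dist t \<ge> \<eta>" using \<eta> by (subst nd) auto
      qed (use \<eta> in simp)
      also have "integral {?n - \<eta>..?n + \<eta>} K \<le> integral {\<theta> - \<delta>..\<theta> + \<delta>} K"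
        using d n K0 by (intro integral_subset_le Kint) (auto simp: \<eta>_def abs_le_iff)
      also have "(?n - \<eta> - (?n - 1/2)) * T + integral {\<theta> - \<delta>..\<theta> + \<delta>} K + (?n + 1/2 - (?n + \<eta>)) * T
        = integral {\<theta> - \<delta>..\<theta> + \<delta>} K + T - 2 * \<eta> * T" by (simp add: algebra_simps)
      also have "\<dots> \<le> integral {\<theta> - \<delta>..\<theta> + \<delta>} K + T" using \<eta> T0 by simp
      finally have "m / m \<le> (integral {\<theta> - \<delta>..\<theta> + \<delta>} K + T) / m" using m0 by (intro divide_right_mono) auto
      then have "1 \<le> h \<theta> + T / m" unfolding h_def using m0 by (simp add: add_divide_distrib)
      then show ?thesis using tail by simp
    qed
  next
    have "c 0 / m = 1" unfolding c0 using m0 by simp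
    then show "(if 0 \<in> {- J..J} then b 0 else 0) = of_real (2 * \<delta>)" using J0 by (simp add: b_def I_def)
    fix j :: int assume j: "j \<noteq> 0"
    show "cmod (if j \<in> {- J..J} then b j else 0) \<le> 1 / \<bar>of_int j\<bar>"
    proof (cases "j \<in> {- J..J}")
      case True
      have num: "cmod (cis (2 * pi * of_int j * \<delta>) - cis (2 * pi * of_int j * (- \<delta>))) \<le> 2"
        by (rule order_trans[OF norm_triangle_ineq4]) simp
      have "cmod (I j (- \<delta>) \<delta>) = cmod (cis (2 * pi * of_int j * \<delta>) - cis (2 * pi * of_int j * (- \<delta>))) / (2 * pi * \<bar>of_int j\<bar>)"
        using j by (simp add: I_def norm_divide norm_mult)
      also have "\<dots> \<le> 2 / (2 * pi * \<bar>of_int j\<bar>)" by (intro divide_right_mono num) simp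
      also have "\<dots> \<le> 1 / \<bar>of_int j\<bar>"
        using pi_gt3 j by (simp add: field_simps)
      finally have i: "cmod (I j (- \<delta>) \<delta>) \<le> 1 / \<bar>of_int j\<bar>" .
      have "cmod (c j / m) \<le> 1" using cj[OF True] m0 by (simp add: norm_divide)
      then have "cmod (c j / m) * cmod (I j (- \<delta>) \<delta>) \<le> 1 * (1 / \<bar>of_int j\<bar>)"
        using i by (intro mult_mono) auto
      then show ?thesis by (simp only: True if_True b_def norm_mult mult_1_left)
    qed auto
  qed
qed

section \<open>The rank condition\<close>

text \<open>The rows are orthogonal to the kernel, so two independent kernel vectors would raise the
  dimension above \<open>CARD('n)\<close>.\<close>

lemma kernel_dim_le_1:
  fixes A :: "real^'n^'n"
  assumes "rank A \<ge> CARD('n) - 1" "A *v u = 0" "A *v v = 0" "u \<noteq> 0"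
  shows "v \<in> span {u}"
proof (rule ccontr)
  assume v: "v \<notin> span {u}"
  have "dim {u} = 1" using assms(4) dim_insert[of u "{}"] by simp
  then have "dim {v, u} = 2" using v dim_insert[of v "{u}"] by simp
  moreover have "dim (rows A \<union> {v, u}) = dim (rows A) + dim {v, u}"
  proof (rule dim_orthogonal_sum)
    fix x y assume x: "x \<in> rows A" and y: "y \<in> {v, u}"
    obtain i where "x = A $ i" using x by (auto simp: rows_def row_def vec_nth_inverse)
    then show "x \<bullet> y = 0"
      using y assms(2,3) by (metis insertE matrix_vector_mul_component singletonD zero_index)
  qed
  moreover have "dim (rows A \<union> {v, u}) \<le> CARD('n)"
    using dim_subset_UNIV[of "rows A \<union> {v, u}"] by simp
  ultimately show False using assms(1) by (simp add: row_rank_def)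
qed

text \<open>If for every \<open>k\<close> some nonzero kernel vector had vanishing
  \<open>k\<close>-th coordinate, all of them would be proportional, since the kernel is at most a
  line, and their common direction would be zero. Hence some hyperplane \<open>v $ k = 0\<close>
  misses the kernel. Which \<open>k\<close> works varies with \<open>t\<close>; compactness is
  therefore applied to tuples with one candidate vector for each \<open>k\<close>, which yields a
  constant uniform in \<open>t\<close>.\<close>

lemma slice_nondegenerate:
  fixes H :: "'r::finite \<Rightarrow> real^'n^'n"
  assumes "\<And>t::real^'r. t \<noteq> 0 \<Longrightarrow> rank (\<Sum>r\<in>UNIV. t $ r *\<^sub>R H r) \<ge> CARD('n) - 1"
  obtains c where "c > 0" "\<And>t::real^'r. \<exists>k. \<forall>v. v $ k = 0 \<longrightarrow> c * norm t * norm v \<le> norm ((\<Sum>r\<in>UNIV. t $ r *\<^sub>R H r) *v v)"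
proof -
  define A where "A t = (\<Sum>r\<in>UNIV. t $ r *\<^sub>R H r)" for t :: "real^'r"
  \<comment> \<open>Row \<open>k\<close> of the matrix \<open>V\<close> is a unit vector with
    vanishing \<open>k\<close>-th coordinate, the candidate for failure at \<open>k\<close>.
    Positivity of \<open>g\<close> says that not all candidates are annihilated at once.\<close>
  define S where "S = {(t::real^'r, V::real^'n^'n). norm t = 1 \<and> (\<forall>k. norm (V $ k) = 1 \<and> V $ k $ k = 0)}"
  define g where "g p = (\<Sum>k\<in>UNIV. norm (A (fst p) *v (snd p $ k)))" for p :: "(real^'r) \<times> (real^'n^'n)"
  have S: "S = (\<lambda>p. norm (fst p)) -` {1} \<inter> (\<Inter>k. (\<lambda>p. norm (snd p $ k)) -` {1} \<inter> (\<lambda>p. snd p $ k $ k) -` {0})"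
    by (auto simp: S_def)
  have "closed S"
    unfolding S by (intro closed_Int closed_INT ballI closed_vimage closed_singleton continuous_intros)
  moreover have "bounded S"
  proof -
    have "norm p \<le> 1 + real CARD('n)" if "p \<in> S" for p
    proof -
      have "norm (snd p) \<le> (\<Sum>k\<in>UNIV. norm (snd p $ k))"
        unfolding norm_vec_def by (rule L2_set_le_sum) auto
      also have "\<dots> = real CARD('n)" using that by (auto simp: S_def)
      finally have "norm (fst p) + norm (snd p) \<le> 1 + real CARD('n)" using that by (auto simp: S_def)
      then show ?thesis using norm_Pair_le[of "fst p" "snd p"] by simp
    qed
    then show ?thesis by (rule boundedI)
  qed
  ultimately have comp: "compact S" by (simp add: compact_eq_bounded_closed)
  have contg: "continuous_on S g"
    unfolding g_def A_def matrix_vector_mult_def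
    by (intro continuous_intros)
  have pos: "g p > 0" if p: "p \<in> S" for p
  proof (rule ccontr)
    assume "\<not> g p > 0"
    then have "(\<Sum>k\<in>UNIV. norm (A (fst p) *v (snd p $ k))) = 0"
      unfolding g_def using sum_nonneg[of UNIV "\<lambda>k. norm (A (fst p) *v (snd p $ k))"] by simp
    then have ker: "A (fst p) *v (snd p $ k) = 0" for k by (simp add: sum_nonneg_eq_0_iff)
    have p1: "norm (fst p) = 1" "\<And>k. norm (snd p $ k) = 1" "\<And>k. snd p $ k $ k = 0" using p by (auto simp: S_def)
    obtain k0 :: 'n where True by auto
    let ?u = "snd p $ k0"
    have u0: "?u \<noteq> 0" using p1(2)[of k0] by auto
    have "?u $ k = 0" for k
    proof -
      have "fst p \<noteq> 0" using p1(1) by auto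
      then have "snd p $ k \<in> span {?u}"
        using kernel_dim_le_1[OF _ ker[of k0] ker[of k] u0] assms by (simp add: A_def)
      then obtain a where a: "snd p $ k = a *\<^sub>R ?u" by (auto simp: span_singleton)
      then have "a \<noteq> 0" using p1(2)[of k] by auto
      then show ?thesis using a p1(3)[of k] by simp
    qed
    then show False using u0 by (simp add: vec_eq_iff)
  qed
  obtain c where c: "c > 0" "\<And>p. p \<in> S \<Longrightarrow> g p \<ge> c"
  proof (cases "S = {}")
    case False
    then obtain p where "p \<in> S" "\<And>p'. p' \<in> S \<Longrightarrow> g p \<le> g p'"
      using continuous_attains_inf[OF comp _ contg] by blast
    then show ?thesis using pos by (intro that[of "g p"]) auto
  qed (use that[of 1] in auto)
  show ?thesis
  proof (rule that[of "c / CARD('n)"])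
    show "c / CARD('n) > 0" using c by simp
    fix t :: "real^'r"
    show "\<exists>k. \<forall>v. v $ k = 0 \<longrightarrow> c / CARD('n) * norm t * norm v \<le> norm ((\<Sum>r\<in>UNIV. t $ r *\<^sub>R H r) *v v)"
    proof (rule ccontr)
      assume "\<not> ?thesis"
      \<comment> \<open>If every \<open>k\<close> fails for \<open>t\<close>, choosing one violating
        vector per \<open>k\<close> and normalising gives a point of \<open>S\<close> at which
        \<open>g\<close> is below its minimum \<open>c\<close>.\<close>
      then obtain v where v: "\<And>k. v k $ k = 0" "\<And>k. norm (A t *v v k) < c / CARD('n) * norm t * norm (v k)"
        unfolding A_def not_le[symmetric] by metis
      have pos': "0 < norm t * norm (v k)" for k
      proof (rule ccontr)
        assume "\<not> ?thesis"
        then have "norm t * norm (v k) = 0" by (metis norm_ge_zero mult_nonneg_nonneg antisym not_less)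
        then show False using v(2)[of k] by (auto simp: mult.assoc)
      qed
      have t0: "t \<noteq> 0" and v0: "\<And>k. v k \<noteq> 0" using pos' by (metis mult_zero_left norm_zero less_irrefl, metis mult_zero_right norm_zero less_irrefl)
      define p where "p = (t /\<^sub>R norm t, \<chi> k. v k /\<^sub>R norm (v k))"
      have "p \<in> S" using t0 v0 v(1) by (auto simp: S_def p_def)
      then have "c \<le> g p" by (rule c)
      also have "\<dots> < (\<Sum>k\<in>(UNIV::'n set). c / CARD('n))"
        unfolding g_def
      proof (rule sum_strict_mono)
        fix k
        have "A (t /\<^sub>R norm t) = A t /\<^sub>R norm t" by (simp add: A_def scaleR_sum_right mult.commute)
        then have "A (fst p) *v (snd p $ k) = (inverse (norm t) * inverse (norm (v k))) *\<^sub>R (A t *v v k)"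
          by (simp add: p_def scaleR_matrix_vector_assoc[symmetric] matrix_vector_mult_scaleR)
        then have "norm (A (fst p) *v (snd p $ k)) = norm (A t *v v k) / (norm t * norm (v k))"
          using t0 v0 by (simp add: field_simps)
        also have "\<dots> < c / CARD('n)"
          using v(2)[of k] pos'[of k] by (simp add: pos_divide_less_eq mult.assoc)
        finally show "norm (A (fst p) *v (snd p $ k)) < c / CARD('n)" .
      qed auto
      finally show False by simp
    qed
  qed
qed

text \<open>One number \<open>e\<close> serves as radius, as inverse bound for the derivatives and as separation constant. This
  matters because the support of \<open>w\<close> may be larger than the ball over which the manifold determines \<open>f\<close>:
  the constants must be uniform in \<open>f\<close> once the radius is bounded below.\<close>

definition admissible_radius :: "real^'n \<Rightarrow> ('r::finite \<Rightarrow> real^'n \<Rightarrow> real) \<Rightarrow> real \<Rightarrow> bool" where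
  "admissible_radius x0 f e \<longleftrightarrow> 0 < e \<and> e \<le> 1 \<and>
    (\<forall>r js y. length js \<le> CARD('n) \<longrightarrow> (\<forall>m. \<bar>y $ m - x0 $ m\<bar> \<le> 3) \<longrightarrow> \<bar>iterated_partial js (f r) y\<bar> \<le> 1 / e) \<and>
    (\<forall>t::real^'r. \<exists>k. slice_separated (\<lambda>x. \<Sum>r\<in>UNIV. t $ r * f r x) k (e * norm t) x0 (2 * e))"

lemma iterated_partial_combination:
  fixes f :: "'r::finite \<Rightarrow> real^'n \<Rightarrow> real"
  assumes "\<And>r. cont_diff k (f r)" "length js \<le> k"
  shows "iterated_partial js (\<lambda>x. \<Sum>r\<in>UNIV. t r * f r x) = (\<lambda>x. \<Sum>r\<in>UNIV. t r * iterated_partial js (f r) x)"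
proof -
  have cd: "cont_diff (length js) (f r)" for r using assms cont_diff_mono by blast
  have "iterated_partial js (\<lambda>x. \<Sum>r\<in>UNIV. t r * f r x) = (\<lambda>x. \<Sum>r\<in>UNIV. iterated_partial js (\<lambda>x. t r * f r x) x)"
    by (intro iterated_partial_sum cont_diff_cmult cd) auto
  then show ?thesis using iterated_partial_cmult[OF cd] by simp
qed

lemma iterated_partial_bounded:
  fixes f :: "'r::finite \<Rightarrow> real^'n \<Rightarrow> real"
  assumes "\<And>r. cont_diff n (f r)" "compact S"
  shows "\<exists>B. \<forall>r js. \<forall>y\<in>S. length js \<le> n \<longrightarrow> \<bar>iterated_partial js (f r) y\<bar> \<le> B"
proof -
  have fin: "finite ((UNIV::'r set) \<times> {js::'n list. length js \<le> n})"
    using finite_lists_length_le[of "UNIV::'n set" n] by simp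
  have "bounded (\<Union>p\<in>(UNIV::'r set) \<times> {js::'n list. length js \<le> n}. iterated_partial (snd p) (f (fst p)) ` S)"
  proof (rule bounded_UN[OF fin], safe)
    fix r and js :: "'n list" assume "length js \<le> n"
    then have "continuous_on UNIV (iterated_partial js (f r))"
      using cont_diff_continuous cont_diff_iterated_partial[OF assms(1)] by blast
    then have "compact (iterated_partial js (f r) ` S)"
      using assms(2) compact_continuous_image continuous_on_subset by blast
    then show "bounded (iterated_partial (snd (r, js)) (f (fst (r, js))) ` S)" by (simp add: compact_imp_bounded)
  qed
  then obtain B where B: "\<And>x. x \<in> (\<Union>p\<in>(UNIV::'r set) \<times> {js::'n list. length js \<le> n}. iterated_partial (snd p) (f (fst p)) ` S) \<Longrightarrow> norm x \<le> B"
    unfolding bounded_iff by blast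
  show ?thesis
  proof (intro exI allI ballI impI)
    fix r and js :: "'n list" and y assume "length js \<le> n" "y \<in> S"
    then have "norm (iterated_partial js (f r) y) \<le> B" by (intro B UN_I[of "(r, js)"]) auto
    then show "\<bar>iterated_partial js (f r) y\<bar> \<le> B" by simp
  qed
qed

lemma coordinate_box_compact: "compact {y::real^'n. \<forall>m. \<bar>y $ m - c $ m\<bar> \<le> r}"
proof -
  have "{y::real^'n. \<forall>m. \<bar>y $ m - c $ m\<bar> \<le> r} = cbox (\<chi> m. c $ m - r) (\<chi> m. c $ m + r)"
  proof (intro equalityI subsetI)
    fix y assume "y \<in> {y::real^'n. \<forall>m. \<bar>y $ m - c $ m\<bar> \<le> r}"
    then have "\<bar>y $ m - c $ m\<bar> \<le> r" for m by blast
    then show "y \<in> cbox (\<chi> m. c $ m - r) (\<chi> m. c $ m + r)"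
      by (simp add: mem_box_cart abs_le_iff algebra_simps)
  next
    fix y assume "y \<in> cbox (\<chi> m. c $ m - r) (\<chi> m. c $ m + r)"
    then show "y \<in> {y::real^'n. \<forall>m. \<bar>y $ m - c $ m\<bar> \<le> r}"
      by (simp add: mem_box_cart abs_le_iff algebra_simps)
  qed
  then show ?thesis by simp
qed

text \<open>At \<open>x0\<close> the gradient is separated to first order by
  \<open>slice_nondegenerate\<close>. Second derivatives are continuous, so on a small cube
  replacing them by their values at \<open>x0\<close> costs at most half of the separation,
  uniformly in the direction of \<open>t\<close>.\<close>

lemma admissible_radius_exists:
  fixes f :: "'r::finite \<Rightarrow> real^'n \<Rightarrow> real"
  assumes n2: "CARD('n) \<ge> 2" and cd: "\<And>r. cont_diff CARD('n) (f r)"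
    and rank: "\<And>t::real^'r. t \<noteq> 0 \<Longrightarrow> rank (hessian (\<lambda>x. \<Sum>r\<in>UNIV. t $ r * f r x) x0) \<ge> CARD('n) - 1"
  shows "\<exists>e. admissible_radius x0 f e"
proof -
  define n where "n = real CARD('n)"
  define R where "R = real CARD('r)"
  have nR: "n > 0" "R > 0" by (simp_all add: n_def R_def)
  obtain B where B: "\<forall>r js. \<forall>y\<in>{y. \<forall>m. \<bar>y $ m - x0 $ m\<bar> \<le> 3}. length js \<le> CARD('n) \<longrightarrow> \<bar>iterated_partial js (f r) y\<bar> \<le> B"
    using iterated_partial_bounded[where f = f, OF cd coordinate_box_compact[of x0 3]] by (rule exE)
  define H where "H r = (\<chi> i m. iterated_partial [i, m] (f r) x0)" for r
  \<comment> \<open>Lists differentiate the head first, so the pencil is the transposed Hessian;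
    transposition preserves the rank.\<close>
  have "(\<Sum>r\<in>UNIV. t $ r *\<^sub>R H r) = transpose (hessian (\<lambda>x. \<Sum>r\<in>UNIV. t $ r * f r x) x0)" for t :: "real^'r"
  proof -
    have "partial_derivative m (partial_derivative i (\<lambda>x. \<Sum>r\<in>UNIV. t $ r * f r x)) x0
      = (\<Sum>r\<in>UNIV. t $ r * iterated_partial [i, m] (f r) x0)" for i m
      using fun_cong[OF iterated_partial_combination[where f = f, OF cd, of "[i, m]" "($) t"], of x0] n2 by simp
    then show ?thesis by (simp add: vec_eq_iff H_def hessian_def transpose_def)
  qed
  then have "rank (\<Sum>r\<in>UNIV. t $ r *\<^sub>R H r) \<ge> CARD('n) - 1" if "t \<noteq> 0" for t :: "real^'r"
    using rank[OF that] by (simp add: rank_transpose)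
  from slice_nondegenerate[OF this] obtain c where c: "c > 0" "\<And>t::real^'r. \<exists>k. \<forall>v. v $ k = 0 \<longrightarrow> c * norm t * norm v \<le> norm ((\<Sum>r\<in>UNIV. t $ r *\<^sub>R H r) *v v)"
    by blast
  \<comment> \<open>The n R error terms, each at most \<epsilon> times the norms of \<open>t\<close>
    and \<open>v\<close>, then add up to half of the lower bound c/n.\<close>
  define \<epsilon> where "\<epsilon> = c / (2 * n\<^sup>2 * R)"
  have \<epsilon>: "\<epsilon> > 0" using c nR by (simp add: \<epsilon>_def)
  have "\<forall>\<^sub>F y in nhds x0. \<forall>i m r. \<bar>iterated_partial [i, m] (f r) y - iterated_partial [i, m] (f r) x0\<bar> < \<epsilon>"
  proof (intro eventually_all_finite)
    fix i m r
    have "continuous_on UNIV (iterated_partial [i, m] (f r))"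
      by (rule cont_diff_continuous[OF cont_diff_iterated_partial[OF cd]]) (use n2 in simp)
    then have "(iterated_partial [i, m] (f r) \<longlongrightarrow> iterated_partial [i, m] (f r) x0) (nhds x0)"
      by (simp add: continuous_on_eq_continuous_at isCont_def tendsto_at_iff_tendsto_nhds)
    then show "\<forall>\<^sub>F y in nhds x0. \<bar>iterated_partial [i, m] (f r) y - iterated_partial [i, m] (f r) x0\<bar> < \<epsilon>"
      using \<epsilon> by (auto simp: tendsto_iff dist_real_def)
  qed
  then obtain d where d: "d > 0" "\<And>y i m r. dist y x0 < d \<Longrightarrow> \<bar>iterated_partial [i, m] (f r) y - iterated_partial [i, m] (f r) x0\<bar> < \<epsilon>"
    unfolding eventually_nhds_metric by blast
  \<comment> \<open>The entries after 1 ensure, in order, the derivative bound \<open>1 / e\<close>,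
    the separation left after halving, and that the cube of half-side \<open>2 * e\<close> lies in
    the ball of radius \<open>d\<close>.\<close>
  define e where "e = Min {1, 1 / (\<bar>B\<bar> + 1), c / (2 * n), d / (3 * n)}"
  have e: "e > 0" "e \<le> 1" "e \<le> 1 / (\<bar>B\<bar> + 1)" "e \<le> c / (2 * n)" "e \<le> d / (3 * n)"
    using c d nR by (auto simp: e_def add_nonneg_pos)
  have "admissible_radius x0 f e"
    unfolding admissible_radius_def
  proof (intro conjI allI impI)
    fix r and js :: "'n list" and y :: "real^'n" assume "length js \<le> CARD('n)" "\<forall>m. \<bar>y $ m - x0 $ m\<bar> \<le> 3"
    then have "\<bar>iterated_partial js (f r) y\<bar> \<le> B" by (intro B[rule_format]) auto
    also have "B \<le> \<bar>B\<bar> + 1" by simp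
    also have "\<bar>B\<bar> + 1 \<le> 1 / e" using e(1,3) by (simp add: field_simps)
    finally show "\<bar>iterated_partial js (f r) y\<bar> \<le> 1 / e" .
  next
    fix t :: "real^'r"
    define F where "F = (\<lambda>x. \<Sum>r\<in>UNIV. t $ r * f r x)"
    define A where "A = (\<Sum>r\<in>UNIV. t $ r *\<^sub>R H r)"
    obtain k where k: "\<And>v. v $ k = 0 \<Longrightarrow> c * norm t * norm v \<le> norm (A *v v)" using c(2)[of t] by (auto simp: A_def)
    show "\<exists>k. slice_separated (\<lambda>x. \<Sum>r\<in>UNIV. t $ r * f r x) k (e * norm t) x0 (2 * e)"
      unfolding F_def[symmetric] slice_separated_def
    proof (rule exI[of _ k], intro allI impI)
      fix x y assume x: "\<forall>m. \<bar>x $ m - x0 $ m\<bar> \<le> 2 * e" and y: "\<forall>m. \<bar>y $ m - x0 $ m\<bar> \<le> 2 * e" and xy: "x $ k = y $ k"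
      define v where "v = x - y"
      have "norm (A *v v) \<le> (\<Sum>i\<in>UNIV. \<bar>(A *v v) $ i\<bar>)" by (rule norm_le_l1_cart)
      \<comment> \<open>Some coordinate carries at least the average share of the norm; it becomes
        the index required by \<open>slice_separated\<close>.\<close>
      then have "\<exists>i. norm (A *v v) / n \<le> \<bar>(A *v v) $ i\<bar>"
      proof (rule contrapos_pp)
        assume "\<not> ?thesis"
        then have "(\<Sum>i\<in>UNIV. \<bar>(A *v v) $ i\<bar>) < (\<Sum>i\<in>(UNIV::'n set). norm (A *v v) / n)"
          by (intro sum_strict_mono) (auto simp: not_le)
        then show "\<not> norm (A *v v) \<le> (\<Sum>i\<in>UNIV. \<bar>(A *v v) $ i\<bar>)" by (simp add: n_def)
      qed
      then obtain i where "norm (A *v v) / n \<le> \<bar>(A *v v) $ i\<bar>" by blast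
      moreover have "c * norm t * norm v / n \<le> norm (A *v v) / n"
        using k[of v] xy nR by (intro divide_right_mono) (auto simp: v_def)
      ultimately have i: "c * norm t * norm v / n \<le> \<bar>(A *v v) $ i\<bar>" by linarith
      have cF: "cont_diff (Suc 0) (partial_derivative i F)"
      proof -
        have "cont_diff CARD('n) F" unfolding F_def by (intro cont_diff_sum cont_diff_cmult cd) auto
        then have "cont_diff (Suc (Suc 0)) F" by (rule cont_diff_mono) (use n2 in simp)
        then show ?thesis by simp
      qed
      obtain s where s: "0 < s" "s < 1" and eq: "partial_derivative i F x - partial_derivative i F y
         = (\<Sum>m\<in>UNIV. (x $ m - y $ m) * partial_derivative m (partial_derivative i F) (y + s *\<^sub>R (x - y)))"
        using cont_diff_mvt[OF cF, of x y] by blast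
      define z where "z = y + s *\<^sub>R (x - y)"
      have "\<bar>z $ m - x0 $ m\<bar> \<le> 2 * e" for m
        unfolding z_def using s x y by (intro segment_coordinate_bound) auto
      then have "(\<Sum>m\<in>UNIV. \<bar>(z - x0) $ m\<bar>) \<le> (\<Sum>m\<in>(UNIV::'n set). 2 * e)" by (intro sum_mono) auto
      then have "norm (z - x0) \<le> n * (2 * e)" using norm_le_l1_cart[of "z - x0"] by (simp add: n_def)
      also have "\<dots> < n * (3 * e)" using e nR by simp
      also have "\<dots> \<le> d" using e(5) nR by (simp add: field_simps)
      finally have zd: "dist z x0 < d" by (simp add: dist_norm)
      have comb: "partial_derivative m (partial_derivative i F) z = (\<Sum>r\<in>UNIV. t $ r * iterated_partial [i, m] (f r) z)" for m
        using fun_cong[OF iterated_partial_combination[where f = f, OF cd, of "[i, m]" "($) t"], of z] n2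
        by (simp add: F_def)
      have "partial_derivative i F x - partial_derivative i F y
         = (\<Sum>m\<in>UNIV. v $ m * (\<Sum>r\<in>UNIV. t $ r * iterated_partial [i, m] (f r) z))"
        unfolding eq z_def[symmetric] by (simp only: comb v_def vector_minus_component)
      moreover have "(A *v v) $ i = (\<Sum>m\<in>UNIV. v $ m * (\<Sum>r\<in>UNIV. t $ r * iterated_partial [i, m] (f r) x0))"
        by (simp add: matrix_vector_mult_def A_def H_def mult.commute)
      ultimately have "partial_derivative i F x - partial_derivative i F y - (A *v v) $ i =
        (\<Sum>m\<in>UNIV. \<Sum>r\<in>UNIV. v $ m * (t $ r * (iterated_partial [i, m] (f r) z - iterated_partial [i, m] (f r) x0)))"
        by (simp add: sum_subtractf right_diff_distrib sum_distrib_left)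
      also have "\<bar>\<dots>\<bar> \<le> (\<Sum>m\<in>(UNIV::'n set). \<Sum>r\<in>(UNIV::'r set). norm v * (norm t * \<epsilon>))"
      proof (rule order_trans[OF sum_abs], rule sum_mono, rule order_trans[OF sum_abs], rule sum_mono)
        fix m r
        show "\<bar>v $ m * (t $ r * (iterated_partial [i, m] (f r) z - iterated_partial [i, m] (f r) x0))\<bar> \<le> norm v * (norm t * \<epsilon>)"
          unfolding abs_mult using less_imp_le[OF d(2)[OF zd, of i m r]]
          by (intro mult_mono component_le_norm_cart) auto
      qed
      also have "\<dots> = c * norm t * norm v / n / 2"
        using nR by (simp add: \<epsilon>_def n_def[symmetric] R_def[symmetric] field_simps power2_eq_square)
      finally have "\<bar>partial_derivative i F x - partial_derivative i F y - (A *v v) $ i\<bar> \<le> c * norm t * norm v / n / 2" .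
      moreover have "Z / 2 \<le> \<bar>a\<bar>" if "\<bar>a - b\<bar> \<le> Z / 2" "Z \<le> \<bar>b\<bar>" for a b Z :: real
        using that by linarith
      ultimately have low: "c * norm t * norm v / n / 2 \<le> \<bar>partial_derivative i F x - partial_derivative i F y\<bar>"
        using i by blast
      have "e * norm t * \<bar>x $ m - y $ m\<bar> \<le> \<bar>partial_derivative i F x - partial_derivative i F y\<bar>" for m
      proof -
        have "e * norm t * \<bar>x $ m - y $ m\<bar> \<le> (c / (2 * n)) * norm t * norm v"
          using e c nR component_le_norm_cart[of v m] by (intro mult_mono) (auto simp: v_def)
        also have "\<dots> = c * norm t * norm v / n / 2" by simp
        also note low
        finally show ?thesis .
      qed
      then show "\<exists>i. \<forall>m. e * norm t * \<bar>x $ m - y $ m\<bar> \<le> \<bar>partial_derivative i F x - partial_derivative i F y\<bar>" by blast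
    qed
  qed (use e in auto)
  then show ?thesis ..
qed

section \<open>Counting rational points\<close>

lemma iterated_partial_zero_outside:
  fixes g :: "real^'n \<Rightarrow> real"
  assumes "open U" "\<And>x. x \<in> U \<Longrightarrow> g x = 0" "y \<in> U"
  shows "iterated_partial js g y = 0"
  using assms
proof (induction js arbitrary: g y)
  case (Cons i js)
  have "partial_derivative i g x = 0" if "x \<in> U" for x
  proof -
    have "(g has_derivative (\<lambda>v. 0)) (at x)"
      by (rule has_derivative_transform_within_open[OF has_derivative_const[of 0]])
         (use Cons.prems that in auto)
    then show ?thesis by (rule partial_derivative_eq)
  qed
  then show ?case using Cons by simp
qed simp

lemma smooth_compact_support_bounds:
  fixes w :: "real^'n \<Rightarrow> real"
  assumes "smooth_compact_support w"
  shows "\<exists>W X. X \<ge> 0 \<and> (\<forall>js y. length js \<le> n \<longrightarrow> \<bar>iterated_partial js w y\<bar> \<le> W) \<and> (\<forall>y m. w y \<noteq> 0 \<longrightarrow> \<bar>y $ m\<bar> \<le> X)"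
proof -
  let ?S = "function_support w"
  have S: "compact ?S" "\<And>k. cont_diff k w" using assms by (auto simp: smooth_compact_support_def)
  obtain W where W: "\<forall>(r::unit) js. \<forall>y\<in>?S. length js \<le> n \<longrightarrow> \<bar>iterated_partial js w y\<bar> \<le> W"
    using iterated_partial_bounded[where f = "\<lambda>_::unit. w", OF S(2) S(1)] by blast
  obtain X where X: "\<And>y. y \<in> ?S \<Longrightarrow> norm y \<le> X"
    using compact_imp_bounded[OF S(1)] unfolding bounded_iff by blast
  have nz: "y \<in> ?S" if "w y \<noteq> 0" for y
    using that closure_subset[of "{x. w x \<noteq> 0}"] by (auto simp: function_support_def)
  show ?thesis
  proof (intro exI conjI allI impI)
    show "\<bar>X\<bar> \<ge> 0" by simp
    fix js :: "'n list" and y assume js: "length js \<le> n"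
    show "\<bar>iterated_partial js w y\<bar> \<le> \<bar>W\<bar>"
    proof (cases "y \<in> ?S")
      case True
      then have "\<bar>iterated_partial js w y\<bar> \<le> W" using W js by blast
      then show ?thesis by linarith
    next
      case False
      then have "iterated_partial js w y = 0"
        using nz S(1) by (intro iterated_partial_zero_outside[of "- ?S"]) (auto dest: compact_imp_closed)
      then show ?thesis by simp
    qed
  next
    fix y m assume "w y \<noteq> 0"
    then have "norm y \<le> X" using X nz by blast
    then show "\<bar>y $ m\<bar> \<le> \<bar>X\<bar>" using component_le_norm_cart[of y m] by linarith
  qed
qed

lemma infsum_rational_points:
  fixes w :: "real^'n \<Rightarrow> real"
  assumes "\<And>q. q > 0 \<Longrightarrow> finite (weighted_points w q)"
  shows "(\<Sum>\<^sub>\<infinity>(a, q) \<in> {(a, q). 1 \<le> q \<and> q \<le> Q \<and> P a q}. w (rational_point a q))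
    = (\<Sum>q\<in>{1..Q}. \<Sum>a\<in>weighted_points w q. w (rational_point a q) * of_bool (P a q))"
proof -
  define T where "T = (\<lambda>(q, a). (a, q)) ` (SIGMA q:{1..Q}. weighted_points w q)"
  have finT: "finite T" unfolding T_def using assms by (intro finite_imageI finite_SigmaI) auto
  have "(\<Sum>\<^sub>\<infinity>(a, q) \<in> {(a, q). 1 \<le> q \<and> q \<le> Q \<and> P a q}. w (rational_point a q))
      = (\<Sum>\<^sub>\<infinity>(a, q) \<in> T. w (rational_point a q) * of_bool (P a q))"
    by (rule infsum_cong_neutral) (auto simp: T_def image_iff)
  also have "\<dots> = (\<Sum>(a, q) \<in> T. w (rational_point a q) * of_bool (P a q))"
    using finT by (rule infsum_finite)
  also have "\<dots> = (\<Sum>(q, a)\<in>(SIGMA q:{1..Q}. weighted_points w q). w (rational_point a q) * of_bool (P a q))"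
    unfolding T_def by (subst sum.reindex) (auto simp: inj_on_def case_prod_beta)
  also have "\<dots> = (\<Sum>q\<in>{1..Q}. \<Sum>a\<in>weighted_points w q. w (rational_point a q) * of_bool (P a q))"
    using assms by (intro sum.Sigma[symmetric]) auto
  finally show ?thesis .
qed

section \<open>Fourier expansion of the smoothed count\<close>

definition frequency_combination :: "('r::finite \<Rightarrow> real^'n \<Rightarrow> real) \<Rightarrow> ('r \<Rightarrow> int) \<Rightarrow> real^'n \<Rightarrow> real" where
  "frequency_combination f g = (\<lambda>x. \<Sum>r\<in>UNIV. of_int (g r) * f r x)"

text \<open>The scale \<open>lam\<close> is the Euclidean norm of the frequency vector, at least 1
  for a nonzero integer vector and at most \<open>CARD('r) * J\<close>. All data of \<open>f\<close>
  enter through the radius \<open>e\<close>, and passing to the smaller \<open>s\<close> makes the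
  constant independent of \<open>f\<close>.\<close>

lemma frequency_exponential_sum_bound:
  fixes f :: "'r::finite \<Rightarrow> real^'n \<Rightarrow> real" and w :: "real^'n \<Rightarrow> real" and J :: real
  assumes n2: "CARD('n) \<ge> 2"
    and cd: "cont_diff CARD('n) w" "\<And>r. cont_diff CARD('n) (f r)"
    and wb: "\<And>js y. length js \<le> CARD('n) \<Longrightarrow> \<bar>iterated_partial js w y\<bar> \<le> W"
    and q: "q > 0" and s: "0 < s" "s \<le> e" and X: "X \<ge> 0"
    and supp: "\<And>y m. w y \<noteq> 0 \<Longrightarrow> \<bar>y $ m - x0 $ m\<bar> \<le> e" "\<And>y m. w y \<noteq> 0 \<Longrightarrow> \<bar>y $ m\<bar> \<le> X"
    and adm: "admissible_radius x0 f e"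
    and g: "g \<noteq> (\<lambda>_. 0)" "\<And>r. \<bar>real_of_int (g r)\<bar> \<le> J"
  shows "cmod (exponential_sum w (frequency_combination f g) q) \<le>
    exponential_sum_const CARD('n) W (CARD('r) / s) s X * q * sqrt (q * (CARD('r) * J)) ^ (CARD('n) - 1) * (2 + ln q) ^ CARD('n)"
proof -
  define t where "t = (\<chi> r. real_of_int (g r))"
  define lam where "lam = norm t"
  have F: "frequency_combination f g = (\<lambda>x. \<Sum>r\<in>UNIV. t $ r * f r x)"
    by (simp add: frequency_combination_def t_def)
  have e: "0 < e" "e \<le> 1" using adm by (auto simp: admissible_radius_def)
  obtain r0 where "g r0 \<noteq> 0" using g(1) by auto
  then have "1 \<le> \<bar>t $ r0\<bar>" by (simp add: t_def)
  also have "\<dots> \<le> lam" unfolding lam_def by (rule component_le_norm_cart)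
  finally have lam: "lam \<ge> 1" .
  have "lam \<le> (\<Sum>r\<in>UNIV. \<bar>t $ r\<bar>)" unfolding lam_def by (rule norm_le_l1_cart)
  also have "\<dots> \<le> (\<Sum>r\<in>(UNIV::'r set). J)" using g(2) by (intro sum_mono) (simp add: t_def)
  finally have lamJ: "lam \<le> CARD('r) * J" by simp
  have W: "W \<ge> 0" using wb[of "[]" 0] by simp
  define K where "K = CARD('r) / s"
  have K1: "K \<ge> 1"
  proof -
    have "s \<le> CARD('r)" using s e by (simp add: Suc_leI order_trans[of s 1])
    then show ?thesis using s by (simp add: K_def)
  qed
  have "cmod (exponential_sum w (frequency_combination f g) q) \<le>
    exponential_sum_const CARD('n) W K s X * q * sqrt (q * lam) ^ (CARD('n) - 1) * (2 + ln q) ^ CARD('n)"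
  proof -
    obtain k where k: "slice_separated (\<lambda>x. \<Sum>r\<in>UNIV. t $ r * f r x) k (e * norm t) x0 (2 * e)"
      using adm unfolding admissible_radius_def by blast
    show ?thesis
      unfolding F
    proof (rule exponential_sum_bound[OF n2 cd(1) _ wb _ K1 lam q s e(2) X supp, where k = k])
      show "cont_diff CARD('n) (\<lambda>x. \<Sum>r\<in>UNIV. t $ r * f r x)"
        by (intro cont_diff_sum cont_diff_cmult cd) auto
    next
      fix js :: "'n list" and y assume js: "length js \<le> CARD('n)" and y: "\<And>i. \<bar>y $ i - x0 $ i\<bar> \<le> 3"
      have "\<bar>\<Sum>r\<in>UNIV. t $ r * iterated_partial js (f r) y\<bar> \<le> (\<Sum>r\<in>(UNIV::'r set). lam * (1 / s))"
      proof (intro order_trans[OF sum_abs] sum_mono)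
        fix r
        have "\<bar>iterated_partial js (f r) y\<bar> \<le> 1 / e" using adm js y unfolding admissible_radius_def by blast
        also have "1 / e \<le> 1 / s" using s by (simp add: frac_le)
        finally show "\<bar>t $ r * iterated_partial js (f r) y\<bar> \<le> lam * (1 / s)"
          unfolding abs_mult lam_def by (intro mult_mono component_le_norm_cart) auto
      qed
      then show "\<bar>iterated_partial js (\<lambda>x. \<Sum>r\<in>UNIV. t $ r * f r x) y\<bar> \<le> K * lam"
        using iterated_partial_combination[where f = f, OF cd(2) js, of "($) t"] by (simp add: K_def mult.commute)
    next
      have "s * lam * \<bar>x $ m - y $ m\<bar> \<le> e * norm t * \<bar>x $ m - y $ m\<bar>" for x y :: "real^'n" and m
        unfolding lam_def using s by (intro mult_right_mono) auto
      then show "slice_separated (\<lambda>x. \<Sum>r\<in>UNIV. t $ r * f r x) k (s * lam) x0 (2 * e)"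
        using k unfolding slice_separated_def by (meson order_trans)
    qed
  qed
  also have "\<dots> \<le> exponential_sum_const CARD('n) W K s X * q * sqrt (q * (CARD('r) * J)) ^ (CARD('n) - 1) * (2 + ln q) ^ CARD('n)"
  proof (intro mult_right_mono mult_left_mono power_mono)
    show "sqrt (q * lam) \<le> sqrt (q * (CARD('r) * J))" using lamJ by (simp add: mult_left_mono)
    show "0 \<le> exponential_sum_const CARD('n) W K s X * q"
      using W K1 s X by (simp add: exponential_sum_const_def amplitude_const_def count_const_def)
    show "0 \<le> (2 + ln (real q)) ^ CARD('n)" using q by simp
  qed (use lam in auto)
  finally show ?thesis by (simp add: K_def)
qed

lemma smoothed_count_expansion:
  fixes f :: "'r::finite \<Rightarrow> real^'n \<Rightarrow> real" and w :: "real^'n \<Rightarrow> real" and J :: int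
  assumes h: "\<And>\<theta>. of_real (h \<theta>) = (\<Sum>j\<in>{- J..J}. b j * cis (2 * pi * of_int j * \<theta>))"
  shows "complex_of_real (\<Sum>q\<in>{1..Q}. \<Sum>a\<in>weighted_points w q. w (rational_point a q) * (\<Prod>r\<in>UNIV. h (q * f r (rational_point a q))))
    = (\<Sum>g\<in>PiE UNIV (\<lambda>_::'r. {- J..J}). (\<Prod>r\<in>UNIV. b (g r)) * (\<Sum>q\<in>{1..Q}. exponential_sum w (frequency_combination f g) q))"
proof -
  have prod: "complex_of_real (\<Prod>r\<in>UNIV. h (q * f r x)) =
    (\<Sum>g\<in>PiE UNIV (\<lambda>_::'r. {- J..J}). (\<Prod>r\<in>UNIV. b (g r)) * cis (2 * pi * (q * frequency_combination f g x)))" for q :: nat and x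
  proof -
    have c: "(\<Prod>r\<in>I. cis (u r)) = cis (\<Sum>r\<in>I. u r)" if "finite I" for I :: "'r set" and u
      using that by (induction I rule: finite_induct) (auto simp: cis_mult)
    have "complex_of_real (\<Prod>r\<in>UNIV. h (q * f r x)) = (\<Prod>r\<in>(UNIV::'r set). \<Sum>j\<in>{- J..J}. b j * cis (2 * pi * of_int j * (q * f r x)))"
      by (simp only: of_real_prod h)
    also have "\<dots> = (\<Sum>g\<in>PiE UNIV (\<lambda>_::'r. {- J..J}). \<Prod>r\<in>UNIV. b (g r) * cis (2 * pi * of_int (g r) * (q * f r x)))"
      by (rule prod_sum_PiE) auto
    also have "\<dots> = (\<Sum>g\<in>PiE UNIV (\<lambda>_::'r. {- J..J}). (\<Prod>r\<in>UNIV. b (g r)) * cis (2 * pi * (q * frequency_combination f g x)))"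
      by (intro sum.cong refl) (simp add: prod.distrib c frequency_combination_def sum_distrib_left mult_ac)
    finally show ?thesis .
  qed
  have "complex_of_real (\<Sum>q\<in>{1..Q}. \<Sum>a\<in>weighted_points w q. w (rational_point a q) * (\<Prod>r\<in>UNIV. h (q * f r (rational_point a q))))
    = (\<Sum>q\<in>{1..Q}. \<Sum>a\<in>weighted_points w q. \<Sum>g\<in>PiE UNIV (\<lambda>_::'r. {- J..J}).
        (\<Prod>r\<in>UNIV. b (g r)) * (of_real (w (rational_point a q)) * cis (2 * pi * (q * frequency_combination f g (rational_point a q)))))"
    unfolding of_real_sum of_real_mult prod sum_distrib_left by (intro sum.cong refl) (simp add: mult_ac)
  also have "\<dots> = (\<Sum>q\<in>{1..Q}. \<Sum>g\<in>PiE UNIV (\<lambda>_::'r. {- J..J}). \<Sum>a\<in>weighted_points w q.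
        (\<Prod>r\<in>UNIV. b (g r)) * (of_real (w (rational_point a q)) * cis (2 * pi * (q * frequency_combination f g (rational_point a q)))))"
    by (intro sum.cong refl sum.swap)
  also have "\<dots> = (\<Sum>g\<in>PiE UNIV (\<lambda>_::'r. {- J..J}). \<Sum>q\<in>{1..Q}. \<Sum>a\<in>weighted_points w q.
        (\<Prod>r\<in>UNIV. b (g r)) * (of_real (w (rational_point a q)) * cis (2 * pi * (q * frequency_combination f g (rational_point a q)))))"
    by (rule sum.swap)
  finally show ?thesis by (simp add: sum_distrib_left exponential_sum_def)
qed

text \<open>The zero frequency reproduces the main term. For the rest, the sum of the absolute
  values of the product coefficients factorises into an R-th power of a one-dimensional sum, which
  the decay 1/|j| makes logarithmic in \<open>J\<close>.\<close>

lemma smoothed_count_estimate: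
  fixes f :: "'r::finite \<Rightarrow> real^'n \<Rightarrow> real" and w :: "real^'n \<Rightarrow> real" and J :: nat
  assumes h: "\<And>\<theta>. of_real (h \<theta>) = (\<Sum>j\<in>{- int J..int J}. b j * cis (2 * pi * of_int j * \<theta>))"
    and b: "b 0 = of_real \<beta>" "\<beta> \<ge> 0" "\<And>j. j \<noteq> 0 \<Longrightarrow> cmod (b j) \<le> 1 / \<bar>of_int j\<bar>"
    and E: "\<And>g q. g \<noteq> (\<lambda>_. 0) \<Longrightarrow> (\<And>r. \<bar>real_of_int (g r)\<bar> \<le> J) \<Longrightarrow> 1 \<le> q \<Longrightarrow> q \<le> Q \<Longrightarrow>
      cmod (exponential_sum w (frequency_combination f g) q) \<le> E"
    and E0: "E \<ge> 0"
  shows "\<bar>(\<Sum>q\<in>{1..Q}. \<Sum>a\<in>weighted_points w q. w (rational_point a q) * (\<Prod>r\<in>UNIV. h (q * f r (rational_point a q))))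
      - \<beta> ^ CARD('r) * (\<Sum>q\<in>{1..Q}. \<Sum>a\<in>weighted_points w q. w (rational_point a q))\<bar>
    \<le> (\<beta> + 2 * (2 + ln (J + 1))) ^ CARD('r) * (Q * E)"
proof -
  let ?G = "PiE UNIV (\<lambda>_::'r. {- int J..int J})"
  let ?z = "\<lambda>_::'r. 0::int"
  define Z where "Z = (\<Sum>q\<in>{1..Q}. \<Sum>a\<in>weighted_points w q. w (rational_point a q) * (\<Prod>r\<in>UNIV. h (q * f r (rational_point a q))))"
  define N where "N = (\<Sum>q\<in>{1..Q}. \<Sum>a\<in>weighted_points w q. w (rational_point a q))"
  define T where "T g = (\<Prod>r\<in>UNIV. b (g r)) * (\<Sum>q\<in>{1..Q}. exponential_sum w (frequency_combination f g) q)" for g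
  have finG: "finite ?G" by (intro finite_PiE) auto
  have zG: "?z \<in> ?G" by auto
  have "T ?z = of_real (\<beta> ^ CARD('r) * N)"
    by (simp add: T_def b(1) N_def exponential_sum_def frequency_combination_def)
  moreover have "complex_of_real Z = T ?z + (\<Sum>g\<in>?G - {?z}. T g)"
    unfolding Z_def smoothed_count_expansion[OF h] T_def[symmetric] using finG zG by (rule sum.remove)
  ultimately have "complex_of_real (Z - \<beta> ^ CARD('r) * N) = (\<Sum>g\<in>?G - {?z}. T g)" by simp
  then have "\<bar>Z - \<beta> ^ CARD('r) * N\<bar> = cmod (\<Sum>g\<in>?G - {?z}. T g)"
    by (metis norm_of_real real_norm_def)
  also have "\<dots> \<le> (\<Sum>g\<in>?G - {?z}. (\<Prod>r\<in>UNIV. cmod (b (g r))) * (Q * E))"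
  proof (rule sum_norm_le)
    fix g assume g: "g \<in> ?G - {?z}"
    have "cmod (\<Sum>q\<in>{1..Q}. exponential_sum w (frequency_combination f g) q) \<le> (\<Sum>q\<in>{1..Q}. E)"
    proof (rule sum_norm_le)
      fix q assume "q \<in> {1..Q}"
      moreover have "\<bar>real_of_int (g r)\<bar> \<le> J" for r
      proof -
        have "g r \<in> {- int J..int J}" using g by (auto simp: PiE_iff)
        then show ?thesis by auto
      qed
      ultimately show "cmod (exponential_sum w (frequency_combination f g) q) \<le> E" using g by (intro E) auto
    qed
    then show "cmod (T g) \<le> (\<Prod>r\<in>UNIV. cmod (b (g r))) * (Q * E)"
      unfolding T_def norm_mult prod_norm[symmetric] by (intro mult_left_mono prod_nonneg) auto
  qed
  also have "\<dots> \<le> (\<Sum>g\<in>?G. (\<Prod>r\<in>UNIV. cmod (b (g r))) * (Q * E))"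
    using finG E0 by (intro sum_mono2) (auto intro!: mult_nonneg_nonneg prod_nonneg)
  also have "\<dots> = (\<Sum>j\<in>{- int J..int J}. cmod (b j)) ^ CARD('r) * (Q * E)"
  proof -
    have "(\<Prod>r\<in>(UNIV::'r set). \<Sum>j\<in>{- int J..int J}. cmod (b j)) = (\<Sum>g\<in>?G. \<Prod>r\<in>UNIV. cmod (b (g r)))"
      by (rule prod_sum_PiE) auto
    then show ?thesis by (simp add: sum_distrib_right)
  qed
  also have "\<dots> \<le> (\<beta> + 2 * (2 + ln (J + 1))) ^ CARD('r) * (Q * E)"
  proof (intro mult_right_mono power_mono)
    have half: "(\<Sum>j\<in>(\<lambda>v. c * int v) ` {1..J}. cmod (b j)) \<le> 2 + ln (J + 1)" if "\<bar>c\<bar> = 1" for c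
    proof -
      have c0: "c \<noteq> 0" using that by auto
      have "(\<Sum>j\<in>(\<lambda>v. c * int v) ` {1..J}. cmod (b j)) = (\<Sum>v\<in>{1..J}. cmod (b (c * int v)))"
        using c0 by (subst sum.reindex) (auto simp: inj_on_def)
      also have "\<dots> \<le> (\<Sum>v\<in>{1..J}. 1 / real (max 1 v))"
      proof (rule sum_mono)
        fix v assume v: "v \<in> {1..J}"
        then have "cmod (b (c * int v)) \<le> 1 / \<bar>of_int (c * int v)\<bar>" using c0 by (intro b(3)) auto
        also have "\<bar>real_of_int (c * int v)\<bar> = real v"
          using that by (metis abs_mult abs_of_nat mult_1 of_int_abs of_int_of_nat_eq)
        finally show "cmod (b (c * int v)) \<le> 1 / real (max 1 v)" using v by (simp add: max_def)
      qed
      also have "\<dots> \<le> (\<Sum>v<J + 1. 1 / real (max 1 v))" by (intro sum_mono2) auto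
      also have "\<dots> \<le> 2 + ln (real (J + 1))" by (rule sum_inverse_bound) simp
      finally show ?thesis by (simp add: add.commute)
    qed
    have "{- int J..int J} = {0} \<union> ((\<lambda>v. 1 * int v) ` {1..J} \<union> (\<lambda>v. - 1 * int v) ` {1..J})"
    proof (intro equalityI subsetI)
      fix j assume j: "j \<in> {- int J..int J}"
      consider "j = 0" | "j > 0" | "j < 0" by linarith
      then show "j \<in> {0} \<union> ((\<lambda>v. 1 * int v) ` {1..J} \<union> (\<lambda>v. - 1 * int v) ` {1..J})"
      proof cases
        case 2
        then have "j = 1 * int (nat j)" "nat j \<in> {1..J}" using j by auto
        then show ?thesis by blast
      next
        case 3
        then have "j = - 1 * int (nat (- j))" "nat (- j) \<in> {1..J}" using j by auto
        then show ?thesis by blast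
      qed simp
    qed auto
    moreover have un: "(\<Sum>j\<in>A \<union> B. cmod (b j)) \<le> (\<Sum>j\<in>A. cmod (b j)) + (\<Sum>j\<in>B. cmod (b j))"
      if "finite A" "finite B" for A B
      using sum.union_inter[OF that, of "\<lambda>j. cmod (b j)"] sum_nonneg[of "A \<inter> B" "\<lambda>j. cmod (b j)"] by simp
    ultimately have "(\<Sum>j\<in>{- int J..int J}. cmod (b j)) \<le> (\<Sum>j\<in>{0}. cmod (b j)) +
        (\<Sum>j\<in>(\<lambda>v. 1 * int v) ` {1..J} \<union> (\<lambda>v. - 1 * int v) ` {1..J}. cmod (b j))"
      by (simp only:) (intro un; simp)
    also have "\<dots> \<le> (\<Sum>j\<in>{0}. cmod (b j)) + ((\<Sum>j\<in>(\<lambda>v. 1 * int v) ` {1..J}. cmod (b j)) + (\<Sum>j\<in>(\<lambda>v. - 1 * int v) ` {1..J}. cmod (b j)))"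
      by (intro add_left_mono un) auto
    also have "\<dots> \<le> \<beta> + ((2 + ln (J + 1)) + (2 + ln (J + 1)))"
    proof (intro add_mono half)
      show "(\<Sum>j\<in>{0}. cmod (b j)) \<le> \<beta>" using b(1,2) by simp
    qed auto
    finally show "(\<Sum>j\<in>{- int J..int J}. cmod (b j)) \<le> \<beta> + 2 * (2 + ln (J + 1))" by simp
  qed (use E0 in \<open>auto intro: sum_nonneg\<close>)
  finally show ?thesis by (simp add: Z_def N_def)
qed

lemma power_diff_le:
  fixes a b :: real
  assumes "0 \<le> a" "a \<le> b"
  shows "b ^ R - a ^ R \<le> R * (b - a) * b ^ (R - 1)"
proof (induction R)
  case (Suc R)
  have "b ^ Suc R - a ^ Suc R = b * (b ^ R - a ^ R) + a ^ R * (b - a)" by (simp add: algebra_simps)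
  also have "\<dots> \<le> b * (R * (b - a) * b ^ (R - 1)) + b ^ R * (b - a)"
    using assms Suc by (intro add_mono mult_left_mono mult_right_mono power_mono) auto
  also have "\<dots> = Suc R * (b - a) * b ^ (Suc R - 1)"
    by (cases R) (simp_all add: algebra_simps)
  finally show ?case .
qed simp

text \<open>Only an upper and a lower trigonometric approximation are compared with the count; their
  difference costs \<open>\<delta> ^ (R - 1) / M\<close> relative to the total weight.\<close>

lemma count_discrepancy:
  fixes f :: "'r::finite \<Rightarrow> real^'n \<Rightarrow> real" and w :: "real^'n \<Rightarrow> real" and M k Q :: nat and \<delta> E :: real
  defines "N \<equiv> (\<Sum>q\<in>{1..Q}. \<Sum>a\<in>weighted_points w q. w (rational_point a q) *
      of_bool (\<forall>r. nearest_int_dist (q * f r (rational_point a q)) \<le> \<delta>))"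
    and "N0 \<equiv> (\<Sum>q\<in>{1..Q}. \<Sum>a\<in>weighted_points w q. w (rational_point a q))"
  assumes w0: "\<And>y. w y \<ge> 0" and M: "M \<ge> 6" "3 / M \<le> \<delta>" and \<delta>: "\<delta> \<le> 1 / 2"
    and \<tau>1: "3 * real M / 9 ^ k \<le> 1"
    and E: "\<And>g q. g \<noteq> (\<lambda>_. 0) \<Longrightarrow> (\<And>r. \<bar>real_of_int (g r)\<bar> \<le> real (2 * k * M)) \<Longrightarrow> 1 \<le> q \<Longrightarrow> q \<le> Q \<Longrightarrow>
      cmod (exponential_sum w (frequency_combination f g) q) \<le> E"
    and E0: "E \<ge> 0"
  shows "\<bar>N - (2 * \<delta>) ^ CARD('r) * N0\<bar> \<le> (6 + 2 * ln (real (2 * k * M) + 1)) ^ CARD('r) * (Q * E)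
    + (CARD('r) * (3 * real M / 9 ^ k) + CARD('r) * (6 / M) * (4 * \<delta>) ^ (CARD('r) - 1)) * N0"
proof -
  define R where "R = CARD('r)"
  define J where "J = 2 * k * M"
  define \<tau> where "\<tau> = 3 * real M / 9 ^ k"
  define \<eta> where "\<eta> = 3 / real M"
  define S where "S \<phi> = (\<Sum>q\<in>{1..Q}. \<Sum>a\<in>weighted_points w q. w (rational_point a q) * \<phi> a q)" for \<phi> :: "int^'n \<Rightarrow> nat \<Rightarrow> real"
  define good where "good a q \<longleftrightarrow> (\<forall>r. nearest_int_dist (q * f r (rational_point a q)) \<le> \<delta>)" for a q
  define P where "P = (6 + 2 * ln (real J + 1)) ^ R * (Q * E)"
  have \<tau>0: "\<tau> \<ge> 0" "\<tau> \<le> 1" using \<tau>1 by (simp_all add: \<tau>_def)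
  have \<eta>0: "\<eta> > 0" "\<eta> \<le> \<delta>" using M by (simp_all add: \<eta>_def)
  have S_mono: "S \<phi> \<le> S \<psi>" if "\<And>a q. \<phi> a q \<le> \<psi> a q" for \<phi> \<psi>
    unfolding S_def using w0 that by (intro sum_mono mult_left_mono) auto
  have S_add: "S (\<lambda>a q. x * \<phi> a q + y) = x * S \<phi> + y * N0" for x y \<phi>
    by (simp add: S_def N0_def sum.distrib sum_distrib_left distrib_left mult_ac)
  have N: "N = S (\<lambda>a q. of_bool (good a q))" by (simp add: N_def S_def good_def)
  have N00: "N0 \<ge> 0" unfolding N0_def using w0 by (intro sum_nonneg) auto
  have N_le: "N \<le> N0"
    unfolding N_def N0_def using w0 by (intro sum_mono) (auto simp: mult_left_le)
  have J: "2 * int k * int M = int J" by (simp add: J_def)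
  have est: "\<bar>S (\<lambda>a q. \<Prod>r\<in>UNIV. h (q * f r (rational_point a q))) - (2 * d) ^ R * N0\<bar> \<le> P"
    if h: "\<And>\<theta>. of_real (h \<theta>) = (\<Sum>j\<in>{- int J..int J}. b j * cis (2 * pi * of_int j * \<theta>))"
      and b: "b 0 = of_real (2 * d)" "\<And>j. j \<noteq> 0 \<Longrightarrow> cmod (b j) \<le> 1 / \<bar>of_int j\<bar>" and d: "0 \<le> d" "d \<le> 1"
    for h b and d :: real
  proof -
    have "\<bar>S (\<lambda>a q. \<Prod>r\<in>UNIV. h (q * f r (rational_point a q))) - (2 * d) ^ R * N0\<bar> \<le> (2 * d + 2 * (2 + ln (J + 1))) ^ R * (Q * E)"
      unfolding S_def N0_def R_def
    proof (rule smoothed_count_estimate[OF h b(1) _ b(2) _ E0])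
      fix g :: "'r \<Rightarrow> int" and q :: nat
      assume "g \<noteq> (\<lambda>_. 0)" "\<And>r. \<bar>real_of_int (g r)\<bar> \<le> real J" "1 \<le> q" "q \<le> Q"
      then show "cmod (exponential_sum w (frequency_combination f g) q) \<le> E"
        unfolding J_def by (rule E)
    qed (use d in auto)
    \<comment> \<open>Since \<open>d\<close> is at most 1, \<open>2 * d + 4\<close> is at most the
      constant 6 in \<open>P\<close>.\<close>
    also have "\<dots> \<le> P"
      unfolding P_def using d E0 by (intro mult_right_mono power_mono) (auto simp: add_ac)
    finally show ?thesis .
  qed
  \<comment> \<open>Widening the window by \<open>\<eta>\<close> puts every counted point where
    \<open>h\<close> is at least \<open>1 - \<tau>\<close>; Bernoulli's inequality handles the
    product over \<open>r\<close>, and \<open>N \<le> N0\<close> turns the resulting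
    \<open>R * \<tau> * N\<close> into an error term. As \<open>\<eta>\<close> is at most
    \<open>\<delta>\<close>, the widened window has length at most
    \<open>4 * \<delta>\<close>.\<close>
  have upper: "N \<le> (2 * \<delta>) ^ R * N0 + P + (R * \<tau> + R * (2 * \<eta>) * (4 * \<delta>) ^ (R - 1)) * N0"
  proof -
    have "\<delta> + \<eta> \<ge> 0" using \<eta>0 by simp
    from smoothed_indicator[OF M(1) this, of k] obtain b h where
      h: "\<forall>\<theta>. of_real (h \<theta>) = (\<Sum>j\<in>{- int J..int J}. b j * cis (2 * pi * of_int j * \<theta>))"
      and b: "b 0 = of_real (2 * (\<delta> + \<eta>))" "\<forall>j. j \<noteq> 0 \<longrightarrow> cmod (b j) \<le> 1 / \<bar>of_int j\<bar>"
      and h0: "\<forall>\<theta>. h \<theta> \<ge> 0" and h1: "\<forall>\<theta>. nearest_int_dist \<theta> \<le> \<delta> + \<eta> - \<eta> \<longrightarrow> h \<theta> \<ge> 1 - \<tau>"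
      unfolding J \<eta>_def[symmetric] \<tau>_def[symmetric] by (elim exE conjE)
    have "S (\<lambda>a q. (1 - R * \<tau>) * of_bool (good a q) + 0) \<le> S (\<lambda>a q. \<Prod>r\<in>UNIV. h (q * f r (rational_point a q)))"
    proof (rule S_mono)
      fix a q
      show "(1 - R * \<tau>) * of_bool (good a q) + 0 \<le> (\<Prod>r\<in>UNIV. h (q * f r (rational_point a q)))"
      proof (cases "good a q")
        case True
        have "1 - R * \<tau> \<le> (1 - \<tau>) ^ R"
          using Bernoulli_inequality[of "- \<tau>" R] \<tau>0 by simp
        also have "\<dots> = (\<Prod>r\<in>(UNIV::'r set). 1 - \<tau>)" by (simp add: R_def)
        also have "\<dots> \<le> (\<Prod>r\<in>UNIV. h (q * f r (rational_point a q)))"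
          using True \<tau>0 by (intro prod_mono conjI h1[rule_format]) (auto simp: good_def)
        finally show ?thesis using True by simp
      qed (use h0 in \<open>simp add: prod_nonneg\<close>)
    qed
    then have "(1 - R * \<tau>) * N \<le> S (\<lambda>a q. \<Prod>r\<in>UNIV. h (q * f r (rational_point a q)))"
      unfolding S_add N by simp
    also have "\<dots> \<le> (2 * (\<delta> + \<eta>)) ^ R * N0 + P"
    proof -
      have "0 \<le> \<delta> + \<eta>" "\<delta> + \<eta> \<le> 1" using \<eta>0 \<delta> by auto
      from est[OF h[rule_format] b(1) b(2)[rule_format] this] show ?thesis by linarith
    qed
    finally have 1: "N \<le> (2 * (\<delta> + \<eta>)) ^ R * N0 + P + R * \<tau> * N" by (simp add: algebra_simps)
    have "R * \<tau> * N \<le> R * \<tau> * N0" using N_le \<tau>0 by (intro mult_left_mono) auto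
    moreover have "(2 * (\<delta> + \<eta>)) ^ R * N0 \<le> ((2 * \<delta>) ^ R + R * (2 * \<eta>) * (4 * \<delta>) ^ (R - 1)) * N0"
    proof (rule mult_right_mono[OF _ N00])
      have "(2 * (\<delta> + \<eta>)) ^ R - (2 * \<delta>) ^ R \<le> R * (2 * (\<delta> + \<eta>) - 2 * \<delta>) * (2 * (\<delta> + \<eta>)) ^ (R - 1)"
        using \<eta>0 by (intro power_diff_le) auto
      also have "\<dots> \<le> R * (2 * \<eta>) * (4 * \<delta>) ^ (R - 1)"
        using \<eta>0 by (intro mult_mono[OF _ power_mono]) (auto simp: algebra_simps)
      finally show "(2 * (\<delta> + \<eta>)) ^ R \<le> (2 * \<delta>) ^ R + R * (2 * \<eta>) * (4 * \<delta>) ^ (R - 1)" by linarith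
    qed
    ultimately have "N \<le> ((2 * \<delta>) ^ R + R * (2 * \<eta>) * (4 * \<delta>) ^ (R - 1)) * N0 + P + R * \<tau> * N0"
      using 1 by linarith
    then show ?thesis by (simp add: algebra_simps)
  qed
  \<comment> \<open>Narrowing the window by \<open>\<eta>\<close> makes one violated condition
    enough: its factor is at most \<open>\<tau>\<close> and the others are at most 1.\<close>
  have lower: "(2 * \<delta>) ^ R * N0 \<le> N + P + (R * \<tau> + R * (2 * \<eta>) * (4 * \<delta>) ^ (R - 1)) * N0"
  proof -
    have "\<delta> - \<eta> \<ge> 0" using \<eta>0 by simp
    from smoothed_indicator[OF M(1) this, of k] obtain b h where
      h: "\<forall>\<theta>. of_real (h \<theta>) = (\<Sum>j\<in>{- int J..int J}. b j * cis (2 * pi * of_int j * \<theta>))"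
      and b: "b 0 = of_real (2 * (\<delta> - \<eta>))" "\<forall>j. j \<noteq> 0 \<longrightarrow> cmod (b j) \<le> 1 / \<bar>of_int j\<bar>"
      and h0: "\<forall>\<theta>. h \<theta> \<ge> 0" "2 * (\<delta> - \<eta>) \<le> 1 \<longrightarrow> (\<forall>\<theta>. h \<theta> \<le> 1)"
      and h1: "2 * (\<delta> - \<eta>) \<le> 1 \<longrightarrow> (\<forall>\<theta>. nearest_int_dist \<theta> \<ge> \<delta> - \<eta> + \<eta> \<longrightarrow> h \<theta> \<le> \<tau>)"
      unfolding J \<eta>_def[symmetric] \<tau>_def[symmetric] by (elim exE conjE)
    have d1: "2 * (\<delta> - \<eta>) \<le> 1" using \<delta> \<eta>0 by simp
    have "S (\<lambda>a q. \<Prod>r\<in>UNIV. h (q * f r (rational_point a q))) \<le> S (\<lambda>a q. 1 * of_bool (good a q) + \<tau>)"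
    proof (rule S_mono)
      fix a q
      show "(\<Prod>r\<in>UNIV. h (q * f r (rational_point a q))) \<le> 1 * of_bool (good a q) + \<tau>"
      proof (cases "good a q")
        case True
        have "(\<Prod>r\<in>UNIV. h (q * f r (rational_point a q))) \<le> 1" using h0 d1 by (intro prod_le_1) auto
        then show ?thesis using True \<tau>0 by simp
      next
        case False
        then obtain r where r: "nearest_int_dist (q * f r (rational_point a q)) \<ge> \<delta>"
          by (auto simp: good_def not_le intro: less_imp_le)
        have "(\<Prod>r\<in>UNIV. h (q * f r (rational_point a q))) = h (q * f r (rational_point a q)) * (\<Prod>r\<in>UNIV - {r}. h (q * f r (rational_point a q)))"
          by (rule prod.remove) auto
        also have "\<dots> \<le> \<tau> * 1"
          using h0 d1 r \<tau>0 by (intro mult_mono h1[rule_format] prod_le_1 prod_nonneg conjI) auto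
        finally show ?thesis using False by simp
      qed
    qed
    then have "S (\<lambda>a q. \<Prod>r\<in>UNIV. h (q * f r (rational_point a q))) \<le> N + \<tau> * N0"
      unfolding S_add N by simp
    moreover have "(2 * (\<delta> - \<eta>)) ^ R * N0 - P \<le> S (\<lambda>a q. \<Prod>r\<in>UNIV. h (q * f r (rational_point a q)))"
    proof -
      have "0 \<le> \<delta> - \<eta>" "\<delta> - \<eta> \<le> 1" using \<eta>0 \<delta> by auto
      from est[OF h[rule_format] b(1) b(2)[rule_format] this] show ?thesis by linarith
    qed
    ultimately have 1: "(2 * (\<delta> - \<eta>)) ^ R * N0 \<le> N + P + \<tau> * N0" by linarith
    have "\<tau> * N0 \<le> R * \<tau> * N0"
    proof -
      have "1 * \<tau> \<le> R * \<tau>" using \<tau>0 by (intro mult_right_mono) (auto simp: R_def Suc_leI)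
      then show ?thesis using N00 by (simp add: mult_right_mono)
    qed
    moreover have "((2 * \<delta>) ^ R - R * (2 * \<eta>) * (4 * \<delta>) ^ (R - 1)) * N0 \<le> (2 * (\<delta> - \<eta>)) ^ R * N0"
    proof (rule mult_right_mono[OF _ N00])
      have "(2 * \<delta>) ^ R - (2 * (\<delta> - \<eta>)) ^ R \<le> R * (2 * \<delta> - 2 * (\<delta> - \<eta>)) * (2 * \<delta>) ^ (R - 1)"
        using \<eta>0 by (intro power_diff_le) auto
      also have "\<dots> \<le> R * (2 * \<eta>) * (4 * \<delta>) ^ (R - 1)"
        using \<eta>0 by (intro mult_mono power_mono) auto
      finally show "(2 * \<delta>) ^ R - R * (2 * \<eta>) * (4 * \<delta>) ^ (R - 1) \<le> (2 * (\<delta> - \<eta>)) ^ R" by linarith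
    qed
    ultimately have "((2 * \<delta>) ^ R - R * (2 * \<eta>) * (4 * \<delta>) ^ (R - 1)) * N0 \<le> N + P + R * \<tau> * N0"
      using 1 by linarith
    then show ?thesis by (simp add: algebra_simps)
  qed
  have "2 * \<eta> = 6 / M" by (simp add: \<eta>_def)
  moreover have "\<bar>N - (2 * \<delta>) ^ R * N0\<bar> \<le> P + (R * \<tau> + R * (2 * \<eta>) * (4 * \<delta>) ^ (R - 1)) * N0"
    using upper lower by linarith
  ultimately show ?thesis
    unfolding P_def J_def R_def \<tau>_def by simp
qed

section \<open>Choosing the parameters\<close>

text \<open>\<open>Y\<close> is the intended real-valued degree. The actual degree
  \<open>2 * k * M\<close> exceeds it by a factor of order log Q only, because \<open>k\<close> of
  that order already makes the tails of the kernel negligible.\<close>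

lemma parameter_choice:
  fixes N N0 \<delta> Y cE A :: real and n R Q :: nat
  assumes disc: "\<And>M k. M \<ge> 6 \<Longrightarrow> 3 / real M \<le> \<delta> \<Longrightarrow> 3 * real M / 9 ^ k \<le> 1 \<Longrightarrow>
      \<bar>N - (2 * \<delta>) ^ R * N0\<bar> \<le> (6 + 2 * ln (real (2 * k * M) + 1)) ^ R *
        (Q * (cE * Q * sqrt (Q * (R * real (2 * k * M))) ^ (n - 1) * (2 + ln Q) ^ n))
        + (real R * (3 * real M / 9 ^ k) + real R * (6 / real M) * (4 * \<delta>) ^ (R - 1)) * N0"
    and N0: "0 \<le> N0" "N0 \<le> A * real Q ^ (n + 1)"
    and cE: "cE \<ge> 0" and \<delta>: "\<delta> \<le> 1 / 2" and Y: "1 \<le> Y * \<delta>" "0 < Y" "Y \<le> Q"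
    and Q: "Q \<ge> 2" and R: "R \<ge> 1"
  shows "\<bar>N - (2 * \<delta>) ^ R * N0\<bar> \<le>
    (64 + 18 * real R) ^ R * cE * (8 * real R * (real R + 3)) ^ (n - 1) * (2 + ln Q) ^ (R + 2 * n) * ((real Q)\<^sup>2 * sqrt (Q * Y) ^ (n - 1))
    + (real R + 2 * real R * 4 ^ (R - 1)) * A * (\<delta> ^ (R - 1) / Y * real Q ^ (n + 1))"
proof -
  define l where "l = 2 + ln (real Q)"
  \<comment> \<open>Rounding up 3Y makes 3/M at most 1/Y, hence at most \<delta>; since Y is at
    least 2, rounding does not pass 4Y.\<close>
  define M where "M = nat \<lceil>3 * Y\<rceil>"
  \<comment> \<open>Then 3^k is at least Q^(R+3), so 9^k is at least Q^(2R+6). This beats 3M, which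
    is at most 12 Q, even after multiplication by Q^R.\<close>
  define k where "k = nat \<lceil>(real R + 3) * ln Q\<rceil>"
  have lnQ: "ln (real Q) \<ge> 0" using Q by simp
  have l2: "l \<ge> 2" using lnQ by (simp add: l_def)
  have \<delta>0: "\<delta> > 0" using Y zero_less_mult_pos[of Y \<delta>] by linarith
  have Yd: "1 / Y \<le> \<delta>" using Y by (simp add: field_simps)
  have Y2: "Y \<ge> 2"
  proof -
    have "Y * \<delta> \<le> Y * (1 / 2)" using Y(2) \<delta> by (intro mult_left_mono) auto
    then show ?thesis using Y(1) by linarith
  qed
  have M: "3 * Y \<le> M" "real M \<le> 4 * Y"
    using Y2 unfolding M_def by linarith+
  have M6: "M \<ge> 6" using M(1) Y2 by linarith
  have k: "(real R + 3) * ln Q \<le> k" unfolding k_def by linarith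
  have kl: "real k \<le> (real R + 3) * l"
  proof -
    have "(real R + 3) * ln Q \<ge> 0" using lnQ by simp
    then have "real k \<le> (real R + 3) * ln Q + 1" unfolding k_def by linarith
    also have "\<dots> \<le> (real R + 3) * l" by (simp add: l_def algebra_simps)
    finally show ?thesis .
  qed
  have Md: "3 / real M \<le> \<delta>"
  proof -
    have "3 / real M \<le> 3 / (3 * Y)" using M(1) Y(2) by (intro divide_left_mono) auto
    then show ?thesis using Yd by simp
  qed
  have \<tau>: "3 * real M / 9 ^ k \<le> 1 / real Q ^ R"
  proof -
    have "real Q ^ (R + 3) = exp (ln Q) ^ (R + 3)" using Q by simp
    also have "\<dots> = exp (real (R + 3) * ln Q)" by (rule exp_of_nat_mult[symmetric])
    also have "\<dots> = exp ((real R + 3) * ln Q)" by simp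
    also have "\<dots> \<le> exp (real k * 1)" using k by simp
    also have "\<dots> = exp 1 ^ k" by (rule exp_of_nat_mult)
    also have "\<dots> \<le> 3 ^ k" using exp_le by (intro power_mono) auto
    finally have Q3: "real Q ^ (R + 3) \<le> 3 ^ k" .
    have "12 * real Q * real Q ^ R \<le> real Q ^ (R + 3) * real Q ^ (R + 3)"
    proof -
      have "(2::real) ^ 5 \<le> real Q ^ 5" using Q by (intro power_mono) auto
      then have "12 * 1 \<le> real Q ^ 5 * real Q ^ R" using Q by (intro mult_mono) (auto intro!: one_le_power)
      then have "12 * 1 * (real Q ^ Suc R) \<le> real Q ^ 5 * real Q ^ R * real Q ^ Suc R"
        by (intro mult_right_mono) auto
      also have "\<dots> = real Q ^ (R + 3) * real Q ^ (R + 3)"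
        unfolding power_add[symmetric] by (simp add: ac_simps)
      finally show ?thesis by (simp add: mult_ac)
    qed
    also have "\<dots> \<le> 3 ^ k * 3 ^ k" using Q3 by (intro mult_mono) auto
    also have "\<dots> = 9 ^ k" by (simp flip: power_mult_distrib)
    finally have "12 * real Q * real Q ^ R \<le> 9 ^ k" .
    moreover have "3 * real M * real Q ^ R \<le> 12 * real Q * real Q ^ R"
      using M(2) Y(3) by (intro mult_right_mono) auto
    ultimately have "3 * real M * real Q ^ R \<le> 9 ^ k" by linarith
    then show ?thesis using Q by (simp add: field_simps)
  qed
  have "1 / real Q ^ R \<le> 1" using Q by simp
  with \<tau> have \<tau>1: "3 * real M / 9 ^ k \<le> 1" by linarith
  \<comment> \<open>Both \<delta> and 1/Y are at least 1/Q, so the kernel tails are absorbed by the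
    boundary error.\<close>
  have dY: "1 / real Q ^ R \<le> \<delta> ^ (R - 1) / Y"
  proof -
    have "1 / real Q \<le> 1 / Y" using Y by (intro divide_left_mono) auto
    then have "1 / real Q \<le> \<delta>" using Yd by linarith
    then have "(1 / real Q) ^ (R - 1) * (1 / real Q) \<le> \<delta> ^ (R - 1) * (1 / Y)"
      using \<open>1 / real Q \<le> 1 / Y\<close> \<delta>0 by (intro mult_mono power_mono) auto
    moreover have "(1 / real Q) ^ (R - 1) * (1 / real Q) = 1 / real Q ^ R"
      using R by (cases R) (auto simp: power_one_over)
    ultimately show ?thesis by simp
  qed
  have second: "(real R * (3 * real M / 9 ^ k) + real R * (6 / real M) * (4 * \<delta>) ^ (R - 1)) * N0
     \<le> (real R + 2 * real R * 4 ^ (R - 1)) * A * (\<delta> ^ (R - 1) / Y * real Q ^ (n + 1))"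
  proof -
    have "6 / real M \<le> 6 / (3 * Y)" using M(1) Y(2) by (intro divide_left_mono) auto
    then have "real R * (6 / real M) * (4 * \<delta>) ^ (R - 1) \<le> R * (6 / (3 * Y)) * (4 * \<delta>) ^ (R - 1)"
      using \<delta>0 by (intro mult_right_mono mult_left_mono) auto
    also have "\<dots> = 2 * real R * 4 ^ (R - 1) * (\<delta> ^ (R - 1) / Y)" by (simp add: power_mult_distrib)
    finally have "real R * (3 * real M / 9 ^ k) + real R * (6 / real M) * (4 * \<delta>) ^ (R - 1)
       \<le> R * (\<delta> ^ (R - 1) / Y) + 2 * real R * 4 ^ (R - 1) * (\<delta> ^ (R - 1) / Y)"
      using \<tau> dY by (intro add_mono mult_left_mono) auto
    also have "\<dots> = (real R + 2 * real R * 4 ^ (R - 1)) * (\<delta> ^ (R - 1) / Y)" by (simp only: distrib_right)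
    finally have "(real R * (3 * real M / 9 ^ k) + real R * (6 / real M) * (4 * \<delta>) ^ (R - 1)) * N0
       \<le> ((real R + 2 * real R * 4 ^ (R - 1)) * (\<delta> ^ (R - 1) / Y)) * (A * real Q ^ (n + 1))"
      using N0 \<delta>0 Y(2) by (intro mult_mono) auto
    then show ?thesis by (simp only: mult_ac)
  qed
  have J: "real (2 * k * M) \<le> 8 * (real R + 3) * l * Y"
  proof -
    have "real (2 * k * M) = 2 * real k * real M" by simp
    also have "\<dots> \<le> 2 * ((real R + 3) * l) * (4 * Y)"
      using kl M(2) l2 by (intro mult_mono mult_left_mono) auto
    finally show ?thesis by (simp add: mult_ac)
  qed
  have lnJ: "6 + 2 * ln (real (2 * k * M) + 1) \<le> (64 + 18 * real R) * l"
  proof -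
    have "1 * 1 \<le> (real R + 3) * l * Q"
      using l2 Q mult_mono[of 1 "real R + 3" 1 l] by (intro mult_mono) auto
    moreover have "8 * (real R + 3) * l * Y \<le> 8 * (real R + 3) * l * Q"
      using Y(3) l2 by (intro mult_left_mono) auto
    ultimately have "real (2 * k * M) + 1 \<le> 9 * (real R + 3) * l * Q" using J by (simp add: algebra_simps)
    moreover have "0 < 9 * (real R + 3) * l * Q" using l2 Q by (intro mult_pos_pos) auto
    moreover have "0 < real (2 * k * M) + 1" by (intro add_nonneg_pos) auto
    ultimately have "ln (real (2 * k * M) + 1) \<le> ln (9 * (real R + 3) * l * Q)"
      by (simp only: ln_le_cancel_iff)
    also have "\<dots> = ln (9 * (real R + 3)) + ln l + ln Q"
      using l2 Q by (simp add: ln_mult)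
    also have "\<dots> \<le> 9 * (real R + 3) + l + l"
      using ln_le_minus_one[of "9 * (real R + 3)"] ln_le_minus_one[of l] l2 lnQ by (simp add: l_def)
    finally have "6 + 2 * ln (real (2 * k * M) + 1) \<le> (60 + 18 * real R) * 1 + 4 * l" by (simp add: algebra_simps)
    also have "\<dots> \<le> (60 + 18 * real R) * l + 4 * l" using l2 by (intro add_right_mono mult_left_mono) auto
    finally show ?thesis by (simp add: algebra_simps)
  qed
  have sq: "sqrt (Q * (R * real (2 * k * M))) \<le> 8 * real R * (real R + 3) * l * sqrt (Q * Y)"
  proof -
    define z where "z = 8 * real R * (real R + 3) * l"
    have z1: "z \<ge> 1"
      unfolding z_def using R l2 mult_mono[of 1 "8 * real R" 1 "real R + 3"] mult_mono[of 1 "8 * real R * (real R + 3)" 1 l] by simp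
    have "Q * (R * real (2 * k * M)) \<le> Q * (R * (8 * (real R + 3) * l * Y))"
      using J by (intro mult_left_mono) auto
    also have "\<dots> = z * (Q * Y)" by (simp add: z_def mult_ac)
    finally have "sqrt (Q * (R * real (2 * k * M))) \<le> sqrt z * sqrt (Q * Y)" by (simp flip: real_sqrt_mult)
    also have "sqrt z \<le> z"
      using z1 by (intro real_le_lsqrt) (auto simp: power2_eq_square mult_le_cancel_right1)
    finally show ?thesis using Y(2) by (simp add: z_def mult_right_mono)
  qed
  have "(6 + 2 * ln (real (2 * k * M) + 1)) ^ R *
        (Q * (cE * Q * sqrt (Q * (R * real (2 * k * M))) ^ (n - 1) * l ^ n))
     \<le> ((64 + 18 * real R) * l) ^ R *
        (Q * (cE * Q * (8 * real R * (real R + 3) * l * sqrt (Q * Y)) ^ (n - 1) * l ^ n))"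
    using lnJ sq cE l2 Y(2) by (intro mult_mono mult_left_mono power_mono) (auto intro: add_nonneg_nonneg)
  also have "\<dots> = (64 + 18 * real R) ^ R * cE * (8 * real R * (real R + 3)) ^ (n - 1) * (l ^ R * l ^ (n - 1) * l ^ n) * ((real Q)\<^sup>2 * sqrt (Q * Y) ^ (n - 1))"
    by (simp add: power_mult_distrib power2_eq_square mult_ac)
  also have "l ^ R * l ^ (n - 1) * l ^ n = l ^ (R + (n - 1) + n)" by (simp add: power_add)
  also have "(64 + 18 * real R) ^ R * cE * (8 * real R * (real R + 3)) ^ (n - 1) * l ^ (R + (n - 1) + n) * ((real Q)\<^sup>2 * sqrt (Q * Y) ^ (n - 1))
    \<le> (64 + 18 * real R) ^ R * cE * (8 * real R * (real R + 3)) ^ (n - 1) * l ^ (R + 2 * n) * ((real Q)\<^sup>2 * sqrt (Q * Y) ^ (n - 1))"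
    using cE l2 Y(2) by (intro mult_right_mono mult_left_mono power_increasing) auto
  finally have first: "(6 + 2 * ln (real (2 * k * M) + 1)) ^ R *
        (Q * (cE * Q * sqrt (Q * (R * real (2 * k * M))) ^ (n - 1) * (2 + ln Q) ^ n))
     \<le> (64 + 18 * real R) ^ R * cE * (8 * real R * (real R + 3)) ^ (n - 1) * (2 + ln Q) ^ (R + 2 * n) * ((real Q)\<^sup>2 * sqrt (Q * Y) ^ (n - 1))"
    unfolding l_def .
  show ?thesis by (rule order_trans[OF disc[OF M6 Md \<tau>1] add_mono[OF first second]])
qed

lemma power_le_fact_exp:
  fixes x :: real
  assumes "x \<ge> 0"
  shows "x ^ k \<le> fact k * exp x"
proof -
  have "x ^ k /\<^sub>R fact k \<le> exp x"
    using sum_le_suminf[OF summable_exp_generic[of x], of "{k}"] assms by (simp add: exp_def)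
  then show ?thesis by (simp add: field_simps)
qed

text \<open>For \<open>Q\<close> at least 2 the logarithm is at least 1/2, so 2 + log Q is at most 5
  log Q. If \<open>n = 3\<close>, the \<open>c\<close>-th power of the logarithm is the
  \<open>2 * c\<close>-th power of its square root, which one term of the exponential series
  controls; coefficient 1 in the exponent therefore suffices.\<close>

lemma log_factor_dominates:
  assumes "Q \<ge> 2"
  shows "(2 + ln (real Q)) ^ c \<le> 5 ^ c * fact (2 * c) * log_factor n 1 (real c) Q"
proof -
  have "ln (real Q) \<ge> ln 2" using assms by simp
  moreover have "ln (2::real) \<ge> 1 / 2" using ln_le_minus_one[of "1 / 2 :: real"] by (simp add: ln_div)
  ultimately have l: "ln (real Q) \<ge> 1 / 2" by linarith
  have "(2 + ln (real Q)) ^ c \<le> (5 * ln (real Q)) ^ c" using l by (intro power_mono) auto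
  also have "\<dots> = 5 ^ c * ln (real Q) ^ c" by (simp add: power_mult_distrib)
  also have "ln (real Q) ^ c \<le> fact (2 * c) * log_factor n 1 (real c) Q"
  proof (cases "n = 3")
    case True
    have "ln (real Q) ^ c = sqrt (ln (real Q)) ^ (2 * c)" using l by (simp add: power_mult)
    also have "\<dots> \<le> fact (2 * c) * exp (sqrt (ln (real Q)))" using l by (intro power_le_fact_exp) auto
    finally show ?thesis using True by (simp add: log_factor_def)
  next
    case False
    have "ln (real Q) ^ c = 1 * ln (real Q) powr c" using l by (simp add: powr_realpow)
    also have "\<dots> \<le> fact (2 * c) * ln (real Q) powr c" by (intro mult_right_mono fact_ge_1) auto
    finally show ?thesis using False by (simp add: log_factor_def)
  qed
  finally show ?thesis by (simp add: mult_ac)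
qed

text \<open>\<open>Y\<close> solves the equation between the frequency error and the boundary error,
  and \<open>E\<close> is their common value. Taking logarithms makes the two equalities linear in
  \<open>ln \<delta>\<close> and \<open>ln q\<close>.\<close>

lemma balancing_identities:
  fixes \<delta> q :: real and n R :: nat
  defines "Y \<equiv> \<delta> powr (2 * (real R - 1) / (real n + 1)) * q powr ((real n - 1) / (real n + 1))"
    and "E \<equiv> \<delta> powr ((real R - 1) * (real n - 1) / (real n + 1)) * q powr (real n + 2 / (real n + 1))"
  assumes \<delta>: "\<delta> > 0" and q: "q > 0" and n: "n \<ge> 1" and R: "R \<ge> 1"
  shows "q\<^sup>2 * sqrt (q * Y) ^ (n - 1) = E" "\<delta> ^ (R - 1) / Y * q ^ (n + 1) = E"
    and "q powr (- ((real n - 1) / (real n + 2 * real R - 1))) \<le> \<delta> \<Longrightarrow> 1 \<le> Y * \<delta>"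
    and "\<delta> \<le> 1 \<Longrightarrow> q \<ge> 1 \<Longrightarrow> Y \<le> q"
proof -
  define a where "a = ln \<delta>"
  define b where "b = ln q"
  have Y: "Y > 0" using \<delta> q by (simp add: Y_def)
  have E: "E > 0" using \<delta> q by (simp add: E_def)
  have lnY: "ln Y = 2 * (real R - 1) / (real n + 1) * a + (real n - 1) / (real n + 1) * b"
    using \<delta> q by (simp add: Y_def ln_mult a_def b_def)
  have lnE: "ln E = (real R - 1) * (real n - 1) / (real n + 1) * a + (real n + 2 / (real n + 1)) * b"
    using \<delta> q by (simp add: E_def ln_mult a_def b_def)
  have n1: "real (n - Suc 0) = real n - 1" "real (R - Suc 0) = real R - 1" using n R by auto
  show "q\<^sup>2 * sqrt (q * Y) ^ (n - 1) = E"
  proof -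
    have "ln (q\<^sup>2 * sqrt (q * Y) ^ (n - 1)) = 2 * b + (real n - 1) * ((b + ln Y) / 2)"
      using q Y by (simp add: ln_mult ln_realpow ln_sqrt n1 b_def)
    also have "\<dots> = ln E"
    proof -
      define z where "z = real n + 1"
      have z: "z \<noteq> 0" "real n = z - 1" by (simp_all add: z_def)
      show ?thesis unfolding lnY lnE z(2) using z(1) by (simp add: divide_simps) (simp add: algebra_simps)
    qed
    finally show ?thesis using q Y E by simp
  qed
  show "\<delta> ^ (R - 1) / Y * q ^ (n + 1) = E"
  proof -
    have "ln (\<delta> ^ (R - 1) / Y * q ^ (n + 1)) = (real R - 1) * a - ln Y + (real n + 1) * b"
      using \<delta> q Y by (simp add: ln_mult ln_div ln_realpow n1 a_def b_def algebra_simps)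
    also have "\<dots> = ln E"
    proof -
      define z where "z = real n + 1"
      have z: "z \<noteq> 0" "real n = z - 1" by (simp_all add: z_def)
      show ?thesis unfolding lnY lnE z(2) using z(1) by (simp add: divide_simps) (simp add: algebra_simps)
    qed
    finally show ?thesis using \<delta> q Y E by simp
  qed
  show "1 \<le> Y * \<delta>" if "q powr (- ((real n - 1) / (real n + 2 * real R - 1))) \<le> \<delta>"
  proof -
    have d: "real n + 2 * real R - 1 > 0" using n R by linarith
    have "ln (q powr (- ((real n - 1) / (real n + 2 * real R - 1)))) \<le> ln \<delta>"
      using that q by (intro ln_mono) auto
    then have "- ((real n - 1) / (real n + 2 * real R - 1)) * b \<le> a" using q by (simp add: a_def b_def)
    then have "0 \<le> (real n + 2 * real R - 1) * a + (real n - 1) * b" using d by (simp add: field_simps)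
    moreover have "ln (Y * \<delta>) = ((real n + 2 * real R - 1) * a + (real n - 1) * b) / (real n + 1)"
    proof -
      define z where "z = real n + 1"
      have z: "z \<noteq> 0" "real n = z - 1" by (simp_all add: z_def)
      have "ln (Y * \<delta>) = ln Y + a" using \<delta> Y by (simp add: ln_mult a_def)
      then show ?thesis unfolding lnY z(2) using z(1) by (simp add: divide_simps) (simp add: algebra_simps)
    qed
    ultimately have "0 \<le> ln (Y * \<delta>)" by simp
    then show ?thesis using \<delta> Y by (simp add: ln_ge_zero_iff)
  qed
  show "Y \<le> q" if "\<delta> \<le> 1" "q \<ge> 1"
  proof -
    have "\<delta> powr (2 * (real R - 1) / (real n + 1)) \<le> 1" using \<delta> that R by (intro powr_le1) auto
    moreover have "q powr ((real n - 1) / (real n + 1)) \<le> q powr 1" using that by (intro powr_mono) auto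
    ultimately have "Y \<le> 1 * q powr 1" unfolding Y_def by (intro mult_mono) auto
    then show ?thesis using q by simp
  qed
qed

text \<open>At the threshold \<open>d\<close> the error of the upper range and the order of the main
  term coincide, and both equal the error of the lower range. Comparison with the count at
  \<open>d\<close> is therefore free of loss for smaller widths.\<close>

lemma threshold_identities:
  fixes q :: real and n R :: nat
  defines "d \<equiv> q powr (- ((real n - 1) / (real n + 2 * real R - 1)))"
    and "E \<equiv> q powr (real n - ((real R - 1) * real n + 1 - 3 * real R) / (real n + 2 * real R - 1))"
  assumes q: "q > 0" and n: "n \<ge> 1" and R: "R \<ge> 1"
  shows "d powr ((real R - 1) * (real n - 1) / (real n + 1)) * q powr (real n + 2 / (real n + 1)) = E"
    and "d ^ R * q ^ (n + 1) = E"
proof -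
  have d0: "d > 0" "E > 0" using q by (simp_all add: d_def E_def)
  have D: "real n + 2 * real R - 1 > 0" using n R by linarith
  have n0: "real n + 1 > 0" by simp
  define D where "D = real n + 2 * real R - 1"
  have D0: "D > 0" "real R = (D - real n + 1) / 2" using D by (simp_all add: D_def)
  have lnd: "ln d = - ((real n - 1) / D) * ln q" using q by (simp add: d_def D_def)
  have lnE: "ln E = (real n - ((real R - 1) * real n + 1 - 3 * real R) / D) * ln q" using q by (simp add: E_def D_def)
  show "d powr ((real R - 1) * (real n - 1) / (real n + 1)) * q powr (real n + 2 / (real n + 1)) = E"
  proof -
    have "ln (d powr ((real R - 1) * (real n - 1) / (real n + 1)) * q powr (real n + 2 / (real n + 1)))
      = ((real R - 1) * (real n - 1) / (real n + 1)) * ln d + (real n + 2 / (real n + 1)) * ln q"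
      using d0 q by (simp add: ln_mult)
    also have "\<dots> = (((real R - 1) * (real n - 1) / (real n + 1)) * (- ((real n - 1) / D)) + (real n + 2 / (real n + 1))) * ln q"
      unfolding lnd by (simp only: distrib_right mult.assoc)
    also have "((real R - 1) * (real n - 1) / (real n + 1)) * (- ((real n - 1) / D)) + (real n + 2 / (real n + 1))
      = real n - ((real R - 1) * real n + 1 - 3 * real R) / D"
      using n0 D0(1) unfolding D0(2) by (simp add: divide_simps) (simp add: algebra_simps)
    also have "\<dots> * ln q = ln E" by (simp add: lnE)
    finally show ?thesis using d0 q by simp
  qed
  show "d ^ R * q ^ (n + 1) = E"
  proof -
    have "ln (d ^ R * q ^ (n + 1)) = real R * ln d + (real n + 1) * ln q"
      using d0 q by (simp add: ln_mult ln_realpow algebra_simps)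
    also have "\<dots> = (real R * (- ((real n - 1) / D)) + (real n + 1)) * ln q"
      unfolding lnd by (simp only: distrib_right mult.assoc)
    also have "real R * (- ((real n - 1) / D)) + (real n + 1) = real n - ((real R - 1) * real n + 1 - 3 * real R) / D"
      using D0(1) unfolding D0(2) by (simp add: divide_simps) (simp add: algebra_simps)
    also have "\<dots> * ln q = ln E" by (simp add: lnE)
    finally show ?thesis using d0 q by simp
  qed
qed

text \<open>Since an admissible radius controls all data of \<open>f\<close>, this bound makes the constants depend on \<open>w\<close> only.\<close>

lemma support_radius_lower_bound:
  fixes w :: "real^'n \<Rightarrow> real"
  assumes "continuous_on UNIV w" "w y \<noteq> 0"
  shows "\<exists>s>0. \<forall>x0 e. function_support w \<subseteq> linf_ball x0 e \<longrightarrow> s \<le> e"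
proof -
  have "open {x. w x \<noteq> 0}"
    using open_vimage[OF _ assms(1), of "- {0}"] by (simp add: vimage_def open_Compl)
  \<comment> \<open>A nonempty open set is not a single point, so the support contains two points
    differing in some coordinate; half that difference bounds the radius of every cube around the
    support from below.\<close>
  then have "{x. w x \<noteq> 0} \<noteq> {y}" using not_open_singleton by metis
  then obtain z where z: "w z \<noteq> 0" "z \<noteq> y" using assms(2) by auto
  then obtain m where m: "z $ m \<noteq> y $ m" by (auto simp: vec_eq_iff)
  show ?thesis
  proof (intro exI conjI allI impI)
    show "\<bar>z $ m - y $ m\<bar> / 2 > 0" using m by simp
    fix x0 :: "real^'n" and e assume sub: "function_support w \<subseteq> linf_ball x0 e"
    have "\<bar>v $ m - x0 $ m\<bar> \<le> e" if "w v \<noteq> 0" for v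
    proof -
      have "v \<in> function_support w" using that closure_subset[of "{x. w x \<noteq> 0}"] by (auto simp: function_support_def)
      then have "infnorm (v - x0) < e" using sub by (auto simp: linf_ball_def)
      then show ?thesis using component_le_infnorm_cart[of "v - x0" m] by simp
    qed
    from this[OF z(1)] this[OF assms(2)] show "\<bar>z $ m - y $ m\<bar> / 2 \<le> e"
      using abs_triangle_ineq4[of "z $ m - x0 $ m" "y $ m - x0 $ m"] by simp
  qed
qed

section \<open>A constant depending on the weight only\<close>

text \<open>The order of quantifiers is the point: \<open>C\<close> is chosen before the centre, the
  functions and the radius. It is built from derivative bounds and size of the support of
  \<open>w\<close> and from the lower bound \<open>s\<close> for the radius.\<close>

lemma uniform_count_estimate:
  fixes w :: "real^'n \<Rightarrow> real"
  assumes n3: "CARD('n) \<ge> 3" and w: "smooth_compact_support w" "\<And>x. w x \<ge> 0"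
  shows "\<exists>C>0. \<forall>x0 (f :: 'r::finite \<Rightarrow> real^'n \<Rightarrow> real) e Q \<delta>.
    admissible_radius x0 f e \<longrightarrow> (\<forall>r. cont_diff CARD('n) (f r)) \<longrightarrow> function_support w \<subseteq> linf_ball x0 e \<longrightarrow>
    Q \<ge> 2 \<longrightarrow> 0 \<le> \<delta> \<longrightarrow> \<delta> \<le> 1 / 2 \<longrightarrow>
    \<bar>weighted_count f w Q \<delta> - (2 * \<delta>) ^ CARD('r) * total_weight w Q\<bar>
      \<le> C * (error_bound (real CARD('n)) (real CARD('r)) Q \<delta> *
             log_factor CARD('n) 1 (real (CARD('r) + 2 * CARD('n))) Q)"
proof (cases "\<forall>y. w y = 0")
  \<comment> \<open>The zero weight is treated apart because it provides no positive lower bound for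
    the radius.\<close>
  case True
  have nonneg: "0 \<le> error_bound (real CARD('n)) (real CARD('r)) Q \<delta> * log_factor CARD('n) 1 (real (CARD('r) + 2 * CARD('n))) Q" for Q \<delta>
    by (simp add: error_bound_def log_factor_def)
  have "weighted_count f w Q \<delta> = 0" "total_weight w Q = 0" for f :: "'r \<Rightarrow> real^'n \<Rightarrow> real" and Q \<delta>
    unfolding weighted_count_def total_weight_def using True by (simp_all add: case_prod_unfold)
  then show ?thesis using nonneg by (intro exI[of _ 1]) simp
next
  case False
  define n where "n = CARD('n)"
  define R where "R = CARD('r)"
  have n1: "n \<ge> 1" "n \<ge> 2" "R \<ge> 1" using n3 by (auto simp: n_def R_def Suc_leI)
  obtain W X where X: "X \<ge> 0" and wb: "\<And>js y. length js \<le> CARD('n) \<Longrightarrow> \<bar>iterated_partial js w y\<bar> \<le> W"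
    and wX: "\<And>y m. w y \<noteq> 0 \<Longrightarrow> \<bar>y $ m\<bar> \<le> X"
    using smooth_compact_support_bounds[OF w(1), of "CARD('n)"] by blast
  have W: "W \<ge> 0" using wb[of "[]" 0] by simp
  have cw: "cont_diff k w" for k using w(1) by (simp add: smooth_compact_support_def)
  obtain s where s: "s > 0" "\<And>x0 e. function_support w \<subseteq> linf_ball x0 e \<Longrightarrow> s \<le> e"
    using support_radius_lower_bound[OF cont_diff_continuous[OF cw]] False by blast
  have fin: "finite (weighted_points w q)" if "q > 0" for q
    using that X wX by (rule support_points)
  define cE where "cE = \<bar>exponential_sum_const n W (R / s) s X\<bar>"
  define A where "A = W * (2 * X + 1) ^ n"
  define a1 where "a1 = (64 + 18 * real R) ^ R * cE * (8 * real R * (real R + 3)) ^ (n - 1)"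
  define a2 where "a2 = (real R + 2 * real R * 4 ^ (R - 1)) * A"
  define D where "D = 2 ^ R * A + a1 + a2"
  define c where "c = R + 2 * n"
  have A0: "A \<ge> 0" "a1 \<ge> 0" "a2 \<ge> 0" using W X by (simp_all add: A_def a1_def a2_def cE_def)
  then have D0: "D \<ge> 0" by (simp add: D_def)
  define N0 where "N0 Q = (\<Sum>q\<in>{1..Q}. \<Sum>a\<in>weighted_points w q. w (rational_point a q))" for Q
  have total: "total_weight w Q = N0 Q" for Q
    using infsum_rational_points[OF fin, of Q "\<lambda>_ _. True"] by (simp add: total_weight_def N0_def)
  have N00: "N0 Q \<ge> 0" for Q unfolding N0_def using w(2) by (intro sum_nonneg) auto
  have N0A: "N0 Q \<le> A * real Q ^ (n + 1)" for Q
  proof -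
    have "N0 Q \<le> (\<Sum>q\<in>{1..Q}. W * ((2 * X + 1) * Q) ^ n)"
      unfolding N0_def
    proof (rule sum_mono)
      fix q assume q: "q \<in> {1..Q}"
      have "(\<Sum>a\<in>weighted_points w q. w (rational_point a q)) \<le> (\<Sum>a\<in>weighted_points w q. W)"
        using wb[of "[]"] by (intro sum_mono) (simp add: abs_le_iff)
      also have "\<dots> = W * real (card (weighted_points w q))" by simp
      also have "\<dots> \<le> W * ((2 * X + 1) * q) ^ CARD('n)"
        using q X wX W by (intro mult_left_mono support_points) auto
      also have "\<dots> \<le> W * ((2 * X + 1) * Q) ^ n"
        unfolding n_def using q X W by (intro mult_left_mono power_mono) auto
      finally show "(\<Sum>a\<in>weighted_points w q. w (rational_point a q)) \<le> W * ((2 * X + 1) * Q) ^ n" .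
    qed
    also have "\<dots> = A * real Q ^ (n + 1)" by (simp add: A_def power_mult_distrib)
    finally show ?thesis .
  qed
  have main: "\<bar>weighted_count f w Q \<delta> - (2 * \<delta>) ^ R * N0 Q\<bar> \<le> D * (2 + ln Q) ^ c * error_bound (real n) (real R) Q \<delta>"
    if adm: "admissible_radius x0 f e" and cf: "\<forall>r. cont_diff CARD('n) (f r)" and sub: "function_support w \<subseteq> linf_ball x0 e"
      and Q: "Q \<ge> 2" and \<delta>: "0 \<le> \<delta>" "\<delta> \<le> 1 / 2" for x0 and f :: "'r \<Rightarrow> real^'n \<Rightarrow> real" and e Q \<delta>
  proof -
    define q where "q = real Q"
    have q2: "q \<ge> 2" using Q by (simp add: q_def)
    have l1: "(2 + ln q) ^ c \<ge> 1" using q2 by (intro one_le_power) auto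
    define N where "N d = (\<Sum>q\<in>{1..Q}. \<Sum>a\<in>weighted_points w q. w (rational_point a q) *
      of_bool (\<forall>r. nearest_int_dist (q * f r (rational_point a q)) \<le> d))" for d
    have count: "weighted_count f w Q d = N d" for d
      using infsum_rational_points[OF fin, of Q "\<lambda>a q. \<forall>r. nearest_int_dist (q * f r (rational_point a q)) \<le> d"]
      by (simp add: weighted_count_def N_def)
    have N_mono: "N d \<le> N d'" if "d \<le> d'" for d d'
      unfolding N_def using w(2) that
      by (intro sum_mono mult_left_mono) (auto simp: of_bool_def intro: order_trans)
    have N_nonneg: "0 \<le> N d" for d
      unfolding N_def using w(2) by (intro sum_nonneg mult_nonneg_nonneg) auto
    have N_le: "N d \<le> N0 Q" for d
      unfolding N_def N0_def using w(2) by (intro sum_mono) (auto simp: mult_left_le)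
    \<comment> \<open>Stated for a general width, since it is applied to \<open>\<delta>\<close>
      above the threshold and to the threshold itself below it.\<close>
    have large: "\<bar>N d - (2 * d) ^ R * N0 Q\<bar> \<le> (a1 + a2) * (2 + ln q) ^ c *
        (d powr ((real R - 1) * (real n - 1) / (real n + 1)) * q powr (real n + 2 / (real n + 1)))"
      if d: "q powr (- ((real n - 1) / (real n + 2 * real R - 1))) \<le> d" "d \<le> 1 / 2" for d
    proof -
      have "0 < q powr (- ((real n - 1) / (real n + 2 * real R - 1)))" using q2 by simp
      with d(1) have d0: "d > 0" by (rule less_le_trans[rotated])
      define Y where "Y = d powr (2 * (real R - 1) / (real n + 1)) * q powr ((real n - 1) / (real n + 1))"
      define E where "E = d powr ((real R - 1) * (real n - 1) / (real n + 1)) * q powr (real n + 2 / (real n + 1))"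
      have q0: "q > 0" "q \<ge> 1" using q2 by auto
      have Y0: "Y > 0" using d0 q0 by (simp add: Y_def)
      have YE: "q\<^sup>2 * sqrt (q * Y) ^ (n - 1) = E" "d ^ (R - 1) / Y * q ^ (n + 1) = E" "1 \<le> Y * d" "Y \<le> q"
        unfolding Y_def E_def using d0 q0 n1 d by (intro balancing_identities; simp)+
      have E0: "E > 0" using d0 q0 by (simp add: E_def)
      have "\<bar>N d - (2 * d) ^ R * N0 Q\<bar> \<le> a1 * (2 + ln (real Q)) ^ c * ((real Q)\<^sup>2 * sqrt (real Q * Y) ^ (n - 1))
        + a2 * (d ^ (R - 1) / Y * real Q ^ (n + 1))"
        unfolding a1_def a2_def c_def
      proof (rule parameter_choice)
        fix M k :: nat
        assume M: "6 \<le> M" "3 / real M \<le> d" "3 * real M / 9 ^ k \<le> 1"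
        have lnQ: "ln (real Q) \<ge> 0" using Q by simp
        show "\<bar>N d - (2 * d) ^ R * N0 Q\<bar> \<le> (6 + 2 * ln (real (2 * k * M) + 1)) ^ R *
          (Q * (cE * Q * sqrt (Q * (R * real (2 * k * M))) ^ (n - 1) * (2 + ln Q) ^ n))
          + (R * (3 * real M / 9 ^ k) + R * (6 / M) * (4 * d) ^ (R - 1)) * N0 Q"
          unfolding N_def N0_def R_def
        proof (rule count_discrepancy)
          show "6 \<le> M" "3 / real M \<le> d" "d \<le> 1 / 2" "\<And>y. 0 \<le> w y" using M d w by auto
          show "3 * real M / 9 ^ k \<le> 1" using M by simp
          show "0 \<le> cE * Q * sqrt (Q * (CARD('r) * real (2 * k * M))) ^ (n - 1) * (2 + ln Q) ^ n"
            using lnQ by (simp add: cE_def)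
          fix g :: "'r \<Rightarrow> int" and p :: nat
          assume g: "g \<noteq> (\<lambda>_. 0)" "\<And>r. \<bar>real_of_int (g r)\<bar> \<le> real (2 * k * M)" and p: "1 \<le> p" "p \<le> Q"
          have "cmod (exponential_sum w (frequency_combination f g) p) \<le>
            exponential_sum_const CARD('n) W (CARD('r) / s) s X * p * sqrt (p * (CARD('r) * real (2 * k * M))) ^ (CARD('n) - 1) * (2 + ln p) ^ CARD('n)"
          proof (rule frequency_exponential_sum_bound[OF _ cw _ wb _ s(1) s(2)[OF sub] X _ wX adm g])
            fix y m assume "w y \<noteq> 0"
            then have "y \<in> function_support w" using closure_subset[of "{x. w x \<noteq> 0}"] by (auto simp: function_support_def)
            then have "infnorm (y - x0) < e" using sub by (auto simp: linf_ball_def)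
            then show "\<bar>y $ m - x0 $ m\<bar> \<le> e" using component_le_infnorm_cart[of "y - x0" m] by simp
          qed (use n3 p cf in auto)
          also have "\<dots> \<le> cE * Q * sqrt (Q * (CARD('r) * real (2 * k * M))) ^ (n - 1) * (2 + ln Q) ^ n"
            unfolding n_def[symmetric] R_def[symmetric] using p
            by (intro mult_mono power_mono real_sqrt_le_mono) (auto simp: cE_def intro!: mult_nonneg_nonneg)
          finally show "cmod (exponential_sum w (frequency_combination f g) p)
            \<le> cE * Q * sqrt (Q * (CARD('r) * real (2 * k * M))) ^ (n - 1) * (2 + ln Q) ^ n" .
        qed
      qed (use N00 N0A YE Y0 d Q n1 in \<open>auto simp: cE_def q_def\<close>)
      also have "\<dots> = a1 * (2 + ln q) ^ c * E + a2 * E" using YE by (simp add: q_def)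
      also have "\<dots> \<le> a1 * (2 + ln q) ^ c * E + a2 * (2 + ln q) ^ c * E"
        using A0 E0 l1 by (intro add_left_mono mult_right_mono) (auto simp: mult_le_cancel_left1)
      finally show ?thesis by (simp add: E_def algebra_simps)
    qed
    define d0 where "d0 = q powr (- ((real n - 1) / (real n + 2 * real R - 1)))"
    have d0_pos: "d0 > 0" using q2 by (simp add: d0_def)
    show ?thesis
    proof (cases "d0 \<le> \<delta>")
      case True
      have "\<bar>N \<delta> - (2 * \<delta>) ^ R * N0 Q\<bar> \<le> (a1 + a2) * (2 + ln q) ^ c *
        (\<delta> powr ((real R - 1) * (real n - 1) / (real n + 1)) * q powr (real n + 2 / (real n + 1)))"
        using True \<delta> by (intro large) (auto simp: d0_def)
      also have "\<dots> \<le> D * (2 + ln q) ^ c *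
        (\<delta> powr ((real R - 1) * (real n - 1) / (real n + 1)) * q powr (real n + 2 / (real n + 1)))"
        using A0 q2 by (intro mult_right_mono) (auto simp: D_def)
      finally show ?thesis using True by (simp add: count error_bound_def d0_def q_def)
    next
      case False
      define E where "E = q powr (real n - ((real R - 1) * real n + 1 - 3 * real R) / (real n + 2 * real R - 1))"
      have E0: "E \<ge> 0" by (simp add: E_def)
      have id: "d0 powr ((real R - 1) * (real n - 1) / (real n + 1)) * q powr (real n + 2 / (real n + 1)) = E" "d0 ^ R * q ^ (n + 1) = E"
        unfolding d0_def E_def using q2 n1 by (intro threshold_identities; simp)+
      have main0: "(2 * d0) ^ R * N0 Q \<le> 2 ^ R * A * E"
      proof -
        have "(2 * d0) ^ R * N0 Q \<le> (2 * d0) ^ R * (A * q ^ (n + 1))"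
          unfolding q_def using d0_pos N0A by (intro mult_left_mono) auto
        also have "\<dots> = 2 ^ R * A * E" unfolding id(2)[symmetric] by (simp add: power_mult_distrib)
        finally show ?thesis .
      qed
      have \<delta>d: "(2 * \<delta>) ^ R \<le> (2 * d0) ^ R" using False \<delta> by (intro power_mono) auto
      have \<delta>1: "(2 * \<delta>) ^ R \<le> 1" using \<delta> by (intro power_le_one) auto
      have \<delta>0: "0 \<le> (2 * \<delta>) ^ R * N0 Q" using \<delta> N00 by simp
      \<comment> \<open>By monotonicity the count and the main term at \<open>\<delta>\<close> both
        lie between 0 and their size at the threshold, so their difference needs no
        cancellation.\<close>
      have "\<bar>N \<delta> - (2 * \<delta>) ^ R * N0 Q\<bar> \<le> 2 ^ R * A * E + (a1 + a2) * (2 + ln q) ^ c * E"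
      proof (cases "d0 \<le> 1 / 2")
        case True
        have "\<bar>N d0 - (2 * d0) ^ R * N0 Q\<bar> \<le> (a1 + a2) * (2 + ln q) ^ c * E"
          using large[of d0] True id(1) by (simp add: d0_def)
        moreover have "N \<delta> \<le> N d0" using False by (intro N_mono) simp
        moreover have "(2 * \<delta>) ^ R * N0 Q \<le> (2 * d0) ^ R * N0 Q" using \<delta>d N00 by (intro mult_right_mono) auto
        ultimately show ?thesis using main0 \<delta>0 N_nonneg[of \<delta>] by linarith
      next
        case False
        have "1 ^ R \<le> (2 * d0) ^ R" using False by (intro power_mono) auto
        then have "1 * N0 Q \<le> (2 * d0) ^ R * N0 Q" using N00 by (intro mult_right_mono) auto
        moreover have "(2 * \<delta>) ^ R * N0 Q \<le> 1 * N0 Q" using \<delta>1 N00 by (intro mult_right_mono) auto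
        moreover have "0 \<le> (a1 + a2) * (2 + ln q) ^ c * E" using A0 E0 q2 by simp
        ultimately show ?thesis using main0 \<delta>0 N_nonneg[of \<delta>] N_le[of \<delta>] by linarith
      qed
      also have "\<dots> \<le> 2 ^ R * A * (2 + ln q) ^ c * E + (a1 + a2) * (2 + ln q) ^ c * E"
      proof (intro add_right_mono mult_right_mono)
        have "0 \<le> 2 ^ R * A" using A0 by simp
        then show "2 ^ R * A \<le> 2 ^ R * A * (2 + ln q) ^ c" using mult_left_mono[OF l1] by simp
      qed (rule E0)
      also have "\<dots> = D * (2 + ln q) ^ c * E" by (simp add: D_def algebra_simps)
      finally show ?thesis using False by (simp add: count error_bound_def d0_def q_def E_def)
    qed
  qed
  \<comment> \<open>\<open>D\<close> may vanish; the added 1 makes the constant positive.\<close>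
  define C where "C = D * (5 ^ c * fact (2 * c)) + 1"
  have C0: "C > 0" using D0 by (simp add: C_def add_nonneg_pos)
  show ?thesis
  proof (intro exI[of _ C] conjI C0 allI impI)
    fix x0 :: "real^'n" and f :: "'r \<Rightarrow> real^'n \<Rightarrow> real" and e \<delta> :: real and Q :: nat
    assume h: "admissible_radius x0 f e" "\<forall>r. cont_diff CARD('n) (f r)" "function_support w \<subseteq> linf_ball x0 e" "2 \<le> Q" "0 \<le> \<delta>" "\<delta> \<le> 1 / 2"
    have eb: "0 \<le> error_bound (real n) (real R) Q \<delta>" "0 \<le> log_factor n 1 (real c) Q"
      by (simp_all add: error_bound_def log_factor_def)
    have "\<bar>weighted_count f w Q \<delta> - (2 * \<delta>) ^ R * N0 Q\<bar> \<le> D * (2 + ln Q) ^ c * error_bound (real n) (real R) Q \<delta>"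
      by (rule main[OF h])
    also have "\<dots> \<le> D * (5 ^ c * fact (2 * c) * log_factor n 1 (real c) Q) * error_bound (real n) (real R) Q \<delta>"
      using D0 eb log_factor_dominates[OF h(4)] by (intro mult_right_mono mult_left_mono) auto
    also have "\<dots> = D * (5 ^ c * fact (2 * c)) * (error_bound (real n) (real R) Q \<delta> * log_factor n 1 (real c) Q)" by simp
    also have "\<dots> \<le> C * (error_bound (real n) (real R) Q \<delta> * log_factor n 1 (real c) Q)"
      using eb by (intro mult_right_mono) (auto simp: C_def)
    finally show "\<bar>weighted_count f w Q \<delta> - (2 * \<delta>) ^ CARD('r) * total_weight w Q\<bar>
      \<le> C * (error_bound (real CARD('n)) (real CARD('r)) Q \<delta> * log_factor CARD('n) 1 (real (CARD('r) + 2 * CARD('n))) Q)"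
      unfolding total n_def R_def c_def .
  qed
qed

theorem theorem1p4:
  assumes "CARD('n::finite) \<ge> 3"
  shows "\<exists>(eps :: real^'n \<Rightarrow> ('r::finite \<Rightarrow> real^'n \<Rightarrow> real) \<Rightarrow> real)
          (c1 :: ((real^'n) \<times> (real^'r)) set \<Rightarrow> (real^'n \<Rightarrow> real) \<Rightarrow> real)
          (c2 :: ((real^'n) \<times> (real^'r)) set \<Rightarrow> (real^'n \<Rightarrow> real) \<Rightarrow> real)
          (C :: ((real^'n) \<times> (real^'r)) set \<Rightarrow> (real^'n \<Rightarrow> real) \<Rightarrow> real).
      (\<forall>x0 f. eps x0 f > 0) \<and>
      (\<forall>M w. c1 M w > 0 \<and> c2 M w > 0 \<and> C M w > 0) \<and>
      (\<forall>(l::nat) x0 f.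
         real l > max (real CARD('n) + 1) (real CARD('n) / 2 + 4) \<and>
         (\<forall>r. cont_diff l (f r)) \<and>
         (\<forall>t::real^'r. t \<noteq> 0 \<longrightarrow>
            rank (hessian (\<lambda>x. \<Sum>r\<in>UNIV. t $ r * f r x) x0) \<ge> CARD('n) - 1)
       \<longrightarrow>
         (\<forall>\<epsilon>0 w.
            0 < \<epsilon>0 \<and> \<epsilon>0 \<le> eps x0 f \<and>
            smooth_compact_support w \<and> (\<forall>x. w x \<ge> 0) \<and>
            function_support w \<subseteq> linf_ball x0 (eps x0 f)
          \<longrightarrow>
            (let M = graph_manifold f x0 \<epsilon>0 in
             \<forall>Q \<delta>. Q \<ge> 2 \<and> 0 \<le> \<delta> \<and> \<delta> \<le> 1 / 2 \<longrightarrow>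
               \<bar>weighted_count f w Q \<delta> - (2 * \<delta>) ^ CARD('r) * total_weight w Q\<bar>
                 \<le> C M w * (error_bound (real CARD('n)) (real CARD('r)) Q \<delta> *
                            log_factor CARD('n) (c1 M w) (c2 M w) Q))))"
proof -
  \<comment> \<open>The default 1 keeps \<open>eps\<close> positive for pairs without an admissible
    radius; under the rank hypothesis such a radius exists.\<close>
  define eps where "eps x0 f = (if \<exists>e. admissible_radius x0 f e then SOME e. admissible_radius x0 f e else 1)"
    for x0 :: "real^'n" and f :: "'r \<Rightarrow> real^'n \<Rightarrow> real"
  define bound where "bound w C \<longleftrightarrow> C > 0 \<and> (\<forall>x0 (f :: 'r \<Rightarrow> real^'n \<Rightarrow> real) e Q \<delta>.
    admissible_radius x0 f e \<longrightarrow> (\<forall>r. cont_diff CARD('n) (f r)) \<longrightarrow> function_support w \<subseteq> linf_ball x0 e \<longrightarrow>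
    Q \<ge> 2 \<longrightarrow> 0 \<le> \<delta> \<longrightarrow> \<delta> \<le> 1 / 2 \<longrightarrow>
    \<bar>weighted_count f w Q \<delta> - (2 * \<delta>) ^ CARD('r) * total_weight w Q\<bar>
      \<le> C * (error_bound (real CARD('n)) (real CARD('r)) Q \<delta> *
             log_factor CARD('n) 1 (real (CARD('r) + 2 * CARD('n))) Q))" for w and C :: real
  \<comment> \<open>The default 1 serves weights for which no bound holds, since positivity is
    demanded of \<open>C\<close> for every function \<open>w\<close>.\<close>
  define C where "C w = (if \<exists>C. bound w C then SOME C. bound w C else 1)" for w
  have eps_adm: "admissible_radius x0 f (eps x0 f)" if "\<exists>e. admissible_radius x0 f e" for x0 f
    using someI_ex[OF that] that by (simp add: eps_def)
  have eps_pos: "eps x0 f > 0" for x0 f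
  proof (cases "\<exists>e. admissible_radius x0 f e")
    case True
    then show ?thesis using eps_adm[OF True] by (simp add: admissible_radius_def)
  qed (simp add: eps_def)
  have C_bound: "bound w (C w)" if "\<exists>C. bound w C" for w
    using someI_ex[OF that] that by (simp add: C_def)
  have C_pos: "C w > 0" for w
  proof (cases "\<exists>C. bound w C")
    case True
    then show ?thesis using C_bound[OF True] by (simp add: bound_def)
  qed (simp add: C_def)
  show ?thesis
  \<comment> \<open>The exponents are absolute: 1 for \<open>n = 3\<close>, and otherwise the total
    power of the logarithm lost, R from the coefficient sums and at most 2n from the degree and the
    box weights. The constant is a function of \<open>w\<close> alone, which is stronger than
    dependence on the manifold and \<open>w\<close>.\<close>
  proof (rule exI[of _ eps], rule exI[of _ "\<lambda>_ _. 1"], rule exI[of _ "\<lambda>_ _. real (CARD('r) + 2 * CARD('n))"],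
      rule exI[of _ "\<lambda>_. C"], intro conjI allI impI)
    fix l :: nat and x0 :: "real^'n" and f :: "'r \<Rightarrow> real^'n \<Rightarrow> real" and \<epsilon>0 w
    assume f: "max (real CARD('n) + 1) (real CARD('n) / 2 + 4) < real l \<and> (\<forall>r. cont_diff l (f r)) \<and>
        (\<forall>t::real^'r. t \<noteq> 0 \<longrightarrow> CARD('n) - 1 \<le> rank (hessian (\<lambda>x. \<Sum>r\<in>UNIV. t $ r * f r x) x0))"
      and w: "0 < \<epsilon>0 \<and> \<epsilon>0 \<le> eps x0 f \<and> smooth_compact_support w \<and> (\<forall>x. 0 \<le> w x) \<and>
        function_support w \<subseteq> linf_ball x0 (eps x0 f)"
    have "CARD('n) \<le> l" using f by simp
    then have cd: "cont_diff CARD('n) (f r)" for r using f cont_diff_mono by blast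
    have "\<exists>e. admissible_radius x0 f e"
      using assms f by (intro admissible_radius_exists cd) auto
    then have adm: "admissible_radius x0 f (eps x0 f)" by (rule eps_adm)
    have "\<exists>C. bound w C"
      using uniform_count_estimate[OF assms, of w, where 'r = 'r] w unfolding bound_def by blast
    then have "bound w (C w)" by (rule C_bound)
    then show "let M = graph_manifold f x0 \<epsilon>0 in
       \<forall>Q \<delta>. 2 \<le> Q \<and> 0 \<le> \<delta> \<and> \<delta> \<le> 1 / 2 \<longrightarrow>
         \<bar>weighted_count f w Q \<delta> - (2 * \<delta>) ^ CARD('r) * total_weight w Q\<bar>
           \<le> C w * (error_bound (real CARD('n)) (real CARD('r)) Q \<delta> *
                     log_factor CARD('n) 1 (real (CARD('r) + 2 * CARD('n))) Q)"
      unfolding Let_def bound_def using adm cd w by blast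
  qed (use eps_pos C_pos in \<open>auto simp: add_pos_pos\<close>)
qed

end
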